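(* Let $k$ and $n$ be positive integers. For any $g\in\mathfrak{S}_{kn}$ and any partition $\mu\vdash kn$, it holds that $$\omega^{(k^n)}_\mu(g)=\frac{f^{(k^n)}}{\mu!}\,\frac{\det_{-1/k,\,1/n}\bigl(P(g)\mathbf{1}_\mu\bigr)}{\det_{-1/(kn)}\mathbf{1}_{kn}} .$$ In particular, it holds that $$K_{(k^n)\mu}=\frac{f^{(k^n)}}{\mu!}\,\frac{\det_{-1/k,\,1/n}\mathbf{1}_\mu}{\det_{-1/(kn)}\mathbf{1}_{kn}} .$$
   Context: $\mathfrak{S}_N$ is the symmetric group on $\{1,\dots,N\}$. For $\sigma\in\mathfrak{S}_N$, $\nu(\sigma)$ is $N$ minus the number of disjoint cycles of $\sigma$ (fixed points counted as cycles), and $P(\sigma)=(\delta_{i\,\sigma(j)})_{1\le i,j\le N}$ is the permutation matrix of $\sigma$. For an $N\times N$ complex matrix $B=(b_{ij})$ and $\alpha,\beta\in\mathbb{C}$, put $$\det\nolimits_{\alpha}B=\sum_{\sigma\in\mathfrak{S}_N}\alpha^{\nu(\sigma)}\prod_{i=1}^N b_{\sigma(i)i},\qquad \det\nolimits_{\alpha,\beta}B=\sum_{\tau,\sigma\in\mathfrak{S}_N}\alpha^{\nu(\tau)}\beta^{\nu(\sigma)}\prod_{i=1}^N b_{\tau(i)\sigma(i)} .$$ $\mathbf{1}_N$ is the $N\times N$ all-one matrix. For a partition $\mu=(\mu_1,\dots,\mu_l)\vdash N$, $\mathbf{1}_\mu$ is the $N\times N$ block diagonal matrix with diagonal blocks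 $\mathbf{1}_{\mu_1},\dots,\mathbf{1}_{\mu_l}$, $\mu!=\mu_1!\mu_2!\cdots\mu_l!$, and $\mathfrak{S}_\mu=\mathfrak{S}_{\mu_1}\times\cdots\times\mathfrak{S}_{\mu_l}\subset\mathfrak{S}_N$ is the Young subgroup whose $i$-th factor consists of the permutations of the letters $m+1,\dots,m+\mu_i$ with $m=\sum_{j<i}\mu_j$. For $\lambda\vdash N$, $\chi^\lambda$ is the irreducible character of $\mathfrak{S}_N$ corresponding to $\lambda$ and $f^\lambda=\chi^\lambda(1)$ is the number of standard tableaux of shape $\lambda$. For $\lambda,\mu\vdash N$, $K_{\lambda\mu}$ is the Kostka number, i.e. the number of semistandard tableaux of shape $\lambda$ and weight $\mu$, and $$\omega^\lambda_\mu(x)=\frac1{\mu!}\sum_{\tau\in\mathfrak{S}_\mu}\chi^\lambda(x\tau)\qquad(x\in\mathfrak{S}_N).$$ $(k^n)$ denotes the partition of $kn$ with $n$ parts, all equal to $k$. *)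

theory Defs
  imports
    "Jordan_Normal_Form.Matrix"
    "HOL-Combinatorics.Permutations"
    "HOL-Combinatorics.Orbits"
    "HOL-Library.Function_Algebras"
begin

text \<open>
  The symmetric group on \<open>N\<close> letters is realised as the set of all \<open>\<sigma>\<close> with
  \<open>\<sigma> permutes {0..<N}\<close>, with composition of functions as product; letters and matrix
  indices run from \<open>0\<close> to \<open>N - 1\<close>, as in \<^theory>\<open>Jordan_Normal_Form.Matrix\<close>.
\<close>

subsection \<open>Alpha-determinants\<close>

text \<open>Fixed points \<open>i < N\<close> contribute the singleton orbit \<open>{i}\<close>.\<close>

definition num_cycles :: "nat \<Rightarrow> (nat \<Rightarrow> nat) \<Rightarrow> nat" where
  "num_cycles N \<sigma> = card (orbit \<sigma> ` {0..<N})"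

definition nu :: "nat \<Rightarrow> (nat \<Rightarrow> nat) \<Rightarrow> nat" where
  "nu N \<sigma> = N - num_cycles N \<sigma>"

definition perm_matrix :: "nat \<Rightarrow> (nat \<Rightarrow> nat) \<Rightarrow> complex mat" where
  "perm_matrix N \<sigma> = mat N N (\<lambda>(i, j). if i = \<sigma> j then 1 else 0)"

definition alpha_det :: "complex \<Rightarrow> complex mat \<Rightarrow> complex" where
  "alpha_det \<alpha> B = (let N = dim_row B in
     \<Sum>\<sigma> | \<sigma> permutes {0..<N}. \<alpha> ^ nu N \<sigma> * (\<Prod>i<N. B $$ (\<sigma> i, i)))"

definition alpha_beta_det :: "complex \<Rightarrow> complex \<Rightarrow> complex mat \<Rightarrow> complex" where
  "alpha_beta_det \<alpha> \<beta> B = (let N = dim_row B in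
     \<Sum>\<tau> | \<tau> permutes {0..<N}. \<Sum>\<sigma> | \<sigma> permutes {0..<N}.
       \<alpha> ^ nu N \<tau> * \<beta> ^ nu N \<sigma> * (\<Prod>i<N. B $$ (\<tau> i, \<sigma> i)))"

subsection \<open>Partitions and Young subgroups\<close>

definition is_partition :: "nat \<Rightarrow> nat list \<Rightarrow> bool" where
  "is_partition N \<mu> \<longleftrightarrow> sorted_wrt (\<ge>) \<mu> \<and> (\<forall>m\<in>set \<mu>. 0 < m) \<and> sum_list \<mu> = N"

definition part_fact :: "nat list \<Rightarrow> nat" where
  "part_fact \<mu> = prod_list (map fact \<mu>)"

definition ones :: "nat \<Rightarrow> complex mat" where
  "ones N = mat N N (\<lambda>_. 1)"

definition ones_part :: "nat list \<Rightarrow> complex mat" where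
  "ones_part \<mu> = diag_block_mat (map ones \<mu>)"

text \<open>
  \<open>row_set \<mu> i\<close> and \<open>col_set \<mu> j\<close> are the sets of entries in row \<open>i\<close> and column \<open>j\<close> of the
  tableau of shape \<open>\<mu>\<close> filled with \<open>0, 1, 2, \<dots>\<close> row by row. The rows of this tableau are
  the blocks of consecutive letters that define the Young subgroup.
\<close>

definition row_set :: "nat list \<Rightarrow> nat \<Rightarrow> nat set" where
  "row_set \<mu> i = (let m = sum_list (take i \<mu>) in {m..<m + \<mu> ! i})"

definition col_set :: "nat list \<Rightarrow> nat \<Rightarrow> nat set" where
  "col_set \<mu> j = {sum_list (take i \<mu>) + j | i. i < length \<mu> \<and> j < \<mu> ! i}"

definition young_subgroup :: "nat list \<Rightarrow> (nat \<Rightarrow> nat) set" where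
  "young_subgroup \<mu> = {\<sigma>. \<sigma> permutes {0..<sum_list \<mu>} \<and>
     (\<forall>i<length \<mu>. \<sigma> ` row_set \<mu> i = row_set \<mu> i)}"

definition column_subgroup :: "nat list \<Rightarrow> (nat \<Rightarrow> nat) set" where
  "column_subgroup \<mu> = {\<sigma>. \<sigma> permutes {0..<sum_list \<mu>} \<and>
     (\<forall>j. \<sigma> ` col_set \<mu> j = col_set \<mu> j)}"

subsection \<open>Irreducible characters\<close>

text \<open>
  An element \<open>\<Sum>\<^sub>y v(y) y\<close> of the complex group algebra is the function \<open>v\<close>,
  which vanishes outside of the permutations of \<open>{0..<N}\<close>.
\<close>

global_interpretation cfun: vector_space
  "\<lambda>(c::complex) (v::(nat \<Rightarrow> nat) \<Rightarrow> complex) y. c * v y"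
  by unfold_locales (auto simp: fun_eq_iff algebra_simps)

text \<open>
  Left multiplication by the group element \<open>x\<close>: the coefficient of \<open>y\<close> in \<open>x v\<close> is the
  coefficient of \<open>x\<^sup>-\<^sup>1 y\<close> in \<open>v\<close>.
\<close>

definition left_mult ::
    "(nat \<Rightarrow> nat) \<Rightarrow> ((nat \<Rightarrow> nat) \<Rightarrow> complex) \<Rightarrow> (nat \<Rightarrow> nat) \<Rightarrow> complex" where
  "left_mult x v = (\<lambda>y. v (Hilbert_Choice.inv x \<circ> y))"

text \<open>
  The Young symmetrizer \<open>(\<Sum>\<^sub>p p) (\<Sum>\<^sub>q sgn(q) q)\<close>, where \<open>p\<close> runs over the row group and
  \<open>q\<close> over the column group of the row-reading tableau of shape \<open>\<mu>\<close>. The left ideal it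
  generates is the irreducible (Specht) module labelled by \<open>\<mu>\<close>; with this convention the
  one-row shape gives the trivial and the one-column shape the sign representation.
\<close>

definition young_symmetrizer :: "nat list \<Rightarrow> (nat \<Rightarrow> nat) \<Rightarrow> complex" where
  "young_symmetrizer \<mu> = (\<lambda>y. \<Sum>p\<in>young_subgroup \<mu>. \<Sum>q\<in>column_subgroup \<mu>.
     if y = p \<circ> q then of_int (sign q) else 0)"

definition specht_module :: "nat list \<Rightarrow> ((nat \<Rightarrow> nat) \<Rightarrow> complex) set" where
  "specht_module \<mu> = cfun.span
     {left_mult x (young_symmetrizer \<mu>) | x. x permutes {0..<sum_list \<mu>}}"

text \<open>
  Trace of the linear map \<open>T\<close> on the finite-dimensional \<open>T\<close>-invariant subspace \<open>V\<close>: the sum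
  of the diagonal entries of its matrix with respect to some basis of \<open>V\<close>.
\<close>

definition trace_on :: "((nat \<Rightarrow> nat) \<Rightarrow> complex) set \<Rightarrow>
    (((nat \<Rightarrow> nat) \<Rightarrow> complex) \<Rightarrow> ((nat \<Rightarrow> nat) \<Rightarrow> complex)) \<Rightarrow> complex" where
  "trace_on V T = (let B = (SOME B. cfun.independent B \<and> cfun.span B = V) in
     \<Sum>b\<in>B. cfun.representation B (T b) b)"

definition irr_char :: "nat list \<Rightarrow> (nat \<Rightarrow> nat) \<Rightarrow> complex" where
  "irr_char \<mu> x = trace_on (specht_module \<mu>) (left_mult x)"

definition char_degree :: "nat list \<Rightarrow> complex" where
  "char_degree \<mu> = irr_char \<mu> id"

definition omega :: "nat list \<Rightarrow> nat list \<Rightarrow> (nat \<Rightarrow> nat) \<Rightarrow> complex" where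
  "omega \<kappa> \<mu> x = 1 / of_nat (part_fact \<mu>) * (\<Sum>\<tau>\<in>young_subgroup \<mu>. irr_char \<kappa> (x \<circ> \<tau>))"

subsection \<open>Kostka numbers\<close>

text \<open>A tableau is the list of its rows; its entries are the letters \<open>1, \<dots>, length \<mu>\<close>.\<close>

definition semistandard_tableaux :: "nat list \<Rightarrow> nat list \<Rightarrow> nat list list set" where
  "semistandard_tableaux \<kappa> \<mu> = {T. map length T = \<kappa> \<and>
     (\<forall>row\<in>set T. sorted row) \<and>
     (\<forall>i j. Suc i < length T \<and> j < length (T ! i) \<and> j < length (T ! Suc i)
        \<longrightarrow> T ! i ! j < T ! Suc i ! j) \<and>
     set (concat T) \<subseteq> {1..length \<mu>} \<and>
     (\<forall>i<length \<mu>. count_list (concat T) (Suc i) = \<mu> ! i)}"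

definition kostka :: "nat list \<Rightarrow> nat list \<Rightarrow> nat" where
  "kostka \<kappa> \<mu> = card (semistandard_tableaux \<kappa> \<mu>)"

end

theory Submission
  imports Defs
begin

text \<open>
  Write \<open>N = k n\<close>, and let \<open>\<Phi>\<^sub>\<alpha> = \<Sum>\<^sub>x \<alpha>^{\<nu>(x)} x\<close> in the group algebra. Up to a power of \<open>\<alpha>\<close>, the sum of
  \<open>\<alpha>^{\<nu>(x)}\<close> over a coset of the symmetric group of \<open>m\<close> letters is \<open>\<Prod>\<^sub>j\<^sub><\<^sub>m (1 + j \<alpha>)\<close>. Hence the central
  element \<open>\<Psi> = \<Phi>\<^sub>-\<^sub>1\<^sub>/\<^sub>k \<Phi>\<^sub>1\<^sub>/\<^sub>n\<close> is killed by the symmetrizer of any \<open>k + 1\<close> letters and by the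
  antisymmetrizer of any \<open>n + 1\<close> letters. Only the \<open>n \<times> k\<close> rectangle fits these constraints, so \<open>\<Psi>\<close> is
  proportional to the character of the rectangular Specht module; evaluation at the identity gives
  the constant, because \<open>\<Psi>(1)\<close> is the \<open>\<alpha>\<close>-determinant of the all-one matrix at \<open>\<alpha> = -1/N\<close>. No
  classification of irreducible representations and no hook length formula enters: an element with
  the two killing properties that is not zero survives the multiplication by the antisymmetrizer of
  \<open>k\<close> disjoint columns, and then by the symmetrizer of \<open>n\<close> disjoint rows.

  For the Kostka number, \<open>\<omega>(1)\<close> is the dimension of the space of invariants of the Young subgroup in
  the Specht module, which is spanned by elements \<open>e T\<close> for fillings \<open>T\<close> of the rectangle. The
  symmetrizer of \<open>k + 1\<close> boxes in two adjacent rows kills the Young symmetrizer by the pigeonhole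
  principle; these relations straighten \<open>e T\<close> into semistandard fillings, and comparing column
  sums shows that the semistandard ones are linearly independent.
\<close>

section \<open>Groups of permutations and colourings\<close>

unbundle no m_inv_syntax

text \<open>The killing properties concern left multiplication only, and both surviving products
  have their new factor on the left. Invariance under conjugation moves the column antisymmetrizer
  to the right, so that the row symmetrizer can act on the left. The outcome transforms trivially
  under rows on the left and by the sign under columns on the right, and every such function is a
  multiple of the Young symmetrizer \<open>c\<close>. Hence pairing with \<open>c\<close> is
  injective on the annihilated class functions, which therefore span at most a line.

  Nonvanishing comes from positivity: \<open>c\<close> has real coefficients, and both normalising
  constants, \<kappa> and the pairing of \<open>c\<close> with the sum \<open>E\<close> of its
  conjugates, reduce to sums of squares. The degree is kept as \<open>E id / \<kappa>\<close>, so
  that \<kappa> cancels when the character is divided by the degree. The trace argument behind the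
  character serves a second time for the Kostka number, with the identity map on the
  invariants.\<close>

locale perm_group =
  fixes G :: "('a \<Rightarrow> 'a) set"
  assumes finite_G: "finite G"
    and id_G: "id \<in> G"
    and comp_G: "p \<in> G \<Longrightarrow> q \<in> G \<Longrightarrow> p \<circ> q \<in> G"
    and inv_G: "p \<in> G \<Longrightarrow> inv p \<in> G"
    and bij_G: "p \<in> G \<Longrightarrow> bij p"
begin

lemma sum_left:
  assumes "p \<in> G"
  shows "(\<Sum>s\<in>G. f (p \<circ> s)) = sum f G"
proof (rule sum.reindex_bij_witness[where i = "\<lambda>s. inv p \<circ> s" and j = "\<lambda>s. p \<circ> s"])
qed (use assms in \<open>auto simp: comp_G inv_G o_assoc bij_G bij_is_surj bij_is_inj surj_iff[THEN iffD1]\<close>)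

lemma sum_right:
  assumes "p \<in> G"
  shows "(\<Sum>s\<in>G. f (s \<circ> p)) = sum f G"
proof (rule sum.reindex_bij_witness[where i = "\<lambda>s. s \<circ> inv p" and j = "\<lambda>s. s \<circ> p"])
qed (use assms in \<open>auto simp: comp_G inv_G comp_assoc bij_G bij_is_surj bij_is_inj surj_iff[THEN iffD1]\<close>)

lemma sum_inv: "(\<Sum>s\<in>G. f (inv s)) = sum f G"
proof (rule sum.reindex_bij_witness[where i = inv and j = inv])
qed (auto simp: inv_G bij_G inv_inv_eq)

end

text \<open>Row group, column group and Young subgroup are all stabilisers of a colouring: by
  \<open>b div k\<close>, by \<open>b mod k\<close> and by \<open>block\<close>. One set of
  reindexing lemmas then serves all three, and also the columns found in
  \<open>killed_colouring\<close>.\<close>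

definition stab :: "'a set \<Rightarrow> ('a \<Rightarrow> 'b) \<Rightarrow> ('a \<Rightarrow> 'a) set" where
  "stab S h = {p. p permutes S \<and> (\<forall>x\<in>S. h (p x) = h x)}"

lemma stabD:
  assumes "p \<in> stab S h"
  shows "p permutes S" "h (p x) = h x"
proof -
  show *: "p permutes S" using assms by (simp add: stab_def)
  show "h (p x) = h x"
    using assms * by (cases "x \<in> S") (auto simp: stab_def permutes_not_in)
qed

lemma stab_const: "stab S (\<lambda>_. c) = {p. p permutes S}"
  by (simp add: stab_def)

lemma stab_cong: "(\<And>x. x \<in> S \<Longrightarrow> h x = h' x) \<Longrightarrow> stab S h = stab S h'"
  unfolding stab_def by (intro Collect_cong conj_cong ball_cong refl) (simp add: permutes_in_image)

lemma perm_group_stab: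
  assumes "finite S"
  shows "perm_group (stab S h)"
proof
  show "finite (stab S h)"
    by (rule finite_subset[OF _ finite_permutations[OF assms]]) (auto simp: stab_def)
  show "id \<in> stab S h" by (simp add: stab_def permutes_id)
  show "p \<circ> q \<in> stab S h" if "p \<in> stab S h" "q \<in> stab S h" for p q
  proof -
    have "p \<circ> q permutes S" by (rule permutes_compose[OF stabD(1)[OF that(2)] stabD(1)[OF that(1)]])
    then show ?thesis by (simp add: stab_def stabD(2)[OF that(1)] stabD(2)[OF that(2)])
  qed
  show "inv p \<in> stab S h" if "p \<in> stab S h" for p
  proof -
    have "h (inv p x) = h x" for x
      using stabD(2)[OF that, of "inv p x"] permutes_inverses(1)[OF stabD(1)[OF that]] by simp
    then show ?thesis using permutes_inv[OF stabD(1)[OF that]] by (simp add: stab_def)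
  qed
  show "bij p" if "p \<in> stab S h" for p
    using that by (auto simp: stab_def permutes_bij)
qed

lemma perm_group_permutes:
  assumes "finite S"
  shows "perm_group {p. p permutes S}"
  using perm_group_stab[OF assms, of "\<lambda>_. ()"] by (simp add: stab_const)

lemma permutes_commute:
  assumes "p permutes A" "q permutes B" "A \<inter> B = {}"
  shows "p \<circ> q = q \<circ> p"
proof
  fix x
  consider "x \<in> A" | "x \<in> B" | "x \<notin> A" "x \<notin> B" by blast
  then show "(p \<circ> q) x = (q \<circ> p) x"
  proof cases
    case 1
    then have "p x \<in> A" using assms by (simp add: permutes_in_image)
    with 1 assms have "q x = x" "q (p x) = p x" by (auto intro!: permutes_not_in)
    then show ?thesis by simp
  next
    case 2
    then have "q x \<in> B" using assms by (simp add: permutes_in_image)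
    with 2 assms have "p x = x" "p (q x) = q x" by (auto intro!: permutes_not_in)
    then show ?thesis by simp
  qed (use assms in \<open>simp add: permutes_not_in\<close>)
qed

text \<open>\<open>C\<close> is a full colour class inside \<open>M\<close>, so the stabiliser is
  the direct product of the symmetric group of \<open>C\<close> and the stabiliser on the rest.
  Peeling off classes drives two inductions: the choice of columns and the order of the Young
  subgroup.\<close>

lemma sum_stab_split:
  fixes M :: "'a set"
  assumes "finite M" "C \<subseteq> M" "\<And>x. x \<in> C \<Longrightarrow> h x = i" "\<And>x. x \<in> M - C \<Longrightarrow> h x \<noteq> i"
  shows "sum f (stab M h) = (\<Sum>q\<in>stab (M - C) h. \<Sum>p | p permutes C. f (p \<circ> q))"
proof -
  define J where "J = (\<lambda>(q :: 'a \<Rightarrow> 'a, p :: 'a \<Rightarrow> 'a). p \<circ> q)"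
  \<comment> \<open>\<open>I\<close> restricts a permutation to the two pieces; it inverts
    \<open>J\<close> because a colour-preserving permutation maps \<open>C\<close> onto
    itself.\<close>
  define I where "I s = ((\<lambda>x. if x \<in> M - C then s x else x), (\<lambda>x. if x \<in> C then s x else x))"
    for s :: "'a \<Rightarrow> 'a"
  have "(\<Sum>t\<in>stab (M - C) h \<times> {p. p permutes C}. f (J t)) = sum f (stab M h)"
  proof (rule sum.reindex_bij_witness[where i = I and j = J])
    fix t assume "t \<in> stab (M - C) h \<times> {p. p permutes C}"
    then obtain q p where t: "t = (q, p)" and q: "q \<in> stab (M - C) h" and p: "p permutes C" by auto
    note q' = stabD[OF q]
    have 1: "q x = x" if "x \<notin> M - C" for x using q'(1) that by (simp add: permutes_not_in)
    have 2: "p x = x" if "x \<notin> C" for x using p that by (simp add: permutes_not_in)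
    have 3: "q x \<in> M - C" if "x \<in> M - C" for x using permutes_in_image[OF q'(1)] that by simp
    have 4: "p x \<in> C" if "x \<in> C" for x using permutes_in_image[OF p] that by simp
    have "(if x \<in> M - C then p (q x) else x) = q x" "(if x \<in> C then p (q x) else x) = p x" for x
      using 1[of x] 2[of "q x"] 2[of x] 3[of x] by auto
    moreover have Jt: "J t = p \<circ> q" by (simp add: J_def t)
    ultimately show "I (J t) = t" unfolding Jt I_def o_apply by (simp add: t del: Diff_iff)
    have "h ((p \<circ> q) x) = h x" if "x \<in> M" for x
    proof (cases "x \<in> C")
      case True
      then show ?thesis using 1[of x] 4[of x] assms(3) by auto
    next
      case False
      with that have "x \<in> M - C" by blast
      then have "p (q x) = q x" using 3 2 by auto
      then show ?thesis using q'(2) by simp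
    qed
    moreover have "p \<circ> q permutes M"
      using permutes_subset[OF p \<open>C \<subseteq> M\<close>] permutes_subset[OF q'(1)] by (auto intro: permutes_compose)
    ultimately show "J t \<in> stab M h" by (auto simp: stab_def J_def t)
  next
    fix s assume s: "s \<in> stab M h"
    note s' = stabD[OF s]
    have C: "s x \<in> C \<longleftrightarrow> x \<in> C" for x
    proof (cases "x \<in> M")
      case True
      then have "s x \<in> M" using s' by (simp add: permutes_in_image)
      then show ?thesis using True assms(2-4) s'(2)[of x] by (metis Diff_iff)
    next
      case False
      then show ?thesis using s'(1) by (simp add: permutes_not_in)
    qed
    have "s ` C \<subseteq> C" using C by auto
    moreover have "C \<subseteq> s ` C" using C s'(1) by (metis permutes_inverses(1) image_iff subsetI)
    ultimately have Cs: "s ` C = C" by blast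
    have Ds: "s ` (M - C) = M - C"
      using s'(1) Cs by (metis image_set_diff permutes_image permutes_inj)
    have inj: "inj s" using s'(1) by (rule permutes_inj)
    show "J (I s) = s"
      using C assms(2) s'(1) by (auto simp: J_def I_def fun_eq_iff permutes_not_in)
    have P: "(\<lambda>x. if x \<in> D then s x else x) permutes D" if "s ` D = D" for D
      by (rule bij_imp_permutes) (use inj that in \<open>auto simp: bij_betw_def inj_on_def\<close>)
    show "I s \<in> stab (M - C) h \<times> {p. p permutes C}"
      unfolding I_def using P[OF Cs] P[OF Ds] s'(2) by (auto simp: stab_def)
  qed auto
  then show ?thesis by (simp add: sum.cartesian_product J_def case_prod_unfold)
qed

text \<open>Transporting a colouring along \<pi> conjugates its stabiliser. Together with
  \<open>colouring_permutes\<close> this replaces an unknown partition of the letters by the rows or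
  columns of the rectangle.\<close>

lemma sum_stab_conj:
  assumes pi: "\<pi> permutes M" and h: "\<And>x. x \<in> M \<Longrightarrow> h' x = h (\<pi> x)"
  shows "sum f (stab M h) = (\<Sum>s\<in>stab M h'. f (\<pi> \<circ> s \<circ> inv \<pi>))"
proof (rule sum.reindex_bij_witness[where j = "\<lambda>s. inv \<pi> \<circ> s \<circ> \<pi>" and i = "\<lambda>s. \<pi> \<circ> s \<circ> inv \<pi>"])
  have *: "inv \<pi> permutes M" using pi by (rule permutes_inv)
  have c1: "\<pi> (inv \<pi> x) = x" "inv \<pi> (\<pi> x) = x" for x using pi by (auto simp: permutes_inverses)
  show "\<pi> \<circ> (inv \<pi> \<circ> s \<circ> \<pi>) \<circ> inv \<pi> = s" "f (\<pi> \<circ> (inv \<pi> \<circ> s \<circ> \<pi>) \<circ> inv \<pi>) = f s" for s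
    by (simp_all add: fun_eq_iff o_def c1)
  show "inv \<pi> \<circ> (\<pi> \<circ> s \<circ> inv \<pi>) \<circ> \<pi> = s" for s
    by (simp add: fun_eq_iff c1)
  have in1: "\<pi> x \<in> M \<longleftrightarrow> x \<in> M" "inv \<pi> x \<in> M \<longleftrightarrow> x \<in> M" for x
    using pi * by (simp_all add: permutes_in_image)
  show "inv \<pi> \<circ> s \<circ> \<pi> \<in> stab M h'" if "s \<in> stab M h" for s
    using stabD[OF that] pi * in1
    by (auto simp: stab_def c1 h permutes_in_image intro!: permutes_compose)
  show "\<pi> \<circ> s \<circ> inv \<pi> \<in> stab M h" if "s \<in> stab M h'" for s
  proof -
    have "h (\<pi> (s (inv \<pi> x))) = h x" if "x \<in> M" for x
    proof -
      have 1: "inv \<pi> x \<in> M" using that in1 by simp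
      moreover have "s (inv \<pi> x) \<in> M" using 1 stabD[OF \<open>s \<in> _\<close>] by (simp add: permutes_in_image)
      ultimately show ?thesis using stabD(2)[OF \<open>s \<in> _\<close>, of "inv \<pi> x"] h c1 by metis
    qed
    then show ?thesis
      using stabD(1)[OF that] pi * by (auto simp: stab_def intro!: permutes_compose)
  qed
qed

lemma sum_permutes_conj:
  fixes \<pi> :: "'a \<Rightarrow> 'a"
  assumes "bij \<pi>"
  shows "(\<Sum>p | p permutes \<pi> ` X. f p) = (\<Sum>p | p permutes X. f (\<pi> \<circ> p \<circ> inv \<pi>))"
proof (rule sum.reindex_bij_witness[where j = "\<lambda>s. inv \<pi> \<circ> s \<circ> \<pi>" and i = "\<lambda>s. \<pi> \<circ> s \<circ> inv \<pi>"])
  have c1: "\<pi> (inv \<pi> x) = x" "inv \<pi> (\<pi> x) = x" for x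
    using assms by (auto simp: bij_is_inj bij_is_surj surj_f_inv_f)
  show "\<pi> \<circ> (inv \<pi> \<circ> s \<circ> \<pi>) \<circ> inv \<pi> = s" "f (\<pi> \<circ> (inv \<pi> \<circ> s \<circ> \<pi>) \<circ> inv \<pi>) = f s" for s
    by (simp_all add: fun_eq_iff o_def c1)
  show "inv \<pi> \<circ> (\<pi> \<circ> s \<circ> inv \<pi>) \<circ> \<pi> = s" for s
    by (simp add: fun_eq_iff c1)
  have P: "\<rho> \<circ> s \<circ> \<rho>' \<in> {p. p permutes \<rho> ` Y}"
    if s: "s permutes Y" and r: "\<And>x. \<rho> (\<rho>' x) = x" "\<And>x. \<rho>' (\<rho> x) = x" for \<rho> \<rho>' :: "'a \<Rightarrow> 'a" and s Y
  proof -
    have "\<rho> (s (\<rho>' x)) = x" if "x \<notin> \<rho> ` Y" for x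
    proof -
      have "\<rho>' x \<notin> Y" using that r by (metis image_eqI)
      then show ?thesis using s r by (simp add: permutes_not_in)
    qed
    moreover have "\<exists>!x. \<rho> (s (\<rho>' x)) = y" for y
      by (rule ex1I[where a = "\<rho> (inv s (\<rho>' y))"]) (use s r in \<open>auto simp: permutes_inverses\<close>)
    ultimately show ?thesis by (auto simp: permutes_def)
  qed
  show "\<pi> \<circ> s \<circ> inv \<pi> \<in> {p. p permutes \<pi> ` X}" if "s \<in> {p. p permutes X}" for s
    using P[of s X \<pi> "inv \<pi>"] that c1 by simp
  show "inv \<pi> \<circ> s \<circ> \<pi> \<in> {p. p permutes X}" if "s \<in> {p. p permutes \<pi> ` X}" for s
    using P[of s "\<pi> ` X" "inv \<pi>" \<pi>] that c1 by (simp add: image_image)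
qed

text \<open>Inversion exchanges left and right cosets. \<open>esum_zero_of_transversals\<close>
  plays the two decompositions against each other.\<close>

lemma sum_over_permutations_insert':
  assumes "finite S" "a \<notin> S"
  shows "sum f {p. p permutes insert a S} =
    (\<Sum>b\<in>insert a S. \<Sum>q | q permutes S. f (q \<circ> transpose a b))"
proof -
  have "sum f {p. p permutes insert a S} = (\<Sum>p | p permutes insert a S. f (inv p))"
    by (rule sum_permutations_inverse)
  also have "\<dots> = (\<Sum>b\<in>insert a S. \<Sum>q | q permutes S. f (inv (transpose a b \<circ> q)))"
    by (rule sum_over_permutations_insert[OF assms])
  also have "\<dots> = (\<Sum>b\<in>insert a S. \<Sum>q | q permutes S. f (inv q \<circ> transpose a b))"
    by (intro sum.cong refl) (auto simp: o_inv_distrib permutes_bij)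
  also have "\<dots> = (\<Sum>b\<in>insert a S. \<Sum>q | q permutes S. f (q \<circ> transpose a b))"
    by (intro sum.cong refl sum_permutations_inverse[symmetric])
  finally show ?thesis .
qed

section \<open>The statistic \<open>\<nu>\<close> on cosets\<close>

lemma orbit_eqI_mem:
  assumes "permutation f" "y \<in> orbit f x"
  shows "orbit f y = orbit f x"
  using orbit_cyclic_eq3[OF cyclic_on_orbit'[OF assms(1)] assms(2)] .

text \<open>Since \<open>g\<close> fixes \<open>y\<close>, the transposition inserts
  \<open>y\<close> into the cycle of \<open>y'\<close>, immediately before \<open>y'\<close>, and
  leaves the other cycles alone.\<close>

lemma orbit_transpose_comp:
  assumes g: "permutation g" and gy: "g y = y" and ne: "y \<noteq> y'"
  defines "h \<equiv> transpose y y' \<circ> g"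
  shows "orbit h x = (if x \<in> insert y (orbit g y') then insert y (orbit g y') else orbit g x)"
proof -
  let ?O = "orbit g y'"
  have h: "permutation h" unfolding h_def using g by (simp add: permutation_compose permutation_swap_id)
  have inj: "g a = g b \<longleftrightarrow> a = b" for a b
    using permutation_bijective[OF g] by (auto dest: bij_is_inj injD)
  have y'O: "y' \<in> ?O" using g by (rule permutation_self_in_orbit)
  have yO: "y \<notin> ?O"
  proof
    assume "y \<in> ?O"
    then have "orbit g y = ?O" using g by (intro orbit_eqI_mem)
    moreover have "orbit g y = {y}" using gy by (simp add: orbit_eq_singleton_iff)
    ultimately show False using y'O ne by auto
  qed
  have hy: "h y = y'" by (simp add: h_def gy)
  have hz: "h z = (if g z = y' then y else g z)" if "z \<noteq> y" for z
    using that gy inj[of z y] by (auto simp: h_def transpose_def)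
  have sub: "orbit h y \<subseteq> insert y ?O"
  proof
    fix z assume "z \<in> orbit h y"
    then show "z \<in> insert y ?O"
    proof induction
      case base then show ?case using hy y'O by simp
    next
      case (step z)
      then show ?case using hz[of z] hy y'O by (cases "z = y") (auto intro: orbit.step)
    qed
  qed
  have y'h: "y' \<in> orbit h y" using orbit.base[of h y] hy by simp
  have "?O \<subseteq> orbit h y"
  proof
    fix z assume "z \<in> ?O"
    then show "z \<in> orbit h y"
    proof induction
      case base
      then show ?case using y'h hz[of y'] orbit.step[OF y'h] ne by (cases "g y' = y'") auto
    next
      case (step z)
      then have "z \<noteq> y" using yO by auto
      then show ?case using orbit.step[OF step.IH] hz[of z] y'h by (cases "g z = y'") auto
    qed
  qed
  then have eq: "orbit h y = insert y ?O"
    using sub permutation_self_in_orbit[OF h, of y] by blast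
  show ?thesis
  proof (cases "x \<in> insert y ?O")
    case True
    then show ?thesis using orbit_eqI_mem[OF h, of x y] eq by simp
  next
    case False
    have "orbit h x = orbit g x"
    proof (rule orbit_cong)
      show "x \<in> orbit g x" using g by (rule permutation_self_in_orbit)
    next
      fix s assume s: "s \<in> orbit g x"
      have "s \<noteq> y"
      proof
        assume "s = y"
        then have "orbit g y = orbit g x" using s g by (intro orbit_eqI_mem) auto
        then have "x \<in> {y}" using permutation_self_in_orbit[OF g, of x] gy
          by (metis orbit_eq_singleton_iff)
        then show False using False by simp
      qed
      moreover have "g s \<noteq> y'"
      proof
        assume "g s = y'"
        then have "y' \<in> orbit g x" using s by (metis orbit.step)
        then have "?O = orbit g x" using g by (intro orbit_eqI_mem)
        then show False using False permutation_self_in_orbit[OF g, of x] by auto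
      qed
      ultimately show "h s = g s" using hz by simp
    qed
    then show ?thesis using False by simp
  qed
qed

lemma num_cycles_le: "num_cycles N p \<le> N"
  unfolding num_cycles_def using card_image_le[of "{0..<N}" "orbit p"] by simp

text \<open>A fixed point and a cycle merge, so exactly one cycle is lost. The inductions over
  inserted letters rest on this.\<close>

lemma nu_transpose_comp:
  assumes g: "g permutes {0..<N}" and gy: "g y = y" and ne: "y \<noteq> y'" and yN: "y < N" "y' < N"
  shows "nu N (transpose y y' \<circ> g) = Suc (nu N g)"
proof -
  let ?h = "transpose y y' \<circ> g" and ?O = "orbit g y'"
  have g': "permutation g" using g by (auto simp: permutation_permutes)
  define Z where "Z = {x \<in> {0..<N}. x \<notin> insert y ?O}"
  have N: "{0..<N} = insert y (?O \<union> Z)"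
    using permutes_orbit_subset[OF g, of y'] yN unfolding Z_def by auto
  have y'O: "y' \<in> ?O" using g' by (rule permutation_self_in_orbit)
  have oy: "orbit g y = {y}" using gy by (simp add: orbit_eq_singleton_iff)
  have yO: "y \<notin> ?O"
  proof
    assume "y \<in> ?O"
    then have "orbit g y = ?O" using g' by (intro orbit_eqI_mem)
    then show False using y'O ne oy by auto
  qed
  have imO: "orbit g ` ?O = {?O}"
  proof -
    have "orbit g z = ?O" if "z \<in> ?O" for z using orbit_eqI_mem[OF g' that] .
    then have "orbit g ` ?O = (\<lambda>_. ?O) ` ?O" by (intro image_cong refl)
    also have "\<dots> = {?O}" using y'O by blast
    finally show ?thesis .
  qed
  have zin: "z \<in> orbit g z" for z using g' by (rule permutation_self_in_orbit)
  have hz: "orbit ?h x = (if x \<in> insert y ?O then insert y ?O else orbit g x)" for x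
    by (rule orbit_transpose_comp[OF g' gy ne])
  have "orbit g ` {0..<N} = insert {y} (insert ?O (orbit g ` Z))"
    unfolding N image_insert image_Un imO oy by simp
  moreover have "orbit ?h ` {0..<N} = insert (insert y ?O) (orbit g ` Z)"
  proof -
    have "orbit ?h ` Z = orbit g ` Z" by (rule image_cong) (auto simp: hz Z_def)
    moreover have "orbit ?h ` insert y ?O = {insert y ?O}"
    proof -
      have "orbit ?h ` insert y ?O = (\<lambda>_. insert y ?O) ` insert y ?O" by (intro image_cong refl) (simp add: hz)
      then show ?thesis by (simp only: image_constant_conv) simp
    qed
    moreover have "{0..<N} = insert y ?O \<union> Z" unfolding N by blast
    ultimately show ?thesis by (simp only: image_Un) simp
  qed
  moreover have "{y} \<notin> insert ?O (orbit g ` Z)" using yO zin y'O ne Z_def by auto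
  moreover have "?O \<notin> orbit g ` Z"
  proof
    assume "?O \<in> orbit g ` Z"
    then obtain z where "z \<in> Z" "?O = orbit g z" by auto
    then show False using zin[of z] by (auto simp: Z_def)
  qed
  moreover have "insert y ?O \<notin> orbit g ` Z"
  proof
    assume "insert y ?O \<in> orbit g ` Z"
    then obtain z where "z \<in> Z" "insert y ?O = orbit g z" by auto
    then show False using zin[of z] by (auto simp: Z_def)
  qed
  moreover have "finite Z" by (simp add: Z_def)
  ultimately have "num_cycles N g = Suc (num_cycles N ?h)" by (simp add: num_cycles_def)
  then show ?thesis using num_cycles_le[of N g] by (simp add: nu_def)
qed

lemma nu_id: "nu N id = 0"
proof -
  have "orbit id x = {x}" for x :: nat by (simp add: orbit_eq_singleton_iff)
  then have "inj (orbit (id :: nat \<Rightarrow> nat))" by (simp add: inj_def)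
  then have "num_cycles N id = N" unfolding num_cycles_def by (simp add: card_image inj_on_subset)
  then show ?thesis by (simp add: nu_def)
qed

lemma nu_inv:
  assumes "p permutes {0..<N}"
  shows "nu N (inv p) = nu N p"
proof -
  have "permutation p" using assms by (auto simp: permutation_permutes)
  then show ?thesis by (simp add: nu_def num_cycles_def orbit_inv_eq)
qed

lemma nu_conj:
  assumes p: "p permutes {0..<N}" and g: "g permutes {0..<N}"
  shows "nu N (g \<circ> p \<circ> inv g) = nu N p"
proof -
  have g1: "inv g (g x) = x" "g (inv g x) = x" for x using g by (simp_all add: permutes_inverses)
  have p': "permutation p" using p by (auto simp: permutation_permutes)
  have o: "orbit (g \<circ> p \<circ> inv g) (g x) = g ` orbit p x" for x
    using orbit_inverse[of x p "g \<circ> p \<circ> inv g" g] permutation_self_in_orbit[OF p'] g1 by simp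
  have "orbit (g \<circ> p \<circ> inv g) ` {0..<N} = orbit (g \<circ> p \<circ> inv g) ` (g ` {0..<N})"
    using permutes_image[OF g] by simp
  also have "\<dots> = (`) g ` (orbit p ` {0..<N})"
    by (simp add: image_image o del: o_apply)
  finally have "num_cycles N (g \<circ> p \<circ> inv g) = num_cycles N p"
    unfolding num_cycles_def
    using permutes_inj[OF g] by (simp add: card_image inj_on_def inj_image_eq_iff)
  then show ?thesis by (simp add: nu_def)
qed

text \<open>Turns a sign twist into a change of sign of \<alpha>, which reduces antisymmetrizers at
  \<open>1 / n\<close> to symmetrizers at \<open>- 1 / n\<close>.\<close>

lemma sign_nu:
  assumes "p permutes {0..<N}"
  shows "sign p = (-1) ^ nu N p"
proof -
  have "finite S \<Longrightarrow> S \<subseteq> {0..<N} \<Longrightarrow> p permutes S \<Longrightarrow> sign p = (-1) ^ nu N p" for S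
  proof (induction S arbitrary: p rule: finite_induct)
    case empty
    then have "p = id" by simp
    then show ?case by (simp only: sign_id nu_id) simp
  next
    case (insert a S)
    from insert.prems(2) have "p \<in> {p. p permutes insert a S}" by simp
    then obtain b q where b: "b \<in> insert a S" and q: "q permutes S" and p: "p = transpose a b \<circ> q"
      unfolding permutes_insert by auto
    have IH: "sign q = (-1) ^ nu N q" using insert q by simp
    have q': "q permutes {0..<N}" using q insert.prems by (auto intro: permutes_subset)
    have qa: "q a = a" using q insert.hyps by (simp add: permutes_not_in)
    show "sign p = (-1) ^ nu N p"
    proof (cases "a = b")
      case True
      then show ?thesis using IH p by simp
    next
      case False
      have "sign p = sign (transpose a b) * sign q"
        unfolding p using q' by (intro sign_compose permutation_swap_id) (auto simp: permutation_permutes)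
      moreover have "nu N p = Suc (nu N q)"
        unfolding p using b insert.prems(1) False by (intro nu_transpose_comp q' qa) auto
      ultimately show ?thesis using IH False by (simp add: sign_swap_id)
    qed
  qed
  from this[OF _ subset_refl assms] show ?thesis by simp
qed

text \<open>A new letter is either fixed, contributing 1, or inserted before one of the
  \<open>card X\<close> earlier letters, contributing \<alpha> each time.\<close>

lemma sum_power_nu_permutes:
  fixes \<alpha> :: "'a :: comm_ring_1"
  assumes "finite X" "X \<subseteq> {0..<N}"
  shows "(\<Sum>s | s permutes X. \<alpha> ^ nu N s) = (\<Prod>j<card X. 1 + of_nat j * \<alpha>)"
  using assms
proof (induction X rule: finite_induct)
  case empty
  have "{s :: nat \<Rightarrow> nat. s permutes {}} = {id}" by auto
  then show "(\<Sum>s | s permutes {}. \<alpha> ^ nu N s) = (\<Prod>j<card ({} :: nat set). 1 + of_nat j * \<alpha>)"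
    by (simp only: card.empty) (simp add: nu_id)
next
  case (insert a X)
  have *: "(\<Sum>q | q permutes X. \<alpha> ^ nu N (transpose a b \<circ> q)) =
      (if b = a then 1 else \<alpha>) * (\<Sum>q | q permutes X. \<alpha> ^ nu N q)" if "b \<in> insert a X" for b
  proof (cases "b = a")
    case False
    have "nu N (transpose a b \<circ> q) = Suc (nu N q)" if "q permutes X" for q
    proof (rule nu_transpose_comp)
      show "q permutes {0..<N}" using that insert.prems by (auto intro: permutes_subset)
      show "q a = a" using that insert.hyps by (simp add: permutes_not_in)
    qed (use False \<open>b \<in> _\<close> insert.prems in auto)
    then show ?thesis using False by (simp add: sum_distrib_left)
  qed simp
  have "(\<Sum>s | s permutes insert a X. \<alpha> ^ nu N s) =
      (\<Sum>b\<in>insert a X. if b = a then 1 else \<alpha>) * (\<Sum>q | q permutes X. \<alpha> ^ nu N q)"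
    unfolding sum_over_permutations_insert[OF insert.hyps] sum_distrib_right
    by (rule sum.cong[OF refl *])
  also have "(\<Sum>b\<in>insert a X. if b = a then 1 else \<alpha>) = 1 + (\<Sum>b\<in>X. \<alpha>)"
  proof -
    have "(\<Sum>b\<in>X. if b = a then 1 else \<alpha>) = (\<Sum>b\<in>X. \<alpha>)"
      using insert.hyps by (intro sum.cong) auto
    then show ?thesis using insert.hyps by simp
  qed
  finally have 1: "(\<Sum>s | s permutes insert a X. \<alpha> ^ nu N s) =
      (1 + of_nat (card X) * \<alpha>) * (\<Prod>j<card X. 1 + of_nat j * \<alpha>)"
    using insert.IH insert.prems by simp
  have 2: "(\<Prod>j<card (insert a X). 1 + of_nat j * \<alpha>) =
      (\<Prod>j<card X. 1 + of_nat j * \<alpha>) * (1 + of_nat (card X) * \<alpha>)"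
    unfolding card_insert_disjoint[OF insert.hyps] by (rule prod.lessThan_Suc)
  show "(\<Sum>s | s permutes insert a X. \<alpha> ^ nu N s) = (\<Prod>j<card (insert a X). 1 + of_nat j * \<alpha>)"
    unfolding 1 2 by (rule mult.commute)
qed

text \<open>The exponent is left open because only the zeros of the product matter. Letters outside
  \<open>X\<close> are stripped from \<open>g\<close> one by one, each costing a factor \<alpha> if
  it is moved; in the end \<open>g\<close> permutes \<open>X\<close> and the coset is the whole
  group.\<close>

lemma sum_power_nu_coset:
  fixes \<alpha> :: "'a :: comm_ring_1"
  assumes X: "X \<subseteq> {0..<N}" and g: "g permutes {0..<N}"
  shows "\<exists>m. (\<Sum>s | s permutes X. \<alpha> ^ nu N (g \<circ> s)) = \<alpha> ^ m * (\<Prod>j<card X. 1 + of_nat j * \<alpha>)"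
proof -
  have fX: "finite X" using X by (rule finite_subset) simp
  have "finite Y \<Longrightarrow> X \<inter> Y = {} \<Longrightarrow> X \<union> Y \<subseteq> {0..<N} \<Longrightarrow> g permutes X \<union> Y \<Longrightarrow> ?thesis" for Y
  proof (induction Y arbitrary: g rule: finite_induct)
    case empty
    interpret perm_group "{s. s permutes X}" using fX by (rule perm_group_permutes)
    show "\<exists>m. (\<Sum>s | s permutes X. \<alpha> ^ nu N (g \<circ> s)) = \<alpha> ^ m * (\<Prod>j<card X. 1 + of_nat j * \<alpha>)"
      using sum_left[of g "\<lambda>s. \<alpha> ^ nu N s"] empty sum_power_nu_permutes[OF fX X, of \<alpha>]
      by (intro exI[of _ 0]) simp
  next
    case (insert y Y)
    from insert.prems(3) have "g \<in> {p. p permutes insert y (X \<union> Y)}" by simp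
    then obtain b q where b: "b \<in> insert y (X \<union> Y)" and q: "q permutes X \<union> Y" and g: "g = transpose y b \<circ> q"
      unfolding permutes_insert by auto
    have IH: "\<exists>m. (\<Sum>s | s permutes X. \<alpha> ^ nu N (q \<circ> s)) = \<alpha> ^ m * (\<Prod>j<card X. 1 + of_nat j * \<alpha>)"
    proof (rule insert.IH)
      show "X \<inter> Y = {}" "X \<union> Y \<subseteq> {0..<N}" using insert.prems(1,2) by blast+
    qed (fact q)
    show "\<exists>m. (\<Sum>s | s permutes X. \<alpha> ^ nu N (g \<circ> s)) = \<alpha> ^ m * (\<Prod>j<card X. 1 + of_nat j * \<alpha>)"
    proof (cases "y = b")
      case True
      then show ?thesis using IH g by simp
    next
      case False
      have "nu N (g \<circ> s) = Suc (nu N (q \<circ> s))" if s: "s permutes X" for s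
        unfolding g comp_assoc
      proof (rule nu_transpose_comp)
        have s': "s permutes X \<union> Y" using s by (rule permutes_subset) simp
        have "q \<circ> s permutes X \<union> Y" by (rule permutes_compose[OF s' q])
        then show "q \<circ> s permutes {0..<N}" by (rule permutes_subset) (use insert.prems in auto)
        have "y \<notin> X \<union> Y" using insert by auto
        then show "(q \<circ> s) y = y" using q s' by (simp add: permutes_not_in)
      qed (use False b insert.prems in auto)
      then have "(\<Sum>s | s permutes X. \<alpha> ^ nu N (g \<circ> s)) = \<alpha> * (\<Sum>s | s permutes X. \<alpha> ^ nu N (q \<circ> s))"
        by (simp add: sum_distrib_left)
      moreover obtain m where "(\<Sum>s | s permutes X. \<alpha> ^ nu N (q \<circ> s)) = \<alpha> ^ m * (\<Prod>j<card X. 1 + of_nat j * \<alpha>)"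
        using IH by blast
      ultimately show ?thesis by (intro exI[of _ "Suc m"]) (simp add: mult.assoc)
    qed
  qed
  from this[of "{0..<N} - X"] show ?thesis using X g by (auto simp: Un_absorb1)
qed

section \<open>Elements killed by symmetrizers and antisymmetrizers\<close>

text \<open>\<open>e\<close> and \<open>d\<close> stand for the trivial and the sign character in
  either order: the same construction first splits off columns and later, with the roles exchanged,
  rows.\<close>

locale char_pair =
  fixes e d :: "(nat \<Rightarrow> nat) \<Rightarrow> complex"
  assumes e_comp: "permutation p \<Longrightarrow> permutation q \<Longrightarrow> e (p \<circ> q) = e p * e q"
    and d_comp: "permutation p \<Longrightarrow> permutation q \<Longrightarrow> d (p \<circ> q) = d p * d q"
    and e_id: "e id = 1" and d_id: "d id = 1"
    and d_swap: "a \<noteq> b \<Longrightarrow> d (transpose a b) = - e (transpose a b)"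
begin

lemma perm_of_permutes: "p permutes X \<Longrightarrow> finite X \<Longrightarrow> permutation p"
  by (auto simp: permutation_permutes)

lemma e_conj:
  assumes "permutation p" "permutation s"
  shows "e (s \<circ> p \<circ> inv s) = e p"
proof -
  have s': "permutation (inv s)" using assms(2) by (rule permutation_inverse)
  have 1: "e s * e (inv s) = 1"
    using e_comp[OF assms(2) s'] e_id permutation_inverse_works(2)[OF assms(2)] by simp
  have "e (s \<circ> p \<circ> inv s) = e s * e p * e (inv s)"
    using assms s' by (simp add: e_comp permutation_compose)
  also have "\<dots> = e p" using 1 by (simp add: algebra_simps)
  finally show ?thesis .
qed

definition esum :: "nat set \<Rightarrow> ((nat \<Rightarrow> nat) \<Rightarrow> complex) \<Rightarrow> (nat \<Rightarrow> nat) \<Rightarrow> complex" where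
  "esum X v y = (\<Sum>s | s permutes X. e s * v (s \<circ> y))"

definition dsum :: "nat set \<Rightarrow> ((nat \<Rightarrow> nat) \<Rightarrow> complex) \<Rightarrow> (nat \<Rightarrow> nat) \<Rightarrow> complex" where
  "dsum X v y = (\<Sum>s | s permutes X. d s * v (s \<circ> y))"

text \<open>Split the group of \<open>insert x C\<close> into cosets of the group of
  \<open>C\<close>. The trivial coset gives \<open>dsum C v\<close>, the others carry
  \<open>d\<close> of a transposition, which is minus \<open>e\<close>. So a vanishing total means
  that \<open>dsum C v\<close> absorbs the \<open>e\<close>-weighted sum of the transpositions of
  \<open>x\<close> with \<open>C\<close>.\<close>

lemma dsum_insert_zero:
  assumes "finite C" "x \<notin> C" and zero: "dsum (insert x C) v y = 0"
  shows "(\<Sum>c\<in>C. e (transpose x c) * dsum C v (transpose x c \<circ> y)) = dsum C v y"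
proof -
  have "0 = (\<Sum>b\<in>insert x C. \<Sum>q | q permutes C. d (q \<circ> transpose x b) * v (q \<circ> transpose x b \<circ> y))"
    using zero unfolding dsum_def sum_over_permutations_insert'[OF assms(1,2)] by simp
  also have "\<dots> = (\<Sum>b\<in>insert x C. d (transpose x b) * dsum C v (transpose x b \<circ> y))"
    unfolding dsum_def sum_distrib_left
  proof (intro sum.cong refl)
    fix b q assume "q \<in> {q. q permutes C}"
    then have "permutation q" using assms(1) perm_of_permutes by auto
    then show "d (q \<circ> transpose x b) * v (q \<circ> transpose x b \<circ> y) =
        d (transpose x b) * (d q * v (q \<circ> (transpose x b \<circ> y)))"
      by (simp add: d_comp permutation_swap_id comp_assoc)
  qed
  also have "\<dots> = dsum C v y + (\<Sum>c\<in>C. d (transpose x c) * dsum C v (transpose x c \<circ> y))"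
    using assms(1,2) d_id by simp
  also have "(\<Sum>c\<in>C. d (transpose x c) * dsum C v (transpose x c \<circ> y)) =
      - (\<Sum>c\<in>C. e (transpose x c) * dsum C v (transpose x c \<circ> y))"
    unfolding sum_negf[symmetric]
  proof (rule sum.cong[OF refl])
    fix c assume "c \<in> C"
    then have "x \<noteq> c" using assms(2) by auto
    then show "d (transpose x c) * dsum C v (transpose x c \<circ> y) = - (e (transpose x c) * dsum C v (transpose x c \<circ> y))"
      by (simp add: d_swap)
  qed
  finally show ?thesis by simp
qed

text \<open>Add up \<open>zero\<close> over all \<open>c\<close>. The terms with
  \<open>b = c\<close> give \<open>card C\<close> copies of \<open>w\<close>; for each
  \<open>b\<close> in \<open>X\<close> the sum over \<open>c\<close> is one more copy, by
  \<open>absorb\<close>. The total is \<open>card C + card X\<close> times the claim.\<close>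

lemma esum_zero_of_transversals:
  assumes fin: "finite C" "finite X" and disj: "C \<inter> X = {}" and ne: "C \<noteq> {} \<or> X \<noteq> {}"
    and absorb: "\<And>x y. x \<in> X \<Longrightarrow> (\<Sum>c\<in>C. e (transpose x c) * w (transpose x c \<circ> y)) = w y"
    and zero: "\<And>c y. c \<in> C \<Longrightarrow> esum (insert c X) w y = 0"
  shows "esum X w y = 0"
proof -
  have "0 = (\<Sum>c\<in>C. esum (insert c X) w y)" using zero by simp
  also have "\<dots> = (\<Sum>c\<in>C. \<Sum>b\<in>insert c X. \<Sum>q | q permutes X. e (q \<circ> transpose c b) * w (q \<circ> transpose c b \<circ> y))"
    unfolding esum_def using disj fin by (intro sum.cong refl sum_over_permutations_insert') auto
  \<comment> \<open>The transposition must come directly under \<open>w\<close> for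
    \<open>absorb\<close> to apply, so the other coset decomposition of the same sum is
    used.\<close>
  also have "\<dots> = (\<Sum>c\<in>C. \<Sum>b\<in>insert c X. \<Sum>q | q permutes X. e (transpose c b \<circ> q) * w (transpose c b \<circ> q \<circ> y))"
  proof (rule sum.cong[OF refl])
    fix c assume c: "c \<in> C"
    then have "c \<notin> X" using disj by auto
    then show "(\<Sum>b\<in>insert c X. \<Sum>q | q permutes X. e (q \<circ> transpose c b) * w (q \<circ> transpose c b \<circ> y)) =
       (\<Sum>b\<in>insert c X. \<Sum>q | q permutes X. e (transpose c b \<circ> q) * w (transpose c b \<circ> q \<circ> y))"
      using sum_over_permutations_insert'[OF fin(2), of c "\<lambda>s. e s * w (s \<circ> y)"]
        sum_over_permutations_insert[OF fin(2), of c "\<lambda>s. e s * w (s \<circ> y)"] by simp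
  qed
  also have "\<dots> = (\<Sum>c\<in>C. \<Sum>b\<in>insert c X. \<Sum>q | q permutes X. e q * (e (transpose c b) * w (transpose c b \<circ> (q \<circ> y))))"
  proof (intro sum.cong refl)
    fix c b q assume "q \<in> {q. q permutes X}"
    then have "permutation q" using fin perm_of_permutes by auto
    then show "e (transpose c b \<circ> q) * w (transpose c b \<circ> q \<circ> y) =
        e q * (e (transpose c b) * w (transpose c b \<circ> (q \<circ> y)))"
      by (simp add: e_comp permutation_swap_id comp_assoc)
  qed
  also have "\<dots> = (\<Sum>c\<in>C. \<Sum>q | q permutes X. \<Sum>b\<in>insert c X. e q * (e (transpose c b) * w (transpose c b \<circ> (q \<circ> y))))"
    by (intro sum.cong refl sum.swap)
  also have "\<dots> = (\<Sum>q | q permutes X. \<Sum>c\<in>C. \<Sum>b\<in>insert c X. e q * (e (transpose c b) * w (transpose c b \<circ> (q \<circ> y))))"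
    by (rule sum.swap)
  also have "\<dots> = (\<Sum>q | q permutes X. e q * (of_nat (card C + card X) * w (q \<circ> y)))"
  proof (rule sum.cong[OF refl])
    fix q :: "nat \<Rightarrow> nat"
    let ?z = "q \<circ> y"
    have "(\<Sum>c\<in>C. \<Sum>b\<in>insert c X. e (transpose c b) * w (transpose c b \<circ> ?z)) =
        (\<Sum>c\<in>C. w ?z + (\<Sum>b\<in>X. e (transpose c b) * w (transpose c b \<circ> ?z)))"
    proof (rule sum.cong[OF refl])
      fix c assume "c \<in> C"
      then have "c \<notin> X" using disj by auto
      then show "(\<Sum>b\<in>insert c X. e (transpose c b) * w (transpose c b \<circ> ?z)) =
          w ?z + (\<Sum>b\<in>X. e (transpose c b) * w (transpose c b \<circ> ?z))"
        using fin(2) e_id by simp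
    qed
    also have "\<dots> = of_nat (card C) * w ?z + (\<Sum>b\<in>X. \<Sum>c\<in>C. e (transpose c b) * w (transpose c b \<circ> ?z))"
      by (simp add: sum.distrib sum.swap[of _ X C] del: o_apply)
    also have "(\<Sum>b\<in>X. \<Sum>c\<in>C. e (transpose c b) * w (transpose c b \<circ> ?z)) = (\<Sum>b\<in>X. w ?z)"
    proof (rule sum.cong[OF refl])
      fix b assume "b \<in> X"
      show "(\<Sum>c\<in>C. e (transpose c b) * w (transpose c b \<circ> ?z)) = w ?z"
        using absorb[OF \<open>b \<in> X\<close>, of ?z] by (simp only: transpose_commute)
    qed
    finally show "(\<Sum>c\<in>C. \<Sum>b\<in>insert c X. e q * (e (transpose c b) * w (transpose c b \<circ> ?z))) =
        e q * (of_nat (card C + card X) * w ?z)"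
      by (simp add: sum_distrib_left[symmetric] algebra_simps del: o_apply)
  qed
  also have "\<dots> = of_nat (card C + card X) * esum X w y"
    unfolding esum_def sum_distrib_left by (intro sum.cong refl) simp
  finally have "of_nat (card C + card X) * esum X w y = 0" by simp
  moreover have "card C + card X \<noteq> 0" using fin ne by auto
  ultimately show ?thesis by (metis mult_eq_0_iff of_nat_eq_0_iff)
qed

text \<open>Moving the \<open>e\<close>-sum past \<open>s\<close> conjugates it to the image of
  \<open>Y\<close> under \<open>s\<close>. Relations that hold for all letter sets of a given size
  thus survive \<open>dsum\<close>.\<close>

lemma esum_dsum_zero:
  assumes fin: "finite C" "finite Y"
    and zero: "\<And>s y. s permutes C \<Longrightarrow> esum (s ` Y) v y = 0"
  shows "esum Y (dsum C v) y = 0"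
proof -
  have "esum Y (dsum C v) y = (\<Sum>p | p permutes Y. \<Sum>s | s permutes C. d s * (e p * v (s \<circ> p \<circ> y)))"
    unfolding esum_def dsum_def sum_distrib_left
    by (intro sum.cong refl) (simp add: comp_assoc mult.left_commute)
  also have "\<dots> = (\<Sum>s | s permutes C. \<Sum>p | p permutes Y. d s * (e p * v (s \<circ> p \<circ> y)))"
    by (rule sum.swap)
  also have "\<dots> = (\<Sum>s | s permutes C. d s * esum (s ` Y) v (s \<circ> y))"
    unfolding sum_distrib_left[symmetric]
  proof (intro sum.cong refl)
    fix s assume "s \<in> {s. s permutes C}"
    then have s: "s permutes C" by simp
    have ps: "permutation s" using s fin perm_of_permutes by auto
    have "esum (s ` Y) v (s \<circ> y) =
        (\<Sum>p | p permutes Y. e (s \<circ> p \<circ> inv s) * v (s \<circ> p \<circ> inv s \<circ> (s \<circ> y)))"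
      unfolding esum_def by (rule sum_permutes_conj[OF permutes_bij[OF s]])
    also have "\<dots> = (\<Sum>p | p permutes Y. e p * v (s \<circ> p \<circ> y))"
    proof (intro sum.cong refl)
      fix p assume "p \<in> {p. p permutes Y}"
      then have "permutation p" using fin perm_of_permutes by auto
      moreover have "s \<circ> p \<circ> inv s \<circ> (s \<circ> y) = s \<circ> p \<circ> y"
        using permutes_inverses(2)[OF s] by (simp add: fun_eq_iff)
      ultimately show "e (s \<circ> p \<circ> inv s) * v (s \<circ> p \<circ> inv s \<circ> (s \<circ> y)) = e p * v (s \<circ> p \<circ> y)"
        using e_conj[OF _ ps] by simp
    qed
    finally show "d s * (\<Sum>p | p permutes Y. e p * v (s \<circ> p \<circ> y)) = d s * esum (s ` Y) v (s \<circ> y)"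
      by simp
  qed
  also have "\<dots> = 0" using zero by simp
  finally show ?thesis .
qed

definition killed :: "nat set \<Rightarrow> nat \<Rightarrow> nat \<Rightarrow> ((nat \<Rightarrow> nat) \<Rightarrow> complex) \<Rightarrow> bool" where
  "killed M k n v \<longleftrightarrow>
    (\<forall>X y. X \<subseteq> M \<longrightarrow> card X = Suc k \<longrightarrow> esum X v y = 0) \<and>
    (\<forall>C y. C \<subseteq> M \<longrightarrow> card C = Suc n \<longrightarrow> dsum C v y = 0)"

end

lemma char_pair_one_sign: "char_pair (\<lambda>_. 1) (\<lambda>p. of_int (sign p))"
  by unfold_locales (auto simp: sign_compose sign_swap_id)

lemma char_pair_sign_one: "char_pair (\<lambda>p. of_int (sign p)) (\<lambda>_. 1)"
  by unfold_locales (auto simp: sign_compose sign_swap_id)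

context char_pair
begin

lemma dsum_empty: "dsum {} v = v"
proof
  fix y
  have "{s :: nat \<Rightarrow> nat. s permutes {}} = {id}" by auto
  then show "dsum {} v y = v y" by (simp add: dsum_def d_id)
qed

text \<open>
  \<open>C\<close> is chosen as large as possible with \<open>dsum C v \<noteq> 0\<close>. Summing the killing relation of
  \<open>insert c X\<close> over all \<open>c \<in> C\<close> then yields a nonzero multiple of the one of \<open>X\<close>.
\<close>

lemma killed_step:
  assumes fin: "finite M" and killed: "killed M (Suc k) n v" and ne: "v y0 \<noteq> 0"
  obtains C where "C \<subseteq> M" "card C \<le> n" "\<exists>y. dsum C v y \<noteq> 0" "killed (M - C) k n (dsum C v)"
proof -
  let ?P = "\<lambda>C. C \<subseteq> M \<and> card C \<le> n \<and> (\<exists>y. dsum C v y \<noteq> 0)"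
  have 0: "?P {}" using ne by (auto simp: dsum_empty)
  have "\<exists>C. ?P C \<and> (\<forall>C'. ?P C' \<longrightarrow> card C' \<le> card C)"
    by (rule Lattices_Big.ex_has_greatest_nat[of ?P, OF 0, of card "Suc n"]) auto
  then obtain C where C: "?P C" and max: "\<And>C'. ?P C' \<Longrightarrow> card C' \<le> card C"
    by metis
  have finC: "finite C" using C fin finite_subset by blast
  have kd: "dsum C' v y = 0" if "C' \<subseteq> M" "card C' = Suc n" for C' y
    using killed that unfolding killed_def by blast
  have ke: "esum X v y = 0" if "X \<subseteq> M" "card X = Suc (Suc k)" for X y
    using killed that unfolding killed_def by blast
  have ins: "dsum (insert x C) v y = 0" if x: "x \<in> M - C" for x y
  proof (rule ccontr)
    assume nz: "dsum (insert x C) v y \<noteq> 0"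
    have sub: "insert x C \<subseteq> M" using x C by auto
    have card: "card (insert x C) = Suc (card C)" using x finC by simp
    have "card C \<noteq> n" using kd[OF sub] nz card by metis
    then have "card (insert x C) \<le> n" using C card by simp
    then show False using max[of "insert x C"] sub nz card by auto
  qed
  have "killed (M - C) k n (dsum C v)"
    unfolding killed_def
  proof (intro conjI allI impI)
    fix X y assume X: "X \<subseteq> M - C" "card X = Suc k"
    have finX: "finite X" using X fin finite_subset by blast
    show "esum X (dsum C v) y = 0"
    proof (rule esum_zero_of_transversals[of C])
      show "finite C" "finite X" by fact+
      show "C \<inter> X = {}" "C \<noteq> {} \<or> X \<noteq> {}" using X by auto
      show "(\<Sum>c\<in>C. e (transpose x c) * dsum C v (transpose x c \<circ> y)) = dsum C v y" if "x \<in> X" for x y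
        using that X ins[of x] by (intro dsum_insert_zero finC) auto
      show "esum (insert c X) (dsum C v) y = 0" if "c \<in> C" for c y
      proof (rule esum_dsum_zero)
        fix s y assume s: "s permutes C"
        have "s permutes M" using s C by (blast intro: permutes_subset)
        moreover have "insert c X \<subseteq> M" using X that C by auto
        ultimately have "s ` insert c X \<subseteq> M" using permutes_image by fastforce
        moreover have "card (s ` insert c X) = card (insert c X)"
          by (rule card_image[OF inj_on_subset[OF permutes_inj[OF s] subset_UNIV]])
        moreover have "card (insert c X) = Suc (Suc k)" using X that finX by (subst card_insert_disjoint) auto
        ultimately show "esum (s ` insert c X) v y = 0" using ke by metis
      qed (use finC finX in auto)
    qed
  next
    fix D y assume D: "D \<subseteq> M - C" "card D = Suc n"
    have "finite D" using D fin finite_subset by blast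
    have "dsum D (dsum C v) y = (\<Sum>p | p permutes D. \<Sum>s | s permutes C. d s * (d p * v (p \<circ> (s \<circ> y))))"
      unfolding dsum_def sum_distrib_left
    proof (intro sum.cong refl)
      fix p s assume "p \<in> {p. p permutes D}" "s \<in> {s. s permutes C}"
      then have "p \<circ> s = s \<circ> p" using D by (intro permutes_commute[of p D s C]) auto
      then show "d p * (d s * v (s \<circ> (p \<circ> y))) = d s * (d p * v (p \<circ> (s \<circ> y)))"
        by (simp add: o_assoc)
    qed
    also have "\<dots> = (\<Sum>s | s permutes C. d s * dsum D v (s \<circ> y))"
      unfolding dsum_def sum_distrib_left by (rule sum.swap)
    also have "\<dots> = 0"
    proof -
      have "D \<subseteq> M" using D(1) by blast
      then show ?thesis using kd[OF _ D(2)] by simp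
    qed
    finally show "dsum D (dsum C v) y = 0" .
  qed
  with C show ?thesis using that by blast
qed

text \<open>Each \<open>killed_step\<close> lowers \<open>k\<close> by one and uses up at most
  \<open>n\<close> letters, so a letter is left when \<open>k = 0\<close>; the symmetrizer of a
  single letter is the identity and kills only 0.\<close>

lemma killed_zero:
  assumes "finite M" "killed M k n v" "card M > k * n"
  shows "v = (\<lambda>_. 0)"
  using assms
proof (induction k arbitrary: M v)
  case 0
  then obtain x where x: "x \<in> M" by fastforce
  have "v y = 0" for y
  proof -
    have "{s. s permutes {x}} = {id}" by auto
    then have "esum {x} v y = v y" unfolding esum_def by (simp add: e_id)
    moreover have "esum {x} v y = 0" using 0(2) x by (auto simp: killed_def)
    ultimately show ?thesis by metis
  qed
  then show ?case by blast
next
  case (Suc k)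
  show ?case
  proof (rule ccontr)
    assume "v \<noteq> (\<lambda>_. 0)"
    then obtain y where "v y \<noteq> 0" by blast
    then obtain C where C: "C \<subseteq> M" "card C \<le> n" "\<exists>y. dsum C v y \<noteq> 0" "killed (M - C) k n (dsum C v)"
      using killed_step[OF Suc.prems(1,2)] by blast
    have "card (M - C) = card M - card C" using C Suc.prems(1) by (simp add: card_Diff_subset finite_subset)
    then have gt: "k * n < card (M - C)" using C(2) Suc.prems(3) by simp
    have "dsum C v = (\<lambda>_. 0)"
      by (rule Suc.IH[OF finite_Diff[OF Suc.prems(1)] C(4) gt])
    then show False using C(3) by simp
  qed
qed

text \<open>With exactly \<open>k * n\<close> letters there is no slack: a column of fewer than
  \<open>n\<close> letters would leave too many for \<open>killed_zero\<close>. The columns split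
  off along the way become the colour classes of \<open>h\<close>.\<close>

lemma killed_colouring:
  assumes "finite M" "killed M k n v" "card M = k * n" "v \<noteq> (\<lambda>_. 0)"
  shows "\<exists>h :: nat \<Rightarrow> nat. (\<forall>x\<in>M. h x < k) \<and> (\<forall>i<k. card {x \<in> M. h x = i} = n) \<and>
    (\<exists>y. (\<Sum>s\<in>stab M h. d s * v (s \<circ> y)) \<noteq> 0)"
  using assms
proof (induction k arbitrary: M v)
  case 0
  then have "M = {}" by simp
  then have "stab M h = {id}" for h :: "nat \<Rightarrow> nat" by (auto simp: stab_def)
  moreover obtain y0 where "v y0 \<noteq> 0" using 0(4) by blast
  ultimately have "(\<Sum>s\<in>stab M h. d s * v (s \<circ> y0)) \<noteq> 0" for h :: "nat \<Rightarrow> nat"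
    by (simp add: d_id)
  then show ?case using \<open>M = {}\<close> by (auto simp del: o_apply)
next
  case (Suc k)
  obtain C where C: "C \<subseteq> M" "card C \<le> n" "\<exists>y. dsum C v y \<noteq> 0" "killed (M - C) k n (dsum C v)"
  proof -
    obtain y0 where "v y0 \<noteq> 0" using Suc.prems(4) by blast
    then show ?thesis using killed_step[OF Suc.prems(1,2)] that by blast
  qed
  have finC: "finite C" and finM: "finite (M - C)" using C Suc.prems(1) by (auto intro: finite_subset)
  have card: "card (M - C) = card M - card C" using C finC by (simp add: card_Diff_subset)
  have "\<not> card (M - C) > k * n" using killed_zero[OF finM C(4)] C(3) by auto
  then have cC: "card C = n" and cM: "card (M - C) = k * n" using card C(2) Suc.prems(3) by auto
  obtain h y where h: "\<forall>x\<in>M - C. h x < k" "\<forall>i<k. card {x \<in> M - C. h x = i} = n"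
    and y: "(\<Sum>s\<in>stab (M - C) h. d s * dsum C v (s \<circ> y)) \<noteq> 0"
  proof -
    have "dsum C v \<noteq> (\<lambda>_. 0)" using C(3) by auto
    from Suc.IH[OF finM C(4) cM this] show ?thesis using that by blast
  qed
  \<comment> \<open>The new column gets the colour \<open>k\<close>, which is free because the
    induction hypothesis uses only smaller ones.\<close>
  define h' where "h' = (\<lambda>x. if x \<in> C then k else h x)"
  have st: "stab (M - C) h' = stab (M - C) h" by (rule stab_cong) (simp add: h'_def)
  have "(\<Sum>s\<in>stab M h'. d s * v (s \<circ> y)) =
      (\<Sum>q\<in>stab (M - C) h'. \<Sum>p | p permutes C. d (p \<circ> q) * v (p \<circ> q \<circ> y))"
    using Suc.prems(1) C(1) h(1) by (intro sum_stab_split[where i = k]) (auto simp: h'_def)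
  also have "\<dots> = (\<Sum>q\<in>stab (M - C) h'. d q * dsum C v (q \<circ> y))"
    unfolding dsum_def sum_distrib_left
  proof (intro sum.cong refl)
    fix p q assume "q \<in> stab (M - C) h'" "p \<in> {p. p permutes C}"
    then have "permutation p" "permutation q"
      using perm_of_permutes[OF _ finC] perm_of_permutes[OF stabD(1) finM] by auto
    then show "d (p \<circ> q) * v (p \<circ> q \<circ> y) = d q * (d p * v (p \<circ> (q \<circ> y)))"
      by (simp add: d_comp comp_assoc)
  qed
  finally have "(\<Sum>s\<in>stab M h'. d s * v (s \<circ> y)) \<noteq> 0" using y st by simp
  moreover have "\<forall>x\<in>M. h' x < Suc k" using h(1) by (auto simp: h'_def less_Suc_eq)
  moreover have "card {x \<in> M. h' x = i} = n" if "i < Suc k" for i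
  proof (cases "i = k")
    case True
    then have "{x \<in> M. h' x = i} = C" using h(1) C(1) by (auto simp: h'_def)
    then show ?thesis using cC by simp
  next
    case False
    then have "{x \<in> M. h' x = i} = {x \<in> M - C. h x = i}" by (auto simp: h'_def)
    then show ?thesis using h(2) that False by (simp add: less_Suc_eq)
  qed
  ultimately show ?case by blast
qed

end

section \<open>The Young symmetrizer of a rectangle\<close>

lemma stab_image_iff:
  assumes "\<sigma> permutes S" "h ` S \<subseteq> I"
  shows "(\<forall>i\<in>I. \<sigma> ` {x \<in> S. h x = i} = {x \<in> S. h x = i}) \<longleftrightarrow> (\<forall>x\<in>S. h (\<sigma> x) = h x)"
proof
  assume L: "\<forall>i\<in>I. \<sigma> ` {x \<in> S. h x = i} = {x \<in> S. h x = i}"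
  show "\<forall>x\<in>S. h (\<sigma> x) = h x"
  proof
    fix x assume x: "x \<in> S"
    then have "\<sigma> x \<in> \<sigma> ` {y \<in> S. h y = h x}" by blast
    also have "\<dots> = {y \<in> S. h y = h x}" using L x assms(2) by blast
    finally show "h (\<sigma> x) = h x" by simp
  qed
next
  assume R: "\<forall>x\<in>S. h (\<sigma> x) = h x"
  show "\<forall>i\<in>I. \<sigma> ` {x \<in> S. h x = i} = {x \<in> S. h x = i}"
  proof
    fix i
    show "\<sigma> ` {x \<in> S. h x = i} = {x \<in> S. h x = i}"
    proof
      show "\<sigma> ` {x \<in> S. h x = i} \<subseteq> {x \<in> S. h x = i}"
        using R permutes_in_image[OF assms(1)] by auto
      show "{x \<in> S. h x = i} \<subseteq> \<sigma> ` {x \<in> S. h x = i}"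
      proof
        fix x assume x: "x \<in> {x \<in> S. h x = i}"
        have "inv \<sigma> x \<in> S" using x permutes_in_image[OF permutes_inv[OF assms(1)]] by simp
        moreover from this have "h (inv \<sigma> x) = i"
          using R x permutes_inverses(1)[OF assms(1), of x] by force
        moreover have "x = \<sigma> (inv \<sigma> x)" using permutes_inverses(1)[OF assms(1)] by simp
        ultimately show "x \<in> \<sigma> ` {x \<in> S. h x = i}" by blast
      qed
    qed
  qed
qed

lemma colouring_permutes:
  fixes h h' :: "'a \<Rightarrow> nat"
  assumes "finite S" "\<And>x. x \<in> S \<Longrightarrow> h x < m" "\<And>x. x \<in> S \<Longrightarrow> h' x < m"
    and card: "\<And>i. i < m \<Longrightarrow> card {x \<in> S. h x = i} = card {x \<in> S. h' x = i}"
  obtains \<pi> where "\<pi> permutes S" "\<And>x. x \<in> S \<Longrightarrow> h' x = h (\<pi> x)"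
proof -
  have "image_mset h' (mset_set S) = image_mset h (mset_set S)"
  proof (rule multiset_eqI)
    fix i
    have "count (image_mset g (mset_set S)) i = card {x \<in> S. g x = i}" for g :: "'a \<Rightarrow> nat"
    proof -
      have "g -` {i} \<inter> S = {x \<in> S. g x = i}" by blast
      then show ?thesis using assms(1) by (simp add: count_image_mset sum_distrib_left[symmetric])
    qed
    moreover have "{x \<in> S. h x = i} = {}" "{x \<in> S. h' x = i} = {}" if "\<not> i < m" using that assms by auto
    ultimately show "count (image_mset h' (mset_set S)) i = count (image_mset h (mset_set S)) i"
      using card by (cases "i < m") (simp_all only: card.empty not_False_eq_True)
  qed
  then show ?thesis using image_mset_eq_implies_permutes[OF assms(1)] that by metis
qed

text \<open>The rectangle has \<open>n\<close> rows of length \<open>k\<close>, and the box in row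
  \<open>i\<close> and column \<open>j\<close> is the letter \<open>i * k + j\<close>; so
  \<open>b div k\<close> and \<open>b mod k\<close> are the coordinates of \<open>b\<close>.\<close>

locale rectangle =
  fixes k n :: nat
  assumes k: "0 < k" and n: "0 < n"
begin

definition N :: nat where "N = k * n"
definition P :: "(nat \<Rightarrow> nat) set" where "P = {p. p permutes {0..<N}}"
definition Row :: "(nat \<Rightarrow> nat) set" where "Row = stab {0..<N} (\<lambda>b. b div k)"
definition Col :: "(nat \<Rightarrow> nat) set" where "Col = stab {0..<N} (\<lambda>b. b mod k)"
abbreviation sgn_c :: "(nat \<Rightarrow> nat) \<Rightarrow> complex" where "sgn_c q \<equiv> of_int (sign q)"
definition c :: "(nat \<Rightarrow> nat) \<Rightarrow> complex" where "c = young_symmetrizer (replicate n k)"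

sublocale P: perm_group P unfolding P_def by (rule perm_group_permutes) simp
sublocale Row: perm_group Row unfolding Row_def by (rule perm_group_stab) simp
sublocale Col: perm_group Col unfolding Col_def by (rule perm_group_stab) simp

lemma Row_P: "p \<in> Row \<Longrightarrow> p \<in> P" and Col_P: "p \<in> Col \<Longrightarrow> p \<in> P"
  by (auto simp: Row_def Col_def P_def dest: stabD(1))

lemma permutation_P: "p \<in> P \<Longrightarrow> permutation p"
  by (auto simp: P_def permutation_permutes)

lemma inv_P [simp]:
  assumes "p \<in> P"
  shows "inv p (p x) = x" "p (inv p x) = x" "inv p \<circ> p = id" "p \<circ> inv p = id" "inv (inv p) = p"
    "inv p \<circ> (p \<circ> u) = u" "p \<circ> (inv p \<circ> u) = u"
  using P.bij_G[OF assms] by (auto simp: fun_eq_iff inv_inv_eq bij_is_inj bij_is_surj surj_f_inv_f)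

lemma inv_comp_P: "p \<in> P \<Longrightarrow> q \<in> P \<Longrightarrow> inv (p \<circ> q) = inv q \<circ> inv p"
  by (simp add: o_inv_distrib P.bij_G)

lemma sgn_c_comp: "p \<in> P \<Longrightarrow> q \<in> P \<Longrightarrow> sgn_c (p \<circ> q) = sgn_c p * sgn_c q"
  by (simp add: sign_compose permutation_P)

lemma sgn_c_inv: "p \<in> P \<Longrightarrow> sgn_c (inv p) = sgn_c p"
  by (simp add: sign_inverse permutation_P)

lemma sgn_c_square [simp]: "sgn_c p * sgn_c p = 1" "sgn_c p * (sgn_c p * x) = x"
  by (simp_all add: sign_def)

lemma comp_P_iff [simp]:
  assumes "p \<in> P"
  shows "p \<circ> u \<in> P \<longleftrightarrow> u \<in> P" "u \<circ> p \<in> P \<longleftrightarrow> u \<in> P"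
proof -
  have "u \<in> P" if "p \<circ> u \<in> P"
    using P.comp_G[OF P.inv_G[OF assms] that] assms by simp
  then show "p \<circ> u \<in> P \<longleftrightarrow> u \<in> P" using assms P.comp_G by blast
  have "u \<in> P" if "u \<circ> p \<in> P"
    using P.comp_G[OF that P.inv_G[OF assms]] assms by (simp add: comp_assoc)
  then show "u \<circ> p \<in> P \<longleftrightarrow> u \<in> P" using assms P.comp_G by blast
qed

lemma row_less: "x < N \<Longrightarrow> x div k < n"
  unfolding N_def using k by (simp add: less_mult_imp_div_less mult.commute)

lemma box_less:
  assumes "i < n" "j < k"
  shows "i * k + j < N"
proof -
  have "i * k + j < Suc i * k" using assms by simp
  also have "\<dots> \<le> n * k" using assms by (intro mult_le_mono1) simp
  finally show ?thesis by (simp add: N_def mult.commute)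
qed

lemma N_eq: "sum_list (replicate n k) = N"
  by (simp add: N_def sum_list_replicate mult.commute)

lemma row_set_eq:
  assumes "i < n"
  shows "row_set (replicate n k) i = {x \<in> {0..<N}. x div k = i}"
proof -
  have "sum_list (take i (replicate n k)) = i * k" using assms by (simp add: sum_list_replicate)
  then have "row_set (replicate n k) i = {i * k..<i * k + k}" using assms by (simp add: row_set_def Let_def)
  also have "\<dots> = {x \<in> {0..<N}. x div k = i}"
  proof (intro Set.set_eqI iffI)
    fix x assume x: "x \<in> {i * k..<i * k + k}"
    then have "x div k = i" by (intro div_nat_eqI) (auto simp: mult.commute)
    moreover have "x < N" using x box_less[of i "x - i * k"] assms
      by (metis atLeastLessThan_iff le_add_diff_inverse less_diff_conv2 add.commute)
    ultimately show "x \<in> {x \<in> {0..<N}. x div k = i}" by simp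
  next
    fix x assume "x \<in> {x \<in> {0..<N}. x div k = i}"
    then have "x = i * k + x mod k" by (metis (mono_tags, lifting) div_mult_mod_eq mem_Collect_eq)
    moreover have "x mod k < k" using k by simp
    ultimately show "x \<in> {i * k..<i * k + k}" by (metis atLeastLessThan_iff le_add1 nat_add_left_cancel_less)
  qed
  finally show ?thesis .
qed

lemma col_set_eq: "col_set (replicate n k) j = {x \<in> {0..<N}. x mod k = j}"
proof (intro Set.set_eqI iffI)
  fix x assume "x \<in> col_set (replicate n k) j"
  then obtain i where "i < n" "j < k" "x = i * k + j"
    by (auto simp: col_set_def sum_list_replicate)
  then show "x \<in> {x \<in> {0..<N}. x mod k = j}" using box_less by simp
next
  fix x assume x: "x \<in> {x \<in> {0..<N}. x mod k = j}"
  then have "x = x div k * k + j" "x div k < n" "j < k" using row_less k by auto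
  then show "x \<in> col_set (replicate n k) j" by (force simp: col_set_def sum_list_replicate)
qed

lemma young_subgroup_rect: "young_subgroup (replicate n k) = Row"
proof -
  have "(\<forall>i<n. \<sigma> ` row_set (replicate n k) i = row_set (replicate n k) i) \<longleftrightarrow> (\<forall>x\<in>{0..<N}. \<sigma> x div k = x div k)"
    if "\<sigma> permutes {0..<N}" for \<sigma>
  proof -
    have "(\<lambda>x. x div k) ` {0..<N} \<subseteq> {..<n}" using row_less by auto
    from stab_image_iff[OF that this] show ?thesis by (simp add: row_set_eq Ball_def)
  qed
  then show ?thesis unfolding young_subgroup_def Row_def stab_def N_eq by auto
qed

lemma column_subgroup_rect: "column_subgroup (replicate n k) = Col"
proof -
  have "(\<forall>i. \<sigma> ` col_set (replicate n k) i = col_set (replicate n k) i) \<longleftrightarrow> (\<forall>x\<in>{0..<N}. \<sigma> x mod k = x mod k)"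
    if "\<sigma> permutes {0..<N}" for \<sigma>
    using stab_image_iff[OF that, of "\<lambda>x. x mod k" UNIV] by (simp add: col_set_eq)
  then show ?thesis unfolding column_subgroup_def Col_def stab_def N_eq by auto
qed

lemma c_eq: "c y = (\<Sum>p\<in>Row. \<Sum>q\<in>Col. if y = p \<circ> q then sgn_c q else 0)"
  by (simp add: c_def young_symmetrizer_def young_subgroup_rect column_subgroup_rect)

section \<open>Covariance and annihilation properties of the Young symmetrizer\<close>

lemma c_row:
  assumes "p \<in> Row"
  shows "c (p \<circ> u) = c u"
proof -
  have "c (p \<circ> u) = (\<Sum>p'\<in>Row. \<Sum>q\<in>Col. if p \<circ> u = p \<circ> p' \<circ> q then sgn_c q else 0)"
    unfolding c_eq by (rule Row.sum_left[OF assms, symmetric])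
  also have "\<dots> = c u" unfolding c_eq
  proof (intro sum.cong refl)
    fix p' q :: "nat \<Rightarrow> nat"
    have "p \<circ> u = p \<circ> p' \<circ> q \<longleftrightarrow> u = p' \<circ> q"
      using inv_P(6)[OF Row_P[OF assms]] by (metis comp_assoc)
    then show "(if p \<circ> u = p \<circ> p' \<circ> q then sgn_c q else 0) = (if u = p' \<circ> q then sgn_c q else 0)"
      by simp
  qed
  finally show ?thesis .
qed

lemma c_col:
  assumes "q \<in> Col"
  shows "c (u \<circ> q) = sgn_c q * c u"
proof -
  note qP = Col_P[OF assms]
  have "c (u \<circ> q) = (\<Sum>p\<in>Row. \<Sum>q'\<in>Col. if u \<circ> q = p \<circ> (q' \<circ> q) then sgn_c (q' \<circ> q) else 0)"
    unfolding c_eq by (intro sum.cong refl Col.sum_right[OF assms, symmetric])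
  also have "\<dots> = sgn_c q * c u" unfolding c_eq sum_distrib_left
  proof (intro sum.cong refl)
    fix p q' assume q': "q' \<in> Col"
    have "u \<circ> q = p \<circ> (q' \<circ> q) \<longleftrightarrow> u = p \<circ> q'"
      using inv_P(4)[OF qP] by (metis comp_assoc comp_id)
    then show "(if u \<circ> q = p \<circ> (q' \<circ> q) then sgn_c (q' \<circ> q) else 0) = sgn_c q * (if u = p \<circ> q' then sgn_c q' else 0)"
      using sgn_c_comp[OF Col_P[OF q'] qP] by simp
  qed
  finally show ?thesis .
qed

lemma c_outside:
  assumes "u \<notin> P"
  shows "c u = 0"
proof -
  have "u \<noteq> p \<circ> q" if "p \<in> Row" "q \<in> Col" for p q
    using that assms P.comp_G Row_P Col_P by blast
  then show ?thesis unfolding c_eq by (simp add: sum.neutral)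
qed

lemma Row_Col_id:
  assumes "p \<in> Row" "p \<in> Col"
  shows "p = id"
proof
  fix x
  have "p x div k = x div k" "p x mod k = x mod k" 
    using stabD(2)[OF assms(1)[unfolded Row_def]] stabD(2)[OF assms(2)[unfolded Col_def]] by auto
  then show "p x = id x" by (metis div_mult_mod_eq id_apply)
qed

lemma c_id: "c id = 1"
proof -
  have *: "id = p \<circ> q \<longleftrightarrow> p = id \<and> q = id" if "p \<in> Row" "q \<in> Col" for p q
  proof
    assume e: "id = p \<circ> q"
    then have "inv p = q" using inv_P(6)[OF Row_P[OF that(1)], of q] by simp
    then have "q = id" using Row_Col_id[of q] Row.inv_G that by metis
    then show "p = id \<and> q = id" using e by simp
  qed simp
  have "c id = (\<Sum>p\<in>Row. if p = id then (\<Sum>q\<in>Col. if q = id then 1 else 0) else 0)"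
    unfolding c_eq by (intro sum.cong refl) (auto simp: * intro!: sum.cong)
  also have "\<dots> = 1" using Row.finite_G Col.finite_G Row.id_G Col.id_G by simp
  finally show ?thesis .
qed

lemma c_real: "c u \<in> \<real>"
  unfolding c_eq by (intro sum_in_Reals) auto

text \<open>The dichotomy behind von Neumann's lemma: if no two letters of a row have preimages in a
  common column, a row permutation can bring every letter into the column of its preimage.\<close>

lemma row_or_swap:
  assumes x: "x \<in> P"
  shows "(\<exists>p\<in>Row. \<exists>q\<in>Col. x = p \<circ> q) \<or>
    (\<exists>a<N. \<exists>b<N. a \<noteq> b \<and> a div k = b div k \<and> inv x a mod k = inv x b mod k)"
proof (rule disjCI)
  assume "\<not> (\<exists>a<N. \<exists>b<N. a \<noteq> b \<and> a div k = b div k \<and> inv x a mod k = inv x b mod k)"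
  then have sep: "a = b" if "a < N" "b < N" "a div k = b div k" "inv x a mod k = inv x b mod k" for a b
    using that by blast
  \<comment> \<open>\<open>r\<close> keeps the row of \<open>l\<close> and takes the column of its
    preimage under \<open>x\<close>. It is injective by \<open>sep\<close>, and
    \<open>r \<circ> x\<close> preserves columns.\<close>
  define r where "r l = (if l < N then l div k * k + inv x l mod k else l)" for l
  have rd: "r l div k = l div k" "r l mod k = inv x l mod k" if "l < N" for l
    using that k by (auto simp: r_def)
  have rl: "r l < N" if "l < N" for l
    using that box_less[OF row_less[OF that], of "inv x l mod k"] k by (simp add: r_def)
  have "r permutes {0..<N}"
  proof (rule bij_imp_permutes)
    have "inj_on r {0..<N}" by (rule inj_onI) (metis sep rd atLeastLessThan_iff)
    moreover have "r ` {0..<N} \<subseteq> {0..<N}" using rl by auto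
    ultimately show "bij_betw r {0..<N} {0..<N}"
      by (simp add: bij_betw_def endo_inj_surj)
  qed (simp add: r_def)
  then have r: "r \<in> P" by (simp add: P_def)
  have rRow: "r \<in> Row" using \<open>r permutes _\<close> rd by (simp add: Row_def stab_def)
  have xl: "x m < N" if "m < N" for m
    using x that permutes_in_image[of x "{0..<N}" m] by (simp add: P_def)
  have "r \<circ> x \<in> P" using r x by simp
  then have "r \<circ> x \<in> Col"
    using rd(2)[OF xl] inv_P(1)[OF x] by (simp add: Col_def stab_def P_def)
  moreover have "inv r \<in> Row" using rRow by (rule Row.inv_G)
  moreover have "x = inv r \<circ> (r \<circ> x)" using r by simp
  ultimately show "\<exists>p\<in>Row. \<exists>q\<in>Col. x = p \<circ> q" by blast
qed

lemma transpose_stab: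
  assumes "a < N" "b < N" "h a = h b"
  shows "transpose a b \<in> stab {0..<N} h"
proof -
  have "h (transpose a b x) = h x" for x using assms by (simp add: transpose_def)
  then show ?thesis using assms by (auto simp: stab_def intro!: permutes_swap_id)
qed

lemma sgn_c_transpose: "a \<noteq> b \<Longrightarrow> sgn_c (transpose a b) = -1"
  by (simp add: sign_swap_id)

lemma transpose_comp_P:
  assumes "x \<in> P"
  shows "transpose a b \<circ> x = x \<circ> transpose (inv x a) (inv x b)"
  using transpose_comp_eq[OF P.bij_G[OF assms]] .

lemma P_less: "x \<in> P \<Longrightarrow> x a < N \<longleftrightarrow> a < N"
  using permutes_in_image[of x "{0..<N}" a] by (simp add: P_def)

text \<open>Both sides vanish unless \<open>u \<in> Row \<circ> Col\<close>, by the swap of two letters in a common row and column.\<close>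

lemma row_col_unique:
  assumes row: "\<And>p u. p \<in> Row \<Longrightarrow> u \<in> P \<Longrightarrow> F (p \<circ> u) = F u"
    and col: "\<And>q u. q \<in> Col \<Longrightarrow> u \<in> P \<Longrightarrow> F (u \<circ> q) = sgn_c q * F u"
    and u: "u \<in> P"
  shows "F u = F id * c u"
  using row_or_swap[OF u]
proof (elim disjE bexE exE conjE)
  fix p q assume "p \<in> Row" "q \<in> Col" and [simp]: "u = p \<circ> q"
  then have "F u = sgn_c q * F id" "c u = sgn_c q"
    using row[of p q] col[of q id] c_row[of p q] c_col[of q id] Col_P[of q] P.id_G c_id by auto
  then show ?thesis by simp
next
  fix a b assume ab: "a < N" "b < N" "a \<noteq> b" "a div k = b div k" "inv u a mod k = inv u b mod k"
  let ?t = "transpose a b" and ?t' = "transpose (inv u a) (inv u b)"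
  have iu: "inv u \<in> P" using u by (rule P.inv_G)
  have t: "?t \<in> Row" unfolding Row_def using ab by (intro transpose_stab)
  have t': "?t' \<in> Col" unfolding Col_def using ab P_less[OF iu] by (intro transpose_stab) auto
  have "inv u a \<noteq> inv u b" using ab(3) u by (metis inv_P(2))
  then have s: "sgn_c ?t' = -1" by (rule sgn_c_transpose)
  have e: "?t \<circ> u = u \<circ> ?t'" using u by (rule transpose_comp_P)
  have "F u = - F u" using row[OF t u] col[OF t' u] e s by simp
  moreover have "c u = - c u" using c_row[OF t, of u] c_col[OF t', of u] e s by simp
  ultimately show ?thesis by simp
qed

lemma pigeonhole_mod:
  assumes "X \<subseteq> {0..<N}" "card X = Suc k"
  obtains a b where "a \<in> X" "b \<in> X" "a \<noteq> b" "f a mod k = f b mod k"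
proof -
  have "(\<lambda>a. f a mod k) ` X \<subseteq> {..<k}" using k by auto
  then have "\<not> inj_on (\<lambda>a. f a mod k) X"
    using card_inj_on_le[of "\<lambda>a. f a mod k" X "{..<k}"] assms(2) by auto
  then show ?thesis using that by (auto simp: inj_on_def)
qed

lemma pigeonhole_div:
  assumes "X \<subseteq> {0..<N}" "card X = Suc n" "w \<in> P"
  obtains a b where "a \<in> X" "b \<in> X" "a \<noteq> b" "w a div k = w b div k"
proof -
  have "w a div k < n" if "a \<in> X" for a
    using that assms(1) P_less[OF assms(3)] by (intro row_less) auto
  then have "(\<lambda>a. w a div k) ` X \<subseteq> {..<n}" by auto
  then have "\<not> inj_on (\<lambda>a. w a div k) X"
    using card_inj_on_le[of "\<lambda>a. w a div k" X "{..<n}"] assms(2) by auto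
  then show ?thesis using that by (auto simp: inj_on_def)
qed

text \<open>Two of the \<open>k + 1\<close> letters have preimages under \<open>w2\<close> in the
  same column. Their transposition leaves the sum unchanged, but it passes through \<open>w2\<close>
  as a column transposition and reverses the sign.\<close>

lemma c_kill_row:
  assumes X: "X \<subseteq> {0..<N}" "card X = Suc k" and w: "w2 \<in> P"
  shows "(\<Sum>s | s permutes X. c (w1 \<circ> s \<circ> w2)) = 0"
proof -
  have fin: "finite X" using X finite_subset by blast
  interpret X: perm_group "{s. s permutes X}" using fin by (rule perm_group_permutes)
  obtain a b where ab: "a \<in> X" "b \<in> X" "a \<noteq> b" "inv w2 a mod k = inv w2 b mod k"
    using pigeonhole_mod[OF X] by metis
  let ?t = "transpose a b" and ?t' = "transpose (inv w2 a) (inv w2 b)"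
  have iw: "inv w2 \<in> P" using w by (rule P.inv_G)
  have "a < N" "b < N" using ab X by auto
  then have t': "?t' \<in> Col" unfolding Col_def using ab P_less[OF iw] by (intro transpose_stab) auto
  have "inv w2 a \<noteq> inv w2 b" using ab(3) w by (metis inv_P(2))
  then have s: "sgn_c ?t' = -1" by (rule sgn_c_transpose)
  have e: "w1 \<circ> (s \<circ> ?t) \<circ> w2 = w1 \<circ> s \<circ> w2 \<circ> ?t'" for s
    using transpose_comp_P[OF w, of a b] by (metis comp_assoc)
  have "(\<Sum>s | s permutes X. c (w1 \<circ> s \<circ> w2)) = (\<Sum>s | s permutes X. c (w1 \<circ> (s \<circ> ?t) \<circ> w2))"
    using ab by (intro X.sum_right[symmetric]) (simp add: permutes_swap_id)
  also have "\<dots> = - (\<Sum>s | s permutes X. c (w1 \<circ> s \<circ> w2))"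
    unfolding e c_col[OF t'] s sum_negf[symmetric] by simp
  finally show ?thesis by simp
qed

text \<open>\<open>w1\<close> sends two of the \<open>n + 1\<close> letters into the same row. Their
  transposition passes through \<open>w1\<close> as a row transposition, invisible to
  \<open>c\<close>, while it reverses the sign of \<open>s\<close>.\<close>

lemma c_kill_col:
  assumes X: "X \<subseteq> {0..<N}" "card X = Suc n" and w: "w1 \<in> P"
  shows "(\<Sum>s | s permutes X. sgn_c s * c (w1 \<circ> s \<circ> w2)) = 0"
proof -
  have fin: "finite X" using X finite_subset by blast
  interpret X: perm_group "{s. s permutes X}" using fin by (rule perm_group_permutes)
  obtain a b where ab: "a \<in> X" "b \<in> X" "a \<noteq> b" "w1 a div k = w1 b div k"
    using pigeonhole_div[OF X w] by metis
  let ?t = "transpose a b" and ?t' = "transpose (w1 a) (w1 b)"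
  have "a < N" "b < N" using ab X by auto
  then have t': "?t' \<in> Row" unfolding Row_def using ab P_less[OF w] by (intro transpose_stab) auto
  have tP: "?t \<in> P" using \<open>a < N\<close> \<open>b < N\<close> by (simp add: P_def permutes_swap_id)
  have e: "w1 \<circ> (?t \<circ> s) \<circ> w2 = ?t' \<circ> (w1 \<circ> s \<circ> w2)" for s
    using transpose_comp_P[OF w, of "w1 a" "w1 b"] w by (metis comp_assoc inv_P(1))
  have tX: "?t \<in> {s. s permutes X}" using ab by (simp add: permutes_swap_id)
  have sg: "sgn_c (?t \<circ> s) = - sgn_c s" if "s permutes X" for s
  proof -
    have "s \<in> P" using that X by (auto simp: P_def intro: permutes_subset)
    then show ?thesis using sgn_c_comp[OF tP] sgn_c_transpose[OF ab(3)] by simp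
  qed
  have "(\<Sum>s | s permutes X. sgn_c s * c (w1 \<circ> s \<circ> w2)) =
      (\<Sum>s | s permutes X. sgn_c (?t \<circ> s) * c (w1 \<circ> (?t \<circ> s) \<circ> w2))"
    using tX by (rule X.sum_left[symmetric])
  also have "\<dots> = - (\<Sum>s | s permutes X. sgn_c s * c (w1 \<circ> s \<circ> w2))"
    unfolding e c_row[OF t'] sum_negf[symmetric] using sg by (intro sum.cong refl) simp
  finally show ?thesis by simp
qed

section \<open>Class functions with the two killing properties form at most a line\<close>

definition class_function :: "((nat \<Rightarrow> nat) \<Rightarrow> complex) \<Rightarrow> bool" where
  "class_function z \<longleftrightarrow> (\<forall>u. u \<notin> P \<longrightarrow> z u = 0) \<and> (\<forall>\<pi>\<in>P. \<forall>u\<in>P. z (\<pi> \<circ> u \<circ> inv \<pi>) = z u)"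

definition annihilated :: "((nat \<Rightarrow> nat) \<Rightarrow> complex) \<Rightarrow> bool" where
  "annihilated z \<longleftrightarrow>
    (\<forall>X y. X \<subseteq> {0..<N} \<longrightarrow> card X = Suc k \<longrightarrow> (\<Sum>s | s permutes X. z (s \<circ> y)) = 0) \<and>
    (\<forall>X y. X \<subseteq> {0..<N} \<longrightarrow> card X = Suc n \<longrightarrow> (\<Sum>s | s permutes X. sgn_c s * z (s \<circ> y)) = 0)"

lemma class_function_commute:
  assumes "class_function z" "a \<in> P" "b \<in> P"
  shows "z (a \<circ> b) = z (b \<circ> a)"
proof -
  have "z (a \<circ> (b \<circ> a) \<circ> inv a) = z (b \<circ> a)"
    using assms unfolding class_function_def by simp
  moreover have "a \<circ> (b \<circ> a) \<circ> inv a = a \<circ> b" using assms(2) by (simp add: comp_assoc)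
  ultimately show ?thesis by simp
qed

lemma card_mod_class: "i < k \<Longrightarrow> card {x \<in> {0..<N}. x mod k = i} = n"
proof -
  assume i: "i < k"
  have "{x \<in> {0..<N}. x mod k = i} = (\<lambda>j. j * k + i) ` {..<n}"
  proof (intro Set.set_eqI iffI)
    fix x assume "x \<in> {x \<in> {0..<N}. x mod k = i}"
    then have "x = x div k * k + i" "x div k < n" using row_less by auto
    then show "x \<in> (\<lambda>j. j * k + i) ` {..<n}" by blast
  qed (use i box_less in auto)
  moreover have "inj_on (\<lambda>j. j * k + i) {..<n}" using k by (auto simp: inj_on_def)
  ultimately show ?thesis by (simp add: card_image)
qed

lemma card_div_class: "i < n \<Longrightarrow> card {x \<in> {0..<N}. x div k = i} = k"
  by (subst row_set_eq[symmetric]) (simp_all add: row_set_def Let_def)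

text \<open>If \<open>z\<close> does not vanish, columns and then rows can be split off without
  reaching 0, but the two systems are related by an unknown permutation \<pi>. Bi-covariance is used
  twice: on \<open>F\<close>, to reach the identity, and on \<open>G\<close>, where \<pi> itself is
  the argument and \<open>G id\<close> is the pairing with \<open>c\<close>.\<close>

lemma annihilated_unique:
  assumes cl: "class_function z" and ann: "annihilated z"
    and orth: "(\<Sum>p\<in>Row. \<Sum>q\<in>Col. sgn_c q * z (p \<circ> q)) = 0"
  shows "z y = 0"
proof (rule ccontr)
  assume nz: "z y \<noteq> 0"
  interpret A: char_pair "\<lambda>_. 1" sgn_c by (rule char_pair_one_sign)
  interpret B: char_pair sgn_c "\<lambda>_. 1" by (rule char_pair_sign_one)
  have zP: "u \<in> P" if "z u \<noteq> 0" for u using cl that by (auto simp: class_function_def)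
  have conj: "z (\<pi> \<circ> u \<circ> inv \<pi>) = z u" if "\<pi> \<in> P" "u \<in> P" for \<pi> u
    using cl that by (auto simp: class_function_def)
  have "A.killed {0..<N} k n z"
    using ann unfolding A.killed_def A.esum_def A.dsum_def annihilated_def by simp
  from A.killed_colouring[OF _ this]
  obtain h y1 where h: "\<forall>x\<in>{0..<N}. h x < k" "\<forall>i<k. card {x \<in> {0..<N}. h x = i} = n"
    and y1: "(\<Sum>s\<in>stab {0..<N} h. sgn_c s * z (s \<circ> y1)) \<noteq> 0"
    using nz by (auto simp: N_def)
  obtain \<pi>1 where p1: "\<pi>1 permutes {0..<N}" "\<And>x. x \<in> {0..<N} \<Longrightarrow> x mod k = h (\<pi>1 x)"
    using colouring_permutes[of "{0..<N}" h k "\<lambda>x. x mod k"] h k card_mod_class by auto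
  have p1P: "\<pi>1 \<in> P" using p1 by (simp add: P_def)
  have y1P: "y1 \<in> P"
  proof -
    obtain s where s: "s \<in> stab {0..<N} h" "sgn_c s * z (s \<circ> y1) \<noteq> 0"
      using y1 by (rule sum.not_neutral_contains_not_neutral)
    then have "s \<in> P" by (auto simp: P_def dest: stabD(1))
    moreover have "s \<circ> y1 \<in> P" using s zP by auto
    ultimately show ?thesis by simp
  qed
  define v where "v u = (\<Sum>q\<in>Col. sgn_c q * z (u \<circ> q))" for u
  define y2 where "y2 = inv \<pi>1 \<circ> y1 \<circ> \<pi>1"
  have y2P: "y2 \<in> P" using y1P p1P P.inv_G P.comp_G by (simp add: y2_def)
  have "(\<Sum>s\<in>stab {0..<N} h. sgn_c s * z (s \<circ> y1)) =
      (\<Sum>q\<in>Col. sgn_c (\<pi>1 \<circ> q \<circ> inv \<pi>1) * z (\<pi>1 \<circ> q \<circ> inv \<pi>1 \<circ> y1))"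
    unfolding Col_def by (rule sum_stab_conj[where h = h, OF p1])
  also have "\<dots> = v y2" unfolding v_def
  proof (intro sum.cong refl)
    fix q assume "q \<in> Col"
    then have q: "q \<in> P" by (rule Col_P)
    have "z (\<pi>1 \<circ> q \<circ> inv \<pi>1 \<circ> y1) = z (\<pi>1 \<circ> (q \<circ> y2) \<circ> inv \<pi>1)"
      using p1P by (simp add: y2_def comp_assoc)
    also have "\<dots> = z (q \<circ> y2)" using conj p1P q y2P by simp
    also have "\<dots> = z (y2 \<circ> q)" using cl q y2P by (rule class_function_commute)
    finally show "sgn_c (\<pi>1 \<circ> q \<circ> inv \<pi>1) * z (\<pi>1 \<circ> q \<circ> inv \<pi>1 \<circ> y1) = sgn_c q * z (y2 \<circ> q)"
      using B.e_conj permutation_P q p1P by simp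
  qed
  finally have vy2: "v y2 \<noteq> 0" using y1 by simp
  \<comment> \<open>The columns act on the right and the killing relations on the left, so
    \<open>v\<close> inherits them; with the characters exchanged, the construction now yields
    \<open>n\<close> rows of \<open>k\<close> letters.\<close>
  have "B.killed {0..<N} n k v"
    unfolding B.killed_def B.esum_def B.dsum_def
  proof (intro conjI allI impI)
    fix X y assume X: "X \<subseteq> {0..<N}" "card X = Suc n"
    have "(\<Sum>s | s permutes X. sgn_c s * v (s \<circ> y)) =
        (\<Sum>q\<in>Col. \<Sum>s | s permutes X. sgn_c q * (sgn_c s * z (s \<circ> (y \<circ> q))))"
      unfolding v_def sum_distrib_left by (subst sum.swap) (simp add: comp_assoc mult.left_commute)
    also have "\<dots> = 0"
      using ann X unfolding annihilated_def by (simp add: sum_distrib_left[symmetric])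
    finally show "(\<Sum>s | s permutes X. sgn_c s * v (s \<circ> y)) = 0" .
  next
    fix X y assume X: "X \<subseteq> {0..<N}" "card X = Suc k"
    have "(\<Sum>s | s permutes X. 1 * v (s \<circ> y)) =
        (\<Sum>q\<in>Col. \<Sum>s | s permutes X. sgn_c q * z (s \<circ> (y \<circ> q)))"
      unfolding v_def mult_1 by (subst sum.swap) (simp add: comp_assoc)
    also have "\<dots> = 0"
      using ann X unfolding annihilated_def by (simp add: sum_distrib_left[symmetric])
    finally show "(\<Sum>s | s permutes X. 1 * v (s \<circ> y)) = 0" .
  qed
  from B.killed_colouring[OF _ this]
  obtain g y3 where g: "\<forall>x\<in>{0..<N}. g x < n" "\<forall>i<n. card {x \<in> {0..<N}. g x = i} = k"
    and y3: "(\<Sum>s\<in>stab {0..<N} g. v (s \<circ> y3)) \<noteq> 0"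
    using vy2 by (auto simp: N_def mult.commute)
  obtain \<pi> where pi: "\<pi> permutes {0..<N}" "\<And>x. x \<in> {0..<N} \<Longrightarrow> x div k = g (\<pi> x)"
    using colouring_permutes[of "{0..<N}" g n "\<lambda>x. x div k"] g row_less card_div_class by auto
  have piP: "\<pi> \<in> P" using pi by (simp add: P_def)
  have y3P: "y3 \<in> P"
  proof -
    obtain s where s: "s \<in> stab {0..<N} g" "v (s \<circ> y3) \<noteq> 0"
      using y3 by (rule sum.not_neutral_contains_not_neutral)
    then have "s \<in> P" by (auto simp: P_def dest: stabD(1))
    moreover obtain q where "q \<in> Col" "sgn_c q * z (s \<circ> y3 \<circ> q) \<noteq> 0"
      using s(2) unfolding v_def by (rule sum.not_neutral_contains_not_neutral)
    then have "s \<circ> y3 \<circ> q \<in> P" "q \<in> P" using zP Col_P by auto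
    ultimately show ?thesis by simp
  qed
  define x where "x = inv \<pi> \<circ> y3"
  have xP: "x \<in> P" using piP y3P P.inv_G P.comp_G by (simp add: x_def)
  \<comment> \<open>Conjugation invariance has brought \<pi> to the far end, so \<open>u\<close> has
    only row permutations on its left and column permutations next to it on its right.\<close>
  define F where "F u = (\<Sum>p\<in>Row. \<Sum>q\<in>Col. sgn_c q * z (p \<circ> u \<circ> q \<circ> \<pi>))" for u
  have "(\<Sum>s\<in>stab {0..<N} g. v (s \<circ> y3)) = (\<Sum>p\<in>Row. v (\<pi> \<circ> p \<circ> inv \<pi> \<circ> y3))"
    unfolding Row_def using sum_stab_conj[where h = g, OF pi, of "\<lambda>s. v (s \<circ> y3)"] by simp
  also have "\<dots> = F x" unfolding v_def F_def
  proof (intro sum.cong refl)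
    fix p q assume pq: "p \<in> Row" "q \<in> Col"
    have "p \<circ> x \<circ> q \<in> P" using pq xP Row_P Col_P P.comp_G by simp
    moreover have "\<pi> \<circ> p \<circ> inv \<pi> \<circ> y3 \<circ> q = \<pi> \<circ> (p \<circ> x \<circ> q)" by (simp add: x_def comp_assoc)
    ultimately have "z (\<pi> \<circ> p \<circ> inv \<pi> \<circ> y3 \<circ> q) = z (p \<circ> x \<circ> q \<circ> \<pi>)"
      using class_function_commute[OF cl piP] by metis
    then show "sgn_c q * z (\<pi> \<circ> p \<circ> inv \<pi> \<circ> y3 \<circ> q) = sgn_c q * z (p \<circ> x \<circ> q \<circ> \<pi>)" by simp
  qed
  finally have "F x \<noteq> 0" using y3 by simp
  moreover have "F x = F id * c x"
  proof (rule row_col_unique[OF _ _ xP])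
    fix p u assume p: "p \<in> Row"
    have "F (p \<circ> u) = (\<Sum>p'\<in>Row. \<Sum>q\<in>Col. sgn_c q * z (p' \<circ> p \<circ> u \<circ> q \<circ> \<pi>))"
      by (simp add: F_def comp_assoc)
    also have "\<dots> = F u" unfolding F_def by (rule Row.sum_right[OF p])
    finally show "F (p \<circ> u) = F u" .
  next
    fix q u assume q: "q \<in> Col"
    have "F (u \<circ> q) = (\<Sum>p\<in>Row. \<Sum>q'\<in>Col. sgn_c q * (sgn_c (q \<circ> q') * z (p \<circ> u \<circ> (q \<circ> q') \<circ> \<pi>)))"
      unfolding F_def using q by (intro sum.cong refl) (simp add: sgn_c_comp Col_P comp_assoc mult.assoc[symmetric])
    also have "\<dots> = sgn_c q * F u"
      unfolding F_def sum_distrib_left by (intro sum.cong refl Col.sum_left[OF q])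
    finally show "F (u \<circ> q) = sgn_c q * F u" .
  qed
  ultimately have "F id \<noteq> 0" by auto
  \<comment> \<open>The variable now takes the place of \<pi>: \<open>G (inv \<pi>)\<close> is
    \<open>F id\<close>. The inverse in the body puts rows on the left and columns on the right of
    \<open>u\<close>.\<close>
  define G where "G u = (\<Sum>p\<in>Row. \<Sum>q\<in>Col. sgn_c q * z (p \<circ> q \<circ> inv u))" for u
  have ip: "inv \<pi> \<in> P" using piP by (rule P.inv_G)
  have "G (inv \<pi>) = G id * c (inv \<pi>)"
  proof (rule row_col_unique[OF _ _ ip])
    fix p u assume p: "p \<in> Row" and u: "u \<in> P"
    have pP: "p \<in> P" using p by (rule Row_P)
    have "G (p \<circ> u) = (\<Sum>p'\<in>Row. \<Sum>q\<in>Col. sgn_c q * z (inv p \<circ> p' \<circ> q \<circ> inv u))"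
      unfolding G_def
    proof (intro sum.cong refl)
      fix p' q assume pq: "p' \<in> Row" "q \<in> Col"
      have "p' \<circ> q \<circ> inv u \<in> P" using pq u Row_P Col_P P.comp_G P.inv_G by simp
      from class_function_commute[OF cl this P.inv_G[OF pP]]
      show "sgn_c q * z (p' \<circ> q \<circ> inv (p \<circ> u)) = sgn_c q * z (inv p \<circ> p' \<circ> q \<circ> inv u)"
        using inv_comp_P[OF pP u] by (simp add: comp_assoc)
    qed
    also have "\<dots> = G u" unfolding G_def by (rule Row.sum_left[OF Row.inv_G[OF p]])
    finally show "G (p \<circ> u) = G u" .
  next
    fix q u assume q: "q \<in> Col" and u: "u \<in> P"
    have qP: "q \<in> P" using q by (rule Col_P)
    have "G (u \<circ> q) = (\<Sum>p\<in>Row. \<Sum>q'\<in>Col. sgn_c q * (sgn_c (q' \<circ> inv q) * z (p \<circ> (q' \<circ> inv q) \<circ> inv u)))"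
      unfolding G_def using q
      by (intro sum.cong refl)
        (simp add: sgn_c_comp sgn_c_inv Col_P P.inv_G comp_assoc inv_comp_P[OF u qP] mult.left_commute)
    also have "\<dots> = sgn_c q * G u"
      unfolding G_def sum_distrib_left by (intro sum.cong refl Col.sum_right[OF Col.inv_G[OF q]])
    finally show "G (u \<circ> q) = sgn_c q * G u" .
  qed
  moreover have "G id = 0" using orth by (simp add: G_def)
  moreover have "G (inv \<pi>) = F id" using piP by (simp add: G_def F_def)
  ultimately show False using \<open>F id \<noteq> 0\<close> by simp
qed

text \<open>By \<open>irr_char_rect\<close>, this is \<kappa> times the irreducible character at the
  inverse of \<open>x\<close>.\<close>

definition E :: "(nat \<Rightarrow> nat) \<Rightarrow> complex" where
  "E x = (\<Sum>y\<in>P. c (inv y \<circ> x \<circ> y))"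

lemma E_class: "class_function E"
  unfolding class_function_def
proof (intro conjI ballI allI impI)
  fix u assume u: "u \<notin> P"
  have "inv y \<circ> u \<circ> y \<notin> P" if "y \<in> P" for y using that u by (simp add: P.inv_G)
  then show "E u = 0" by (simp add: E_def c_outside)
next
  fix \<pi> u assume pu: "\<pi> \<in> P" "u \<in> P"
  have "E (\<pi> \<circ> u \<circ> inv \<pi>) = (\<Sum>y\<in>P. c (inv (\<pi> \<circ> y) \<circ> (\<pi> \<circ> u \<circ> inv \<pi>) \<circ> (\<pi> \<circ> y)))"
    unfolding E_def by (rule P.sum_left[OF pu(1), symmetric])
  also have "\<dots> = E u"
    unfolding E_def using pu by (intro sum.cong refl) (simp add: inv_comp_P comp_assoc)
  finally show "E (\<pi> \<circ> u \<circ> inv \<pi>) = E u" .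
qed

lemma E_annihilated: "annihilated E"
  unfolding annihilated_def
proof (intro conjI allI impI)
  have out: "E (s \<circ> y) = 0" if "y \<notin> P" "s permutes X" "X \<subseteq> {0..<N}" for s y X
  proof -
    have "s \<in> P" using that(2,3) by (auto simp: P_def intro: permutes_subset)
    then have "s \<circ> y \<notin> P" using that(1) by simp
    then show ?thesis using E_class by (simp add: class_function_def)
  qed
  fix X y
  {
    assume X: "X \<subseteq> {0..<N}" "card X = Suc k"
    show "(\<Sum>s | s permutes X. E (s \<circ> y)) = 0"
    proof (cases "y \<in> P")
      case True
      have "(\<Sum>s | s permutes X. E (s \<circ> y)) = (\<Sum>w\<in>P. \<Sum>s | s permutes X. c (inv w \<circ> s \<circ> (y \<circ> w)))"
        unfolding E_def by (subst sum.swap) (simp add: comp_assoc)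
      also have "\<dots> = 0" using True X by (simp add: c_kill_row)
      finally show ?thesis .
    qed (use X out in simp)
  next
    assume X: "X \<subseteq> {0..<N}" "card X = Suc n"
    show "(\<Sum>s | s permutes X. sgn_c s * E (s \<circ> y)) = 0"
    proof (cases "y \<in> P")
      case True
      have "(\<Sum>s | s permutes X. sgn_c s * E (s \<circ> y)) =
          (\<Sum>w\<in>P. \<Sum>s | s permutes X. sgn_c s * c (inv w \<circ> s \<circ> (y \<circ> w)))"
        unfolding E_def sum_distrib_left by (subst sum.swap) (simp add: comp_assoc)
      also have "\<dots> = 0" using X by (simp add: c_kill_col P.inv_G)
      finally show ?thesis .
    qed (use X out in simp)
  }
qed

lemma card_P_pos: "card P > 0"
  using P.finite_G P.id_G by (auto simp: card_gt_0_iff)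

lemma E_id: "E id = of_nat (card P)"
proof -
  have "E id = (\<Sum>y\<in>P. 1)"
    unfolding E_def by (intro sum.cong refl) (simp add: c_id)
  then show ?thesis by simp
qed

lemma sum_c_mult: "(\<Sum>x\<in>P. c x * z x) = (\<Sum>p\<in>Row. \<Sum>q\<in>Col. sgn_c q * z (p \<circ> q))"
proof -
  have "(\<Sum>x\<in>P. c x * z x) = (\<Sum>x\<in>P. \<Sum>p\<in>Row. \<Sum>q\<in>Col. if x = p \<circ> q then sgn_c q * z x else 0)"
    unfolding c_eq sum_distrib_right by (intro sum.cong refl) simp
  also have "\<dots> = (\<Sum>p\<in>Row. \<Sum>x\<in>P. \<Sum>q\<in>Col. if x = p \<circ> q then sgn_c q * z x else 0)"
    by (rule sum.swap)
  also have "\<dots> = (\<Sum>p\<in>Row. \<Sum>q\<in>Col. \<Sum>x\<in>P. if x = p \<circ> q then sgn_c q * z x else 0)"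
    by (intro sum.cong refl sum.swap)
  also have "\<dots> = (\<Sum>p\<in>Row. \<Sum>q\<in>Col. sgn_c q * z (p \<circ> q))"
  proof (intro sum.cong refl)
    fix p q assume "p \<in> Row" "q \<in> Col"
    then have "p \<circ> q \<in> P" using Row_P Col_P P.comp_G by blast
    then show "(\<Sum>x\<in>P. if x = p \<circ> q then sgn_c q * z x else 0) = sgn_c q * z (p \<circ> q)"
      using P.finite_G by simp
  qed
  finally show ?thesis .
qed

lemma sum_square_nonzero:
  assumes "\<And>u. f u \<in> \<real>" "f id \<noteq> 0"
  shows "(\<Sum>u\<in>P. f u * f u :: complex) \<noteq> 0"
proof -
  have f: "f u = of_real (Re (f u))" for u using assms(1)[of u] by (simp add: of_real_Re)
  have "(\<Sum>u\<in>P. f u * f u) = of_real (\<Sum>u\<in>P. Re (f u) * Re (f u))"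
    unfolding of_real_sum of_real_mult f[symmetric] ..
  moreover have "(\<Sum>u\<in>P. Re (f u) * Re (f u)) > 0"
  proof (rule sum_pos2[of _ id])
    have "Re (f id) \<noteq> 0" using assms(2) f[of id] by auto
    then show "0 < Re (f id) * Re (f id)" by (metis not_real_square_gt_zero)
  qed (use P.finite_G P.id_G in auto)
  ultimately show ?thesis by (metis less_irrefl of_real_eq_0_iff)
qed

text \<open>All conjugates of \<open>c\<close> have the same pairing with the class function
  \<open>E\<close>. Hence \<open>card P\<close> times the pairing is the sum of the squares of the
  real values of \<open>E\<close>, which is positive because of \<open>E id\<close>.\<close>

lemma sum_c_E_nonzero: "(\<Sum>x\<in>P. c x * E x) \<noteq> 0"
proof -
  have "(\<Sum>x\<in>P. E x * E x) = (\<Sum>x\<in>P. \<Sum>y\<in>P. c (inv y \<circ> x \<circ> y) * E x)"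
    unfolding E_def[of x for x] sum_distrib_right ..
  also have "\<dots> = (\<Sum>y\<in>P. \<Sum>x\<in>P. c (inv y \<circ> x \<circ> y) * E x)" by (rule sum.swap)
  also have "\<dots> = (\<Sum>y\<in>P. \<Sum>x\<in>P. c x * E x)"
  proof (rule sum.cong[OF refl])
    fix y assume y: "y \<in> P"
    have "(\<Sum>x\<in>P. c (inv y \<circ> x \<circ> y) * E x) = (\<Sum>x\<in>P. c (inv y \<circ> (y \<circ> x) \<circ> y) * E (y \<circ> x))"
      by (rule P.sum_left[OF y, symmetric])
    also have "\<dots> = (\<Sum>x\<in>P. c (inv y \<circ> (y \<circ> (x \<circ> inv y)) \<circ> y) * E (y \<circ> (x \<circ> inv y)))"
      by (rule P.sum_right[OF P.inv_G[OF y], symmetric])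
    also have "\<dots> = (\<Sum>x\<in>P. c x * E x)"
    proof (intro sum.cong refl)
      fix x assume x: "x \<in> P"
      have "E (y \<circ> (x \<circ> inv y)) = E x" using E_class x y by (simp add: class_function_def comp_assoc)
      then show "c (inv y \<circ> (y \<circ> (x \<circ> inv y)) \<circ> y) * E (y \<circ> (x \<circ> inv y)) = c x * E x"
        using y by (simp add: comp_assoc)
    qed
    finally show "(\<Sum>x\<in>P. c (inv y \<circ> x \<circ> y) * E x) = (\<Sum>x\<in>P. c x * E x)" .
  qed
  also have "\<dots> = of_nat (card P) * (\<Sum>x\<in>P. c x * E x)" by simp
  finally have "(\<Sum>x\<in>P. E x * E x) = of_nat (card P) * (\<Sum>x\<in>P. c x * E x)" .
  moreover have "(\<Sum>x\<in>P. E x * E x) \<noteq> 0"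
    using card_P_pos E_id by (intro sum_square_nonzero) (auto simp: E_def intro!: sum_in_Reals c_real)
  ultimately show ?thesis by auto
qed

text \<open>Subtracting the multiple of \<open>E\<close> that has the same pairing with
  \<open>c\<close> leaves a function that vanishes by \<open>annihilated_unique\<close>.\<close>

lemma class_function_proportional:
  assumes cl: "class_function z" and ann: "annihilated z"
  shows "z u * E id = z id * E u"
proof -
  define t where "t = (\<Sum>x\<in>P. c x * z x) / (\<Sum>x\<in>P. c x * E x)"
  define w where "w u = z u - t * E u" for u
  have "class_function w"
    using cl E_class unfolding class_function_def w_def by simp
  moreover have "annihilated w"
    unfolding annihilated_def w_def
  proof (intro conjI allI impI)
    fix X y assume X: "X \<subseteq> {0..<N}" "card X = Suc k"
    have "(\<Sum>s | s permutes X. z (s \<circ> y)) = 0" "(\<Sum>s | s permutes X. E (s \<circ> y)) = 0"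
      using ann E_annihilated X unfolding annihilated_def by auto
    then show "(\<Sum>s | s permutes X. z (s \<circ> y) - t * E (s \<circ> y)) = 0"
      by (simp add: sum_subtractf sum_distrib_left[symmetric])
  next
    fix X y assume X: "X \<subseteq> {0..<N}" "card X = Suc n"
    have "(\<Sum>s | s permutes X. sgn_c s * z (s \<circ> y)) = 0" "(\<Sum>s | s permutes X. sgn_c s * E (s \<circ> y)) = 0"
      using ann E_annihilated X unfolding annihilated_def by auto
    then show "(\<Sum>s | s permutes X. sgn_c s * (z (s \<circ> y) - t * E (s \<circ> y))) = 0"
      by (simp add: right_diff_distrib sum_subtractf mult.left_commute sum_distrib_left[symmetric])
  qed
  moreover have "(\<Sum>x\<in>P. c x * w x) = 0"
  proof -
    have "(\<Sum>x\<in>P. c x * w x) = (\<Sum>x\<in>P. c x * z x) - t * (\<Sum>x\<in>P. c x * E x)"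
      by (simp add: w_def right_diff_distrib sum_subtractf mult.left_commute sum_distrib_left)
    then show ?thesis using sum_c_E_nonzero by (simp add: t_def)
  qed
  ultimately have "w u = 0" for u using annihilated_unique sum_c_mult by metis
  then have "z u = t * E u" for u by (simp add: w_def)
  then show ?thesis by simp
qed

section \<open>The Young symmetrizer as a multiple of an idempotent\<close>

definition \<kappa> :: complex where "\<kappa> = (\<Sum>u\<in>P. c u * c (inv u))"

text \<open>The square of \<open>c\<close> is covariant under rows and columns like
  \<open>c\<close>, hence a multiple of it; the factor is its coefficient at the identity.\<close>

lemma c_idempotent:
  assumes "w \<in> P"
  shows "(\<Sum>u\<in>P. c u * c (inv u \<circ> w)) = \<kappa> * c w"
proof -
  define F where "F w = (\<Sum>u\<in>P. c u * c (inv u \<circ> w))" for w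
  have "F w = F id * c w"
  proof (rule row_col_unique[OF _ _ assms])
    fix p u assume p: "p \<in> Row" and u: "u \<in> P"
    have "F (p \<circ> u) = (\<Sum>x\<in>P. c (p \<circ> x) * c (inv (p \<circ> x) \<circ> (p \<circ> u)))"
      unfolding F_def by (rule P.sum_left[OF Row_P[OF p], symmetric])
    also have "\<dots> = F u"
      unfolding F_def using p by (intro sum.cong refl) (simp add: c_row inv_comp_P Row_P comp_assoc)
    finally show "F (p \<circ> u) = F u" .
  next
    fix q u assume q: "q \<in> Col" and u: "u \<in> P"
    show "F (u \<circ> q) = sgn_c q * F u"
      unfolding F_def sum_distrib_left
    proof (intro sum.cong refl)
      fix x
      have "c (inv x \<circ> (u \<circ> q)) = sgn_c q * c (inv x \<circ> u)" using c_col[OF q, of "inv x \<circ> u"] by (simp add: comp_assoc)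
      then show "c x * c (inv x \<circ> (u \<circ> q)) = sgn_c q * (c x * c (inv x \<circ> u))" by simp
    qed
  qed
  then show ?thesis by (simp add: F_def \<kappa>_def)
qed

lemma c_convolution:
  assumes a: "a \<in> P"
  shows "(\<Sum>y\<in>P. c (inv a \<circ> y) * c (inv y \<circ> z)) = \<kappa> * c (inv a \<circ> z)"
proof -
  have "(\<Sum>y\<in>P. c (inv a \<circ> y) * c (inv y \<circ> z)) =
      (\<Sum>y\<in>P. c (inv a \<circ> (a \<circ> y)) * c (inv (a \<circ> y) \<circ> z))"
    by (rule P.sum_left[OF a, symmetric])
  also have "\<dots> = (\<Sum>y\<in>P. c y * c (inv y \<circ> (inv a \<circ> z)))"
    using a by (intro sum.cong refl) (simp add: inv_comp_P comp_assoc)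
  also have "\<dots> = \<kappa> * c (inv a \<circ> z)"
  proof (cases "inv a \<circ> z \<in> P")
    case True
    then show ?thesis by (rule c_idempotent)
  next
    case False
    then have "inv y \<circ> (inv a \<circ> z) \<notin> P" if "y \<in> P" for y using that P.inv_G by simp
    then show ?thesis using False by (simp add: c_outside)
  qed
  finally show ?thesis .
qed

text \<open>With \<open>d = c a\<close>, where \<open>a\<close> is the sum of the row group, \<open>d\<close> is real and symmetric and
  \<open>\<Sum>\<^sub>w d(w)\<^sup>2 = |Row|\<^sup>2 \<kappa>\<close>.\<close>

lemma \<kappa>_nonzero: "\<kappa> \<noteq> 0"
proof -
  define d where "d w = (\<Sum>p\<in>Row. c (w \<circ> p))" for w
  have d_eq: "d w = (\<Sum>p\<in>Row. \<Sum>p'\<in>Row. \<Sum>q\<in>Col. if w = p' \<circ> q \<circ> p then sgn_c q else 0)"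
    if w: "w \<in> P" for w
  proof -
    have "d w = (\<Sum>p\<in>Row. c (w \<circ> inv p))"
      unfolding d_def by (rule Row.sum_inv[symmetric])
    also have "\<dots> = (\<Sum>p\<in>Row. \<Sum>p'\<in>Row. \<Sum>q\<in>Col. if w = p' \<circ> q \<circ> p then sgn_c q else 0)"
      unfolding c_eq
    proof (intro sum.cong refl)
      fix p p' and q :: "nat \<Rightarrow> nat" assume p: "p \<in> Row"
      have "w \<circ> inv p = p' \<circ> q \<longleftrightarrow> w = p' \<circ> q \<circ> p"
        using inv_P(3,4)[OF Row_P[OF p]] by (metis comp_assoc comp_id)
      then show "(if w \<circ> inv p = p' \<circ> q then sgn_c q else 0) = (if w = p' \<circ> q \<circ> p then sgn_c q else 0)"
        by simp
    qed
    finally show ?thesis .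
  qed
  have reindex: "(\<Sum>p\<in>Row. \<Sum>p'\<in>Row. \<Sum>q\<in>Col. f p p' q) =
      (\<Sum>p\<in>Row. \<Sum>p'\<in>Row. \<Sum>q\<in>Col. f (inv p) (inv p') (inv q))"
    for f :: "(nat \<Rightarrow> nat) \<Rightarrow> (nat \<Rightarrow> nat) \<Rightarrow> (nat \<Rightarrow> nat) \<Rightarrow> complex"
  proof -
    have "(\<Sum>p\<in>Row. \<Sum>p'\<in>Row. \<Sum>q\<in>Col. f p p' q) = (\<Sum>p\<in>Row. \<Sum>p'\<in>Row. \<Sum>q\<in>Col. f (inv p) p' q)"
      by (rule Row.sum_inv[symmetric])
    also have "\<dots> = (\<Sum>p\<in>Row. \<Sum>p'\<in>Row. \<Sum>q\<in>Col. f (inv p) (inv p') q)"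
      by (rule sum.cong[OF refl], rule Row.sum_inv[symmetric])
    also have "\<dots> = (\<Sum>p\<in>Row. \<Sum>p'\<in>Row. \<Sum>q\<in>Col. f (inv p) (inv p') (inv q))"
      by (rule sum.cong[OF refl], rule sum.cong[OF refl], rule Col.sum_inv[symmetric])
    finally show ?thesis .
  qed
  have d_inv: "d (inv w) = d w" if w: "w \<in> P" for w
  proof -
    have "d (inv w) = (\<Sum>p\<in>Row. \<Sum>p'\<in>Row. \<Sum>q\<in>Col. if inv w = inv p' \<circ> inv q \<circ> inv p then sgn_c (inv q) else 0)"
      unfolding d_eq[OF P.inv_G[OF w]] by (rule reindex)
    also have "\<dots> = (\<Sum>p\<in>Row. \<Sum>p'\<in>Row. \<Sum>q\<in>Col. if w = p \<circ> q \<circ> p' then sgn_c q else 0)"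
    proof (intro sum.cong refl)
      fix p p' q assume pq: "p \<in> Row" "p' \<in> Row" "q \<in> Col"
      have P: "p \<in> P" "p' \<in> P" "q \<in> P" using pq Row_P Col_P by auto
      then have "inv p' \<circ> inv q \<circ> inv p = inv (p \<circ> q \<circ> p')"
        by (simp add: inv_comp_P P.comp_G comp_assoc)
      moreover have "inv w = inv u \<longleftrightarrow> w = u" if "u \<in> P" for u using w that by (metis inv_P(5))
      ultimately show "(if inv w = inv p' \<circ> inv q \<circ> inv p then sgn_c (inv q) else 0) =
          (if w = p \<circ> q \<circ> p' then sgn_c q else 0)"
        using P P.comp_G sgn_c_inv[of q] by simp
    qed
    also have "\<dots> = d w" unfolding d_eq[OF w] by (rule sum.swap)
    finally show ?thesis .
  qed
  have cp: "c p = 1" if "p \<in> Row" for p using c_row[OF that, of id] c_id by simp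
  have "(\<Sum>w\<in>P. d w * d w) = (\<Sum>w\<in>P. d w * d (inv w))"
    by (intro sum.cong refl) (simp add: d_inv)
  also have "\<dots> = (\<Sum>w\<in>P. \<Sum>p\<in>Row. \<Sum>p'\<in>Row. c (w \<circ> p) * c (inv w \<circ> p'))"
    unfolding d_def sum_product ..
  also have "\<dots> = (\<Sum>p\<in>Row. \<Sum>w\<in>P. \<Sum>p'\<in>Row. c (w \<circ> p) * c (inv w \<circ> p'))" by (rule sum.swap)
  also have "\<dots> = (\<Sum>p\<in>Row. \<Sum>p'\<in>Row. \<Sum>w\<in>P. c (w \<circ> p) * c (inv w \<circ> p'))"
    by (intro sum.cong refl sum.swap)
  also have "\<dots> = (\<Sum>p\<in>Row. \<Sum>p'\<in>Row. \<kappa>)"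
  proof (intro sum.cong refl)
    fix p p' assume p: "p \<in> Row" "p' \<in> Row"
    note pP = Row_P[OF p(1)]
    have "(\<Sum>w\<in>P. c (w \<circ> p) * c (inv w \<circ> p')) =
        (\<Sum>w\<in>P. c (w \<circ> inv p \<circ> p) * c (inv (w \<circ> inv p) \<circ> p'))"
      by (rule P.sum_right[OF P.inv_G[OF pP], symmetric])
    also have "\<dots> = (\<Sum>w\<in>P. c w * c (inv w \<circ> p'))"
    proof (intro sum.cong refl)
      fix w assume w: "w \<in> P"
      have "inv (w \<circ> inv p) \<circ> p' = p \<circ> (inv w \<circ> p')"
        using w pP by (simp add: inv_comp_P P.inv_G comp_assoc)
      then show "c (w \<circ> inv p \<circ> p) * c (inv (w \<circ> inv p) \<circ> p') = c w * c (inv w \<circ> p')"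
        using c_row[OF p(1)] pP by (simp add: comp_assoc)
    qed
    also have "\<dots> = \<kappa>" using c_idempotent[OF Row_P[OF p(2)]] cp[OF p(2)] by simp
    finally show "(\<Sum>w\<in>P. c (w \<circ> p) * c (inv w \<circ> p')) = \<kappa>" .
  qed
  finally have "(\<Sum>w\<in>P. d w * d w) = (\<Sum>p\<in>Row. \<Sum>p'\<in>Row. \<kappa>)" .
  moreover have "(\<Sum>w\<in>P. d w * d w) \<noteq> 0"
  proof (rule sum_square_nonzero)
    show "d u \<in> \<real>" for u unfolding d_def by (intro sum_in_Reals c_real)
    have "d id = of_nat (card Row)" unfolding d_def using cp by simp
    then show "d id \<noteq> 0" using Row.finite_G Row.id_G by (auto simp: card_eq_0_iff)
  qed
  ultimately show ?thesis by auto
qed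

end

section \<open>The character as a trace\<close>

lemma sum_apply: "(\<Sum>a\<in>A. f a) x = (\<Sum>a\<in>A. f a x)"
  by (induction A rule: infinite_finite_induct) auto

text \<open>\<open>Q y\<close> is the image of the basis vector \<open>y\<close> of the group algebra under a projection onto the
  span of \<open>B\<close>; the right-hand side is the trace of \<open>T Q\<close> on the group algebra.\<close>

lemma trace_via_projection:
  fixes T :: "((nat \<Rightarrow> nat) \<Rightarrow> complex) \<Rightarrow> ((nat \<Rightarrow> nat) \<Rightarrow> complex)"
  assumes ind: "cfun.independent B" and span: "cfun.span B = V" and fin: "finite B" "finite A"
    and QV: "\<And>y. y \<in> A \<Longrightarrow> Q y \<in> V"
    and proj: "\<And>v. v \<in> V \<Longrightarrow> v = (\<lambda>z. \<Sum>y\<in>A. v y * Q y z)"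
    and TV: "\<And>v. v \<in> V \<Longrightarrow> T v \<in> V"
    and lin: "\<And>f. T (\<lambda>z. \<Sum>b\<in>B. f b * b z) = (\<lambda>z. \<Sum>b\<in>B. f b * T b z)"
  shows "(\<Sum>b\<in>B. cfun.representation B (T b) b) = (\<Sum>y\<in>A. T (Q y) y)"
proof -
  let ?r = "cfun.representation B"
  have BV: "b \<in> V" if "b \<in> B" for b using cfun.span_base[OF that] span by simp
  have r: "?r (T b) b = (\<Sum>y\<in>A. T b y * ?r (Q y) b)" if b: "b \<in> B" for b
  proof -
    have "T b = (\<Sum>y\<in>A. (\<lambda>z. T b y * Q y z))"
    proof
      fix z
      show "T b z = (\<Sum>y\<in>A. (\<lambda>z. T b y * Q y z)) z"
        using fun_cong[OF proj[OF TV[OF BV[OF b]]], of z] unfolding sum_apply .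
    qed
    then have "?r (T b) = ?r (\<Sum>y\<in>A. (\<lambda>z. T b y * Q y z))" by (rule arg_cong)
    also have "\<dots> = (\<lambda>b'. \<Sum>y\<in>A. ?r (\<lambda>z. T b y * Q y z) b')"
      using QV span by (intro cfun.representation_sum ind) (auto intro: cfun.span_scale)
    also have "\<dots> = (\<lambda>b'. \<Sum>y\<in>A. T b y * ?r (Q y) b')"
      using QV span by (intro ext sum.cong refl) (simp add: cfun.representation_scale[OF ind])
    finally show ?thesis by simp
  qed
  have Q: "Q y = (\<lambda>z. \<Sum>b\<in>B. ?r (Q y) b * b z)" if "y \<in> A" for y
  proof -
    have "(\<Sum>b\<in>B. (\<lambda>z. ?r (Q y) b * b z)) = Q y"
      using QV[OF that] span by (intro cfun.sum_representation_eq ind fin) auto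
    from fun_cong[OF this] have "(\<Sum>b\<in>B. ?r (Q y) b * b z) = Q y z" for z
      unfolding sum_apply .
    then show ?thesis by (intro ext) (rule sym)
  qed
  have "(\<Sum>b\<in>B. ?r (T b) b) = (\<Sum>b\<in>B. \<Sum>y\<in>A. T b y * ?r (Q y) b)"
    by (rule sum.cong[OF refl r])
  also have "\<dots> = (\<Sum>y\<in>A. \<Sum>b\<in>B. T b y * ?r (Q y) b)" by (rule sum.swap)
  also have "\<dots> = (\<Sum>y\<in>A. T (Q y) y)"
  proof (rule sum.cong[OF refl])
    fix y assume y: "y \<in> A"
    have "T (Q y) = (\<lambda>z. \<Sum>b\<in>B. ?r (Q y) b * T b z)" by (subst Q[OF y]) (rule lin)
    then show "(\<Sum>b\<in>B. T b y * ?r (Q y) b) = T (Q y) y" by (simp add: mult.commute)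
  qed
  finally show ?thesis .
qed

lemma left_mult_linear:
  "left_mult x (\<lambda>z. \<Sum>b\<in>B. f b * g b z) = (\<lambda>z. \<Sum>b\<in>B. f b * left_mult x (g b) z)"
  by (simp add: left_mult_def)

text \<open>\<open>trace_on\<close> picks a basis with \<open>SOME\<close>; this shows that there is
  one to pick.\<close>

lemma finite_basis_exists:
  assumes "finite S"
  obtains B where "cfun.independent B" "cfun.span B = cfun.span S" "finite B"
proof -
  obtain B where B: "B \<subseteq> cfun.span S" "cfun.independent B" "cfun.span S \<subseteq> cfun.span B"
    using cfun.maximal_independent_subset[of "cfun.span S"] by blast
  have "finite B" using cfun.independent_span_bound[OF assms B(2,1)] by simp
  moreover have "cfun.span B = cfun.span S"
    using B(3) cfun.span_minimal[OF B(1) cfun.subspace_span] by blast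
  ultimately show ?thesis using that B(2) by blast
qed

text \<open>Both sides are linear in \<open>v\<close>, so a projection formula need only be checked
  on generators.\<close>

lemma linear_on_span:
  assumes S: "\<And>v. v \<in> S \<Longrightarrow> v = (\<lambda>z. \<Sum>y\<in>A. v y * Q y z)" and v: "v \<in> cfun.span S"
  shows "v = (\<lambda>z. \<Sum>y\<in>A. v y * Q y z)"
  using v
proof (rule cfun.span_induct)
  show "cfun.subspace {v. v = (\<lambda>z. \<Sum>y\<in>A. v y * Q y z)}"
    unfolding cfun.subspace_def
  proof (intro conjI ballI allI)
    show "0 \<in> {v. v = (\<lambda>z. \<Sum>y\<in>A. v y * Q y z)}" by (simp add: fun_eq_iff)
    fix u w assume "u \<in> {v. v = (\<lambda>z. \<Sum>y\<in>A. v y * Q y z)}" "w \<in> {v. v = (\<lambda>z. \<Sum>y\<in>A. v y * Q y z)}"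
    then have "u z = (\<Sum>y\<in>A. u y * Q y z)" "w z = (\<Sum>y\<in>A. w y * Q y z)" for z
      by (metis (mono_tags, lifting) mem_Collect_eq)+
    then have "(u + w) z = (\<Sum>y\<in>A. (u + w) y * Q y z)" for z
      unfolding plus_fun_apply distrib_right sum.distrib by metis
    then show "u + w \<in> {v. v = (\<lambda>z. \<Sum>y\<in>A. v y * Q y z)}" by (intro CollectI ext)
  next
    fix a u assume "u \<in> {v. v = (\<lambda>z. \<Sum>y\<in>A. v y * Q y z)}"
    then have "u z = (\<Sum>y\<in>A. u y * Q y z)" for z
      by (metis (mono_tags, lifting) mem_Collect_eq)
    then have "a * u z = (\<Sum>y\<in>A. a * u y * Q y z)" for z
      unfolding mult.assoc sum_distrib_left[symmetric] by metis
    then show "(\<lambda>y. a * u y) \<in> {v. v = (\<lambda>z. \<Sum>y\<in>A. v y * Q y z)}" by (intro CollectI ext)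
  qed
qed (use S in blast)

context rectangle
begin

lemma specht_rect: "specht_module (replicate n k) = cfun.span {left_mult x c | x. x \<in> P}"
  by (simp add: specht_module_def N_eq c_def P_def)

text \<open>The module is the left ideal generated by the idempotent \<open>c / \<kappa>\<close>, on
  which right multiplication by this idempotent is the identity.\<close>

lemma specht_projection:
  assumes "v \<in> specht_module (replicate n k)"
  shows "v = (\<lambda>z. \<Sum>y\<in>P. v y * (c (inv y \<circ> z) / \<kappa>))"
  using assms unfolding specht_rect
proof (rule linear_on_span[rotated])
  fix v assume "v \<in> {left_mult x c | x. x \<in> P}"
  then obtain x where x: "x \<in> P" and v: "v = left_mult x c" by blast
  show "v = (\<lambda>z. \<Sum>y\<in>P. v y * (c (inv y \<circ> z) / \<kappa>))"
  proof
    fix z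
    have "(\<Sum>y\<in>P. v y * (c (inv y \<circ> z) / \<kappa>)) = (\<Sum>y\<in>P. c (inv x \<circ> y) * c (inv y \<circ> z)) / \<kappa>"
      by (simp add: v left_mult_def sum_divide_distrib del: o_apply)
    also have "(\<Sum>y\<in>P. c (inv x \<circ> y) * c (inv y \<circ> z)) = \<kappa> * c (inv x \<circ> z)"
      by (rule c_convolution[OF x])
    finally show "v z = (\<Sum>y\<in>P. v y * (c (inv y \<circ> z) / \<kappa>))"
      using \<kappa>_nonzero by (simp add: v left_mult_def del: o_apply)
  qed
qed

text \<open>The trace becomes one over the whole group algebra, independent of the basis that
  \<open>SOME\<close> picks. The diagonal entry at \<open>y\<close> is the value of
  \<open>c / \<kappa>\<close> at a conjugate of the inverse of \<open>x\<close>.\<close>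

lemma irr_char_rect:
  assumes x: "x \<in> P"
  shows "irr_char (replicate n k) x = E (inv x) / \<kappa>"
proof -
  let ?V = "specht_module (replicate n k)"
  define B where "B = (SOME B. cfun.independent B \<and> cfun.span B = ?V)"
  have fin: "finite {left_mult x c | x. x \<in> P}" using P.finite_G by simp
  obtain B0 where "cfun.independent B0" "cfun.span B0 = ?V"
    using finite_basis_exists[OF fin] specht_rect by metis
  then have B: "cfun.independent B" "cfun.span B = ?V"
    unfolding B_def by (metis (mono_tags, lifting) someI_ex)+
  have finB: "finite B"
    using cfun.independent_span_bound[OF fin B(1)] B(2) cfun.span_superset[of B] specht_rect by simp
  have gen: "left_mult y c \<in> ?V" if "y \<in> P" for y
    using that unfolding specht_rect by (intro cfun.span_base) blast
  have scale: "(\<lambda>z. a * v z) \<in> ?V" if "v \<in> ?V" for a v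
    using that unfolding specht_rect by (rule cfun.span_scale)
  have "irr_char (replicate n k) x = (\<Sum>b\<in>B. cfun.representation B (left_mult x b) b)"
    by (simp add: irr_char_def trace_on_def B_def Let_def)
  also have "\<dots> = (\<Sum>y\<in>P. left_mult x (\<lambda>z. c (inv y \<circ> z) / \<kappa>) y)"
  proof (rule trace_via_projection[OF B finB P.finite_G])
    show "(\<lambda>z. c (inv y \<circ> z) / \<kappa>) \<in> ?V" if "y \<in> P" for y
      using scale[OF gen[OF that], of "1 / \<kappa>"] by (simp add: left_mult_def)
    show "v = (\<lambda>z. \<Sum>y\<in>P. v y * (c (inv y \<circ> z) / \<kappa>))" if "v \<in> ?V" for v
      using that by (rule specht_projection)
    show "left_mult x (\<lambda>z. \<Sum>b\<in>B. f b * b z) = (\<lambda>z. \<Sum>b\<in>B. f b * left_mult x b z)" for f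
      by (rule left_mult_linear)
    fix v assume "v \<in> ?V"
    then show "left_mult x v \<in> ?V" unfolding specht_rect
    proof (rule cfun.span_induct)
      show "cfun.subspace {v. left_mult x v \<in> cfun.span {left_mult x c |x. x \<in> P}}"
        unfolding cfun.subspace_def
      proof (intro conjI ballI allI)
        show "0 \<in> {v. left_mult x v \<in> cfun.span {left_mult x c |x. x \<in> P}}"
          using cfun.span_zero by (simp add: left_mult_def zero_fun_def)
        show "u + w \<in> {v. left_mult x v \<in> cfun.span {left_mult x c |x. x \<in> P}}"
          if "u \<in> {v. left_mult x v \<in> cfun.span {left_mult x c |x. x \<in> P}}"
            "w \<in> {v. left_mult x v \<in> cfun.span {left_mult x c |x. x \<in> P}}" for u w
          using cfun.span_add[of "left_mult x u" _ "left_mult x w"] that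
          by (simp add: left_mult_def plus_fun_def)
        show "(\<lambda>y. a * u y) \<in> {v. left_mult x v \<in> cfun.span {left_mult x c |x. x \<in> P}}"
          if "u \<in> {v. left_mult x v \<in> cfun.span {left_mult x c |x. x \<in> P}}" for u a
          using cfun.span_scale[of "left_mult x u" _ a] that by (simp add: left_mult_def)
      qed
    next
      fix v assume "v \<in> {left_mult x c | x. x \<in> P}"
      then obtain y where y: "y \<in> P" and v: "v = left_mult y c" by blast
      have "left_mult x v = left_mult (x \<circ> y) c"
        using x y by (simp add: v left_mult_def inv_comp_P comp_assoc)
      then show "left_mult x v \<in> cfun.span {left_mult x c |x. x \<in> P}"
        using gen[of "x \<circ> y"] x y specht_rect by simp
    qed
  qed
  also have "\<dots> = E (inv x) / \<kappa>"
    by (simp add: left_mult_def E_def sum_divide_distrib comp_assoc)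
  finally show ?thesis .
qed

end

section \<open>The alpha-beta-determinant\<close>

fun block :: "nat list \<Rightarrow> nat \<Rightarrow> nat" where
  "block [] b = 0"
| "block (m # ms) b = (if b < m then 0 else Suc (block ms (b - m)))"

lemma block_less: "b < sum_list \<mu> \<Longrightarrow> block \<mu> b < length \<mu>"
  by (induction \<mu> arbitrary: b) auto

lemma row_set_block:
  assumes "i < length \<mu>"
  shows "row_set \<mu> i = {b \<in> {0..<sum_list \<mu>}. block \<mu> b = i}"
  using assms
proof (induction \<mu> arbitrary: i)
  case (Cons m ms)
  show ?case
  proof (cases i)
    case 0
    then show ?thesis by (auto simp: row_set_def Let_def)
  next
    case (Suc i')
    have "b \<in> row_set (m # ms) i \<longleftrightarrow> m \<le> b \<and> b - m \<in> row_set ms i'" for b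
      by (auto simp: Suc row_set_def Let_def)
    moreover have "row_set ms i' = {b \<in> {0..<sum_list ms}. block ms b = i'}"
      using Cons Suc by simp
    ultimately show ?thesis by (auto simp: Suc)
  qed
qed simp

lemma young_subgroup_block: "young_subgroup \<mu> = stab {0..<sum_list \<mu>} (block \<mu>)"
proof -
  have "(\<forall>i<length \<mu>. \<sigma> ` row_set \<mu> i = row_set \<mu> i) \<longleftrightarrow> (\<forall>x\<in>{0..<sum_list \<mu>}. block \<mu> (\<sigma> x) = block \<mu> x)"
    if "\<sigma> permutes {0..<sum_list \<mu>}" for \<sigma>
  proof -
    have "block \<mu> ` {0..<sum_list \<mu>} \<subseteq> {..<length \<mu>}" using block_less by auto
    from stab_image_iff[OF that this] show ?thesis by (simp add: row_set_block Ball_def)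
  qed
  then show ?thesis unfolding young_subgroup_def stab_def by auto
qed

text \<open>The letters start at \<open>d\<close> so that the induction can pass to the tail of
  \<mu>, whose letters begin after the first block.\<close>

lemma card_stab_block:
  "card (stab {d..<d + sum_list \<mu>} (\<lambda>b. block \<mu> (b - d))) = part_fact \<mu>"
proof (induction \<mu> arbitrary: d)
  case Nil
  have "stab {} h = {id}" for h :: "nat \<Rightarrow> nat" by (auto simp: stab_def)
  then show ?case by (simp add: part_fact_def)
next
  case (Cons m ms)
  let ?S = "{d..<d + sum_list (m # ms)}" and ?C = "{d..<d + m}"
  let ?h = "\<lambda>b. block (m # ms) (b - d)"
  have S: "?S - ?C = {d + m..<d + m + sum_list ms}" by auto
  have "stab (?S - ?C) ?h = stab (?S - ?C) (\<lambda>b. Suc (block ms (b - (d + m))))"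
    by (rule stab_cong) auto
  also have "\<dots> = stab {d + m..<d + m + sum_list ms} (\<lambda>b. block ms (b - (d + m)))"
    unfolding S by (simp add: stab_def)
  finally have st: "card (stab (?S - ?C) ?h) = part_fact ms" using Cons.IH by simp
  have "card (stab ?S ?h) = (\<Sum>s\<in>stab ?S ?h. 1)" by simp
  also have "\<dots> = (\<Sum>q\<in>stab (?S - ?C) ?h. \<Sum>p | p permutes ?C. 1)"
    by (rule sum_stab_split[where i = 0]) auto
  also have "\<dots> = part_fact ms * fact m"
    using st by (simp add: card_permutations[of ?C m])
  finally show ?case by (simp add: part_fact_def mult.commute)
qed

lemma card_young_subgroup: "card (young_subgroup \<mu>) = part_fact \<mu>"
  using card_stab_block[of 0 \<mu>] by (simp add: young_subgroup_block)

lemma ones_part_index: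
  "dim_row (ones_part \<mu>) = sum_list \<mu> \<and> dim_col (ones_part \<mu>) = sum_list \<mu> \<and>
   (\<forall>i<sum_list \<mu>. \<forall>j<sum_list \<mu>. ones_part \<mu> $$ (i, j) = (if block \<mu> i = block \<mu> j then 1 else 0))"
proof (induction \<mu>)
  case Nil
  then show ?case by (simp add: ones_part_def)
next
  case (Cons m ms)
  have "ones_part (m # ms) =
      four_block_mat (ones m) (0\<^sub>m m (sum_list ms)) (0\<^sub>m (sum_list ms) m) (ones_part ms)"
    using Cons by (simp add: ones_part_def Let_def ones_def)
  then show ?case
    using Cons by (auto simp: ones_def)
qed

context rectangle
begin

section \<open>The powers of \<alpha> as class functions, and their product \<Psi>\<close>

definition \<phi> :: "complex \<Rightarrow> (nat \<Rightarrow> nat) \<Rightarrow> complex" where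
  "\<phi> \<alpha> u = (if u \<in> P then \<alpha> ^ nu N u else 0)"

lemma \<phi>_class: "class_function (\<phi> \<alpha>)"
  unfolding class_function_def
proof (intro conjI allI ballI impI)
  fix \<pi> u assume pu: "\<pi> \<in> P" "u \<in> P"
  then have "\<pi> \<circ> u \<circ> inv \<pi> \<in> P" using P.comp_G P.inv_G by simp
  moreover have "nu N (\<pi> \<circ> u \<circ> inv \<pi>) = nu N u" using pu by (intro nu_conj) (auto simp: P_def)
  ultimately show "\<phi> \<alpha> (\<pi> \<circ> u \<circ> inv \<pi>) = \<phi> \<alpha> u" using pu by (simp add: \<phi>_def)
qed (simp add: \<phi>_def)

lemma \<phi>_inv: "u \<in> P \<Longrightarrow> \<phi> \<alpha> (inv u) = \<phi> \<alpha> u"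
  using nu_inv[of u N] by (simp add: \<phi>_def P.inv_G P_def[symmetric]) (simp add: P_def)

lemma permutes_P: "X \<subseteq> {0..<N} \<Longrightarrow> s permutes X \<Longrightarrow> s \<in> P"
  by (auto simp: P_def intro: permutes_subset)

text \<open>At this base the factor with \<open>j = m\<close> in \<open>sum_power_nu_coset\<close>
  is 0, and \<open>m + 1\<close> letters are just enough for it to occur.\<close>

lemma \<phi>_coset_zero:
  assumes X: "X \<subseteq> {0..<N}" "card X = Suc m" and g: "g \<in> P" and m: "0 < m"
  shows "(\<Sum>s | s permutes X. \<phi> (- 1 / of_nat m) (g \<circ> s)) = 0"
proof -
  let ?a = "- 1 / of_nat m :: complex"
  have "(\<Sum>s | s permutes X. \<phi> ?a (g \<circ> s)) = (\<Sum>s | s permutes X. ?a ^ nu N (g \<circ> s))"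
    using permutes_P[OF X(1)] g P.comp_G by (intro sum.cong refl) (simp add: \<phi>_def)
  moreover obtain r where "(\<Sum>s | s permutes X. ?a ^ nu N (g \<circ> s)) = ?a ^ r * (\<Prod>j<card X. 1 + of_nat j * ?a)"
    using sum_power_nu_coset[OF X(1), of g ?a] g by (auto simp: P_def)
  moreover have "(\<Prod>j<card X. 1 + of_nat j * ?a) = 0"
  proof -
    have "1 + of_nat m * ?a = 0" using m by simp
    moreover have "m \<in> {..<card X}" using X by simp
    ultimately show ?thesis by (intro prod_zero) blast+
  qed
  ultimately show ?thesis by simp
qed

lemma \<phi>_sign_coset_zero:
  assumes X: "X \<subseteq> {0..<N}" "card X = Suc m" and g: "g \<in> P" and m: "0 < m"
  shows "(\<Sum>s | s permutes X. sgn_c s * \<phi> (1 / of_nat m) (g \<circ> s)) = 0"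
proof -
  have "sgn_c s * \<phi> (1 / of_nat m) (g \<circ> s) = sgn_c g * \<phi> (- 1 / of_nat m) (g \<circ> s)" if "s permutes X" for s
  proof -
    have s: "s \<in> P" using X(1) that by (rule permutes_P)
    then have gs: "g \<circ> s \<in> P" using g P.comp_G by simp
    have "sgn_c s = sgn_c g * sgn_c (g \<circ> s)" using g s by (simp add: sgn_c_comp)
    moreover have "sgn_c (g \<circ> s) = (-1) ^ nu N (g \<circ> s)"
      using sign_nu[of "g \<circ> s" N] gs by (simp add: P_def)
    moreover have "(-1) ^ r * (1 / of_nat m) ^ r = (- 1 / of_nat m :: complex) ^ r" for r
      by (simp add: power_mult_distrib[symmetric])
    ultimately show ?thesis using gs by (simp add: \<phi>_def mult.assoc)
  qed
  then have "(\<Sum>s | s permutes X. sgn_c s * \<phi> (1 / of_nat m) (g \<circ> s)) =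
      sgn_c g * (\<Sum>s | s permutes X. \<phi> (- 1 / of_nat m) (g \<circ> s))"
    by (simp add: sum_distrib_left)
  then show ?thesis using \<phi>_coset_zero[OF assms] by simp
qed

text \<open>The product in the group algebra; since \<phi> is invariant under inversion,
  \<open>u \<circ> \<sigma>\<close> may replace \<open>u \<circ> inv \<sigma>\<close>. This form
  matches the double sum in \<open>alpha_beta_det\<close>, with \<tau> in the role of
  \<open>u \<circ> \<sigma>\<close>.\<close>

definition \<Psi> :: "(nat \<Rightarrow> nat) \<Rightarrow> complex" where
  "\<Psi> u = (\<Sum>\<sigma>\<in>P. \<phi> (- 1 / of_nat k) (u \<circ> \<sigma>) * \<phi> (1 / of_nat n) \<sigma>)"

lemma \<Psi>_class: "class_function \<Psi>"
  unfolding class_function_def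
proof (intro conjI allI ballI impI)
  fix u assume "u \<notin> P"
  then show "\<Psi> u = 0" by (simp add: \<Psi>_def \<phi>_def)
next
  fix \<pi> u assume pu: "\<pi> \<in> P" "u \<in> P"
  have "\<Psi> (\<pi> \<circ> u \<circ> inv \<pi>) =
      (\<Sum>\<sigma>\<in>P. \<phi> (- 1 / of_nat k) (\<pi> \<circ> u \<circ> inv \<pi> \<circ> (\<pi> \<circ> \<sigma>)) * \<phi> (1 / of_nat n) (\<pi> \<circ> \<sigma>))"
    unfolding \<Psi>_def by (rule P.sum_left[OF pu(1), symmetric])
  also have "\<dots> = (\<Sum>\<sigma>\<in>P. \<phi> (- 1 / of_nat k) (\<pi> \<circ> u \<circ> inv \<pi> \<circ> (\<pi> \<circ> (\<sigma> \<circ> inv \<pi>))) * \<phi> (1 / of_nat n) (\<pi> \<circ> (\<sigma> \<circ> inv \<pi>)))"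
    by (rule P.sum_right[OF P.inv_G[OF pu(1)], symmetric])
  also have "\<dots> = \<Psi> u"
    unfolding \<Psi>_def
  proof (intro sum.cong refl)
    fix \<sigma> assume s: "\<sigma> \<in> P"
    have e: "\<pi> \<circ> u \<circ> inv \<pi> \<circ> (\<pi> \<circ> (\<sigma> \<circ> inv \<pi>)) = \<pi> \<circ> (u \<circ> \<sigma>) \<circ> inv \<pi>"
      "\<pi> \<circ> (\<sigma> \<circ> inv \<pi>) = \<pi> \<circ> \<sigma> \<circ> inv \<pi>"
      using pu by (simp_all add: comp_assoc)
    have inv: "\<phi> a (\<pi> \<circ> w \<circ> inv \<pi>) = \<phi> a w" if "w \<in> P" for a w
      using \<phi>_class that pu by (simp add: class_function_def)
    have "u \<circ> \<sigma> \<in> P" using s pu P.comp_G by simp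
    then show "\<phi> (- 1 / of_nat k) (\<pi> \<circ> u \<circ> inv \<pi> \<circ> (\<pi> \<circ> (\<sigma> \<circ> inv \<pi>))) * \<phi> (1 / of_nat n) (\<pi> \<circ> (\<sigma> \<circ> inv \<pi>)) =
        \<phi> (- 1 / of_nat k) (u \<circ> \<sigma>) * \<phi> (1 / of_nat n) \<sigma>"
      unfolding e(1) unfolding e(2) by (simp only: inv s)
  qed
  finally show "\<Psi> (\<pi> \<circ> u \<circ> inv \<pi>) = \<Psi> u" .
qed

text \<open>Moves \<open>u\<close> to the factor with \<open>1 / n\<close>, on which the
  antisymmetrizer of \<open>n + 1\<close> letters has to act.\<close>

lemma \<Psi>_alt:
  assumes "u \<in> P"
  shows "\<Psi> u = (\<Sum>\<sigma>\<in>P. \<phi> (- 1 / of_nat k) \<sigma> * \<phi> (1 / of_nat n) (inv u \<circ> \<sigma>))"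
proof -
  have "(\<Sum>\<sigma>\<in>P. \<phi> (- 1 / of_nat k) \<sigma> * \<phi> (1 / of_nat n) (inv u \<circ> \<sigma>)) =
      (\<Sum>\<sigma>\<in>P. \<phi> (- 1 / of_nat k) (u \<circ> \<sigma>) * \<phi> (1 / of_nat n) (inv u \<circ> (u \<circ> \<sigma>)))"
    using assms by (rule P.sum_left[symmetric])
  then show ?thesis using assms by (simp add: \<Psi>_def)
qed

lemma \<Psi>_annihilated: "annihilated \<Psi>"
  unfolding annihilated_def
proof (intro conjI allI impI)
  have out: "\<Psi> (s \<circ> y) = 0" if "y \<notin> P" "s permutes X" "X \<subseteq> {0..<N}" for s y X
    using permutes_P[OF that(3,2)] that(1) \<Psi>_class by (simp add: class_function_def)
  fix X y
  {
    assume X: "X \<subseteq> {0..<N}" "card X = Suc k"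
    show "(\<Sum>s | s permutes X. \<Psi> (s \<circ> y)) = 0"
    proof (cases "y \<in> P")
      case True
      have "(\<Sum>s | s permutes X. \<Psi> (s \<circ> y)) =
          (\<Sum>\<sigma>\<in>P. \<Sum>s | s permutes X. \<phi> (- 1 / of_nat k) (s \<circ> y \<circ> \<sigma>) * \<phi> (1 / of_nat n) \<sigma>)"
        unfolding \<Psi>_def by (rule sum.swap)
      also have "\<dots> = (\<Sum>\<sigma>\<in>P. (\<Sum>s | s permutes X. \<phi> (- 1 / of_nat k) (y \<circ> \<sigma> \<circ> s)) * \<phi> (1 / of_nat n) \<sigma>)"
        unfolding sum_distrib_right
      proof (intro sum.cong refl)
        fix \<sigma> s assume s: "\<sigma> \<in> P" "s \<in> {s. s permutes X}"
        then have "s \<in> P" "y \<circ> \<sigma> \<in> P" using permutes_P[OF X(1)] True P.comp_G by auto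
        from class_function_commute[OF \<phi>_class this]
        show "\<phi> (- 1 / of_nat k) (s \<circ> y \<circ> \<sigma>) * \<phi> (1 / of_nat n) \<sigma> =
            \<phi> (- 1 / of_nat k) (y \<circ> \<sigma> \<circ> s) * \<phi> (1 / of_nat n) \<sigma>"
          by (simp add: comp_assoc)
      qed
      also have "\<dots> = 0"
        using \<phi>_coset_zero[OF X _ k] True P.comp_G by simp
      finally show ?thesis .
    qed (use X out in simp)
  next
    assume X: "X \<subseteq> {0..<N}" "card X = Suc n"
    interpret X: perm_group "{s. s permutes X}"
      using X finite_subset by (intro perm_group_permutes) blast
    show "(\<Sum>s | s permutes X. sgn_c s * \<Psi> (s \<circ> y)) = 0"
    proof (cases "y \<in> P")
      case True
      \<comment> \<open>\<open>\<Psi>_alt\<close> inverts its argument, so \<open>s\<close> is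
        inverted beforehand and appears uninverted in the second factor.\<close>
      have "(\<Sum>s | s permutes X. sgn_c s * \<Psi> (s \<circ> y)) =
          (\<Sum>s | s permutes X. sgn_c (inv s) * \<Psi> (inv s \<circ> y))"
        by (rule X.sum_inv[symmetric])
      also have "\<dots> = (\<Sum>s | s permutes X. \<Sum>\<sigma>\<in>P. \<phi> (- 1 / of_nat k) \<sigma> * (sgn_c s * \<phi> (1 / of_nat n) (\<sigma> \<circ> inv y \<circ> s)))"
      proof (intro sum.cong refl)
        fix s assume s: "s \<in> {s. s permutes X}"
        then have sP: "s \<in> P" using permutes_P[OF X(1)] by auto
        have "\<Psi> (inv s \<circ> y) = (\<Sum>\<sigma>\<in>P. \<phi> (- 1 / of_nat k) \<sigma> * \<phi> (1 / of_nat n) (inv y \<circ> s \<circ> \<sigma>))"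
          using \<Psi>_alt[of "inv s \<circ> y"] sP True by (simp add: P.comp_G P.inv_G inv_comp_P)
        also have "\<dots> = (\<Sum>\<sigma>\<in>P. \<phi> (- 1 / of_nat k) \<sigma> * \<phi> (1 / of_nat n) (\<sigma> \<circ> inv y \<circ> s))"
        proof (intro sum.cong refl)
          fix \<sigma> assume "\<sigma> \<in> P"
          moreover have "inv y \<circ> s \<in> P" using sP True P.comp_G P.inv_G by simp
          ultimately show "\<phi> (- 1 / of_nat k) \<sigma> * \<phi> (1 / of_nat n) (inv y \<circ> s \<circ> \<sigma>) =
              \<phi> (- 1 / of_nat k) \<sigma> * \<phi> (1 / of_nat n) (\<sigma> \<circ> inv y \<circ> s)"
            using class_function_commute[OF \<phi>_class, of \<sigma> "inv y \<circ> s"] by (simp add: comp_assoc)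
        qed
        finally show "sgn_c (inv s) * \<Psi> (inv s \<circ> y) =
            (\<Sum>\<sigma>\<in>P. \<phi> (- 1 / of_nat k) \<sigma> * (sgn_c s * \<phi> (1 / of_nat n) (\<sigma> \<circ> inv y \<circ> s)))"
          using sgn_c_inv[OF sP] by (simp add: sum_distrib_left mult.left_commute)
      qed
      also have "\<dots> = (\<Sum>\<sigma>\<in>P. \<phi> (- 1 / of_nat k) \<sigma> * (\<Sum>s | s permutes X. sgn_c s * \<phi> (1 / of_nat n) (\<sigma> \<circ> inv y \<circ> s)))"
        unfolding sum_distrib_left by (rule sum.swap)
      also have "\<dots> = 0"
        using \<phi>_sign_coset_zero[OF X _ n] True P.comp_G P.inv_G by simp
      finally show ?thesis .
    qed (use X out in simp)
  }
qed

lemma \<Psi>_inv: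
  assumes u: "u \<in> P"
  shows "\<Psi> (inv u) = \<Psi> u"
proof -
  have "\<Psi> (inv u) = (\<Sum>\<sigma>\<in>P. \<phi> (- 1 / of_nat k) (u \<circ> inv \<sigma>) * \<phi> (1 / of_nat n) (inv \<sigma>))"
    unfolding \<Psi>_def
  proof (intro sum.cong refl)
    fix \<sigma> assume s: "\<sigma> \<in> P"
    have "\<phi> a (inv u \<circ> \<sigma>) = \<phi> a (inv \<sigma> \<circ> u)" for a
      using \<phi>_inv[of "inv u \<circ> \<sigma>" a] s u by (simp add: P.comp_G P.inv_G inv_comp_P)
    moreover have "\<phi> a (inv \<sigma> \<circ> u) = \<phi> a (u \<circ> inv \<sigma>)" for a
      using class_function_commute[OF \<phi>_class P.inv_G[OF s] u] .
    ultimately show "\<phi> (- 1 / of_nat k) (inv u \<circ> \<sigma>) * \<phi> (1 / of_nat n) \<sigma> =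
        \<phi> (- 1 / of_nat k) (u \<circ> inv \<sigma>) * \<phi> (1 / of_nat n) (inv \<sigma>)"
      using s \<phi>_inv by simp
  qed
  also have "\<dots> = \<Psi> u" unfolding \<Psi>_def by (rule P.sum_inv)
  finally show ?thesis .
qed

text \<open>At the identity both factors are taken at the same \<sigma>, so the bases multiply to
  \<open>- 1 / (k * n)\<close>: this is the origin of the denominator of the formula.\<close>

lemma \<Psi>_id: "\<Psi> id = (\<Sum>\<sigma>\<in>P. (- 1 / of_nat N) ^ nu N \<sigma>)"
  unfolding \<Psi>_def by (intro sum.cong refl) (simp add: \<phi>_def N_def power_mult_distrib[symmetric])

lemma \<Psi>_id_nonzero: "\<Psi> id \<noteq> 0"
proof -
  have "\<Psi> id = (\<Prod>j<N. 1 + of_nat j * (- 1 / of_nat N))"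
    using sum_power_nu_permutes[of "{0..<N}" N "- 1 / of_nat N :: complex"]
    unfolding \<Psi>_id P_def by simp
  moreover have "1 + of_nat j * (- 1 / of_nat N) \<noteq> (0 :: complex)" if "j < N" for j
  proof
    assume "1 + of_nat j * (- 1 / of_nat N) = (0 :: complex)"
    then have "of_nat N = (of_nat j :: complex)" using that by (simp add: field_simps)
    then show False using that by (metis less_irrefl of_nat_eq_iff)
  qed
  ultimately show ?thesis by simp
qed

lemma alpha_det_ones: "alpha_det (- 1 / of_nat N) (ones N) = \<Psi> id"
proof -
  have "(\<Prod>i<N. ones N $$ (\<sigma> i, i)) = 1" if "\<sigma> permutes {0..<N}" for \<sigma>
    using permutes_in_image[OF that] by (intro prod.neutral) (auto simp: ones_def)
  then have "alpha_det (- 1 / of_nat N) (ones N) = (\<Sum>\<sigma> | \<sigma> permutes {0..<N}. (- 1 / of_nat N) ^ nu N \<sigma>)"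
    by (simp add: alpha_det_def Let_def ones_def)
  then show ?thesis by (simp add: \<Psi>_id P_def)
qed

lemma char_degree_rect: "char_degree (replicate n k) = E id / \<kappa>"
  using irr_char_rect[OF P.id_G] by (simp add: char_degree_def inv_id)

text \<open>\<Psi> and \<open>E\<close> are proportional and the identity fixes the scalar; \<kappa>
  is hidden in the degree, and the inverse in \<open>irr_char_rect\<close> disappears by
  \<open>\<Psi>_inv\<close>.\<close>

lemma irr_char_eq_\<Psi>:
  assumes "x \<in> P"
  shows "irr_char (replicate n k) x = char_degree (replicate n k) * \<Psi> x / \<Psi> id"
proof -
  have "\<Psi> (inv x) * E id = \<Psi> id * E (inv x)"
    by (rule class_function_proportional[OF \<Psi>_class \<Psi>_annihilated])
  then have "E (inv x) = \<Psi> x * E id / \<Psi> id"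
    using \<Psi>_inv[OF assms] \<Psi>_id_nonzero by (simp add: field_simps)
  then show ?thesis using irr_char_rect[OF assms] by (simp add: char_degree_rect mult.commute)
qed

section \<open>The alpha-beta-determinant as a sum of \<Psi> over a coset of the Young
  subgroup\<close>

lemma perm_matrix_mult_index:
  assumes g: "g \<in> P" and B: "dim_row B = N" "dim_col B = N" and ij: "i < N" "j < N"
  shows "(perm_matrix N g * B) $$ (i, j) = B $$ (inv g i, j)"
proof -
  have "inv g i < N" using ij P_less[OF P.inv_G[OF g]] by simp
  have "(perm_matrix N g * B) $$ (i, j) = (\<Sum>l = 0..<N. (if i = g l then 1 else 0) * B $$ (l, j))"
    using B ij by (simp add: perm_matrix_def scalar_prod_def)
  also have "\<dots> = (\<Sum>l = 0..<N. if l = inv g i then B $$ (l, j) else 0)"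
    using g by (intro sum.cong refl) auto
  also have "\<dots> = B $$ (inv g i, j)" using \<open>inv g i < N\<close> by simp
  finally show ?thesis .
qed

text \<open>Substitute \<open>\<tau> = g \<circ> h \<circ> \<sigma>\<close>: the permutation matrix
  cancels \<open>g\<close>, and the product of the entries becomes the indicator that
  \<open>h\<close> preserves the blocks.\<close>

lemma alpha_beta_det_ones_part:
  assumes g: "g \<in> P" and mu: "sum_list \<mu> = N"
  shows "alpha_beta_det (- 1 / of_nat k) (1 / of_nat n) (perm_matrix N g * ones_part \<mu>) =
    (\<Sum>h\<in>young_subgroup \<mu>. \<Psi> (g \<circ> h))"
proof -
  let ?a = "- 1 / of_nat k :: complex" and ?b = "1 / of_nat n :: complex"
  let ?S = "stab {0..<N} (block \<mu>)"
  have B: "dim_row (ones_part \<mu>) = N" "dim_col (ones_part \<mu>) = N"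
    and idx: "\<And>i j. i < N \<Longrightarrow> j < N \<Longrightarrow> ones_part \<mu> $$ (i, j) = (if block \<mu> i = block \<mu> j then 1 else 0)"
    using ones_part_index[of \<mu>] mu by auto
  have SP: "h \<in> P" if "h \<in> ?S" for h using stabD(1)[OF that] by (simp add: P_def)
  have prod: "(\<Prod>i<N. (perm_matrix N g * ones_part \<mu>) $$ ((g \<circ> h \<circ> \<sigma>) i, \<sigma> i)) = (if h \<in> ?S then 1 else 0)"
    if h: "h \<in> P" and s: "\<sigma> \<in> P" for h \<sigma>
  proof -
    have lt: "\<sigma> i < N" "h (\<sigma> i) < N" "(g \<circ> h \<circ> \<sigma>) i < N" if "i < N" for i
      using that P_less h s g by simp_all
    have e: "(perm_matrix N g * ones_part \<mu>) $$ ((g \<circ> h \<circ> \<sigma>) i, \<sigma> i) =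
        (if block \<mu> (h (\<sigma> i)) = block \<mu> (\<sigma> i) then 1 else 0)" if "i < N" for i
      using perm_matrix_mult_index[OF g B lt(3,1)[OF that]] idx[OF lt(2,1)[OF that]] g by simp
    show ?thesis
    proof (cases "h \<in> ?S")
      case True
      then have "block \<mu> (h x) = block \<mu> x" for x by (rule stabD(2))
      then show ?thesis using True e by simp
    next
      case False
      then obtain x where x: "x < N" "block \<mu> (h x) \<noteq> block \<mu> x"
        using h by (auto simp: stab_def P_def)
      have "inv \<sigma> x < N" using x P_less[OF P.inv_G[OF s]] by simp
      moreover have "\<sigma> (inv \<sigma> x) = x" using s by simp
      ultimately have "\<exists>i\<in>{..<N}. (perm_matrix N g * ones_part \<mu>) $$ ((g \<circ> h \<circ> \<sigma>) i, \<sigma> i) = 0"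
        using x e[of "inv \<sigma> x"] by (intro bexI[of _ "inv \<sigma> x"]) auto
      then show ?thesis using False by (simp add: prod_zero_iff)
    qed
  qed
  have dim: "dim_row (perm_matrix N g * ones_part \<mu>) = N" by (simp add: perm_matrix_def)
  have "alpha_beta_det ?a ?b (perm_matrix N g * ones_part \<mu>) =
     (\<Sum>\<tau>\<in>P. \<Sum>\<sigma>\<in>P. ?a ^ nu N \<tau> * ?b ^ nu N \<sigma> * (\<Prod>i<N. (perm_matrix N g * ones_part \<mu>) $$ (\<tau> i, \<sigma> i)))"
    unfolding alpha_beta_det_def Let_def dim P_def ..
  also have "\<dots> = (\<Sum>\<sigma>\<in>P. \<Sum>\<tau>\<in>P. ?a ^ nu N \<tau> * ?b ^ nu N \<sigma> * (\<Prod>i<N. (perm_matrix N g * ones_part \<mu>) $$ (\<tau> i, \<sigma> i)))"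
    by (rule sum.swap)
  also have "\<dots> = (\<Sum>\<sigma>\<in>P. \<Sum>h\<in>P. if h \<in> ?S then \<phi> ?a (g \<circ> h \<circ> \<sigma>) * \<phi> ?b \<sigma> else 0)"
  proof (rule sum.cong[OF refl])
    fix \<sigma> assume s: "\<sigma> \<in> P"
    let ?f = "\<lambda>\<tau>. ?a ^ nu N \<tau> * ?b ^ nu N \<sigma> * (\<Prod>i<N. (perm_matrix N g * ones_part \<mu>) $$ (\<tau> i, \<sigma> i))"
    have "sum ?f P = (\<Sum>h\<in>P. ?f (g \<circ> h))" by (rule P.sum_left[OF g, symmetric])
    also have "\<dots> = (\<Sum>h\<in>P. ?f (g \<circ> (h \<circ> \<sigma>)))" by (rule P.sum_right[OF s, symmetric])
    also have "\<dots> = (\<Sum>h\<in>P. if h \<in> ?S then \<phi> ?a (g \<circ> h \<circ> \<sigma>) * \<phi> ?b \<sigma> else 0)"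
    proof (rule sum.cong[OF refl])
      fix h assume h: "h \<in> P"
      have "g \<circ> h \<circ> \<sigma> \<in> P" using h g s P.comp_G by simp
      then show "?f (g \<circ> (h \<circ> \<sigma>)) = (if h \<in> ?S then \<phi> ?a (g \<circ> h \<circ> \<sigma>) * \<phi> ?b \<sigma> else 0)"
        using prod[OF h s] s by (simp add: \<phi>_def comp_assoc del: o_apply)
    qed
    finally show "sum ?f P = (\<Sum>h\<in>P. if h \<in> ?S then \<phi> ?a (g \<circ> h \<circ> \<sigma>) * \<phi> ?b \<sigma> else 0)" .
  qed
  also have "\<dots> = (\<Sum>h\<in>P. if h \<in> ?S then \<Psi> (g \<circ> h) else 0)"
    by (subst sum.swap) (auto simp: \<Psi>_def intro!: sum.cong simp del: o_apply)
  also have "\<dots> = (\<Sum>h\<in>?S. \<Psi> (g \<circ> h))"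
    using SP P.finite_G by (subst sum.inter_filter[symmetric]) (auto intro!: sum.cong)
  finally show ?thesis by (simp add: young_subgroup_block mu)
qed

lemma omega_rect:
  assumes g: "g \<in> P" and mu: "sum_list \<mu> = N"
  shows "omega (replicate n k) \<mu> g = char_degree (replicate n k) / of_nat (part_fact \<mu>) *
    (alpha_beta_det (- 1 / of_nat k) (1 / of_nat n) (perm_matrix N g * ones_part \<mu>) /
     alpha_det (- 1 / of_nat N) (ones N))"
proof -
  have "h \<in> P" if "h \<in> young_subgroup \<mu>" for h
    using that by (simp add: young_subgroup_def P_def mu)
  then have "(\<Sum>\<tau>\<in>young_subgroup \<mu>. irr_char (replicate n k) (g \<circ> \<tau>)) =
      (\<Sum>\<tau>\<in>young_subgroup \<mu>. char_degree (replicate n k) * \<Psi> (g \<circ> \<tau>) / \<Psi> id)"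
    using g P.comp_G by (intro sum.cong refl irr_char_eq_\<Psi>) simp
  then show ?thesis
    unfolding alpha_beta_det_ones_part[OF assms] alpha_det_ones omega_def
    by (simp add: sum_distrib_left sum_divide_distrib)
qed

end

section \<open>Invariants of the Young subgroup\<close>

context rectangle
begin

lemma comp_inv_eq_iff:
  assumes "a \<in> P"
  shows "f \<circ> inv a = g \<longleftrightarrow> f = g \<circ> a"
  using assms by (auto simp: comp_assoc)

lemma inv_comp_eq_iff:
  assumes "a \<in> P"
  shows "inv a \<circ> f = g \<longleftrightarrow> f = a \<circ> g"
  using assms by (auto simp: comp_assoc)

end

locale rectangle_weight = rectangle +
  fixes \<mu> :: "nat list"
  assumes mu: "sum_list \<mu> = N"
begin

definition S :: "(nat \<Rightarrow> nat) set" where "S = young_subgroup \<mu>"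

sublocale S: perm_group S
  unfolding S_def young_subgroup_block by (rule perm_group_stab) simp

text \<open>The filling of weight \<mu> in reading order. Entries start at 1 as in
  \<open>semistandard_tableaux\<close>; the value 0 outside the rectangle lets equality of functions
  express equality of fillings.\<close>

definition w :: "nat \<Rightarrow> nat" where "w b = (if b < N then Suc (block \<mu> b) else 0)"

lemma S_iff: "h \<in> S \<longleftrightarrow> h \<in> P \<and> w \<circ> h = w"
proof -
  have "(\<forall>x\<in>{0..<N}. block \<mu> (h x) = block \<mu> x) \<longleftrightarrow> w \<circ> h = w" if "h \<in> P"
    using P_less[OF that] by (auto simp: w_def fun_eq_iff)
  then show ?thesis by (auto simp: S_def young_subgroup_block mu stab_def P_def)
qed

lemma S_P: "h \<in> S \<Longrightarrow> h \<in> P" by (simp add: S_iff)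

definition W :: "(nat \<Rightarrow> nat) set" where "W = {w \<circ> x | x. x \<in> P}"

lemma finite_W: "finite W"
  unfolding W_def using P.finite_G by simp

lemma W_comp: "T \<in> W \<Longrightarrow> p \<in> P \<Longrightarrow> T \<circ> p \<in> W"
  unfolding W_def using P.comp_G by (auto simp: comp_assoc)

text \<open>The coefficient of \<open>U\<close> in \<open>T\<close> times \<open>c\<close>, where
  permutations act on fillings from the right by composition.\<close>

definition D :: "(nat \<Rightarrow> nat) \<Rightarrow> (nat \<Rightarrow> nat) \<Rightarrow> complex" where
  "D T U = (\<Sum>x\<in>P. c x * (if T \<circ> x = U then 1 else 0))"

text \<open>The map \<open>y \<mapsto> w \<circ> y\<close> identifies the cosets \<open>S y\<close> with the fillings of the rectangle of weight
  \<open>\<mu>\<close>; \<open>e T\<close> is the coset sum of \<open>T\<close> multiplied by the Young symmetrizer.\<close>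

definition e :: "(nat \<Rightarrow> nat) \<Rightarrow> (nat \<Rightarrow> nat) \<Rightarrow> complex" where
  "e T y = (if y \<in> P then D T (w \<circ> y) else 0)"

lemma D_eq: "D T U = (\<Sum>p\<in>Row. \<Sum>q\<in>Col. if T \<circ> p \<circ> q = U then sgn_c q else 0)"
  unfolding D_def sum_c_mult by (intro sum.cong refl) (simp add: comp_assoc)

text \<open>In the group algebra, \<open>e (w \<circ> x)\<close> is the sum of the Young subgroup,
  times \<open>x\<close>, times \<open>c\<close>; so it lies in the Specht module and is invariant
  under \<open>S\<close>.\<close>

lemma e_eq:
  assumes x: "x \<in> P"
  shows "e (w \<circ> x) = (\<lambda>z. \<Sum>h\<in>S. c (inv (h \<circ> x) \<circ> z))"
proof
  fix z
  show "e (w \<circ> x) z = (\<Sum>h\<in>S. c (inv (h \<circ> x) \<circ> z))"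
  proof (cases "z \<in> P")
    case False
    have "inv (h \<circ> x) \<circ> z \<notin> P" if "h \<in> S" for h
      using False comp_P_iff(1)[OF P.inv_G[OF P.comp_G[OF S_P[OF that] x]]] by blast
    then show ?thesis using False by (simp add: e_def c_outside)
  next
    case True
    have 1: "(\<Sum>h\<in>S. if inv (h \<circ> x) \<circ> z = u then 1 else 0) = (if w \<circ> x \<circ> u = w \<circ> z then 1 else 0 :: complex)"
      if u: "u \<in> P" for u
    proof -
      \<comment> \<open>The only candidate for \<open>h\<close> in the sum; it lies in
        \<open>S\<close> exactly if \<open>x \<circ> u\<close> and \<open>z\<close> give the same
        filling.\<close>
      let ?h = "z \<circ> inv (x \<circ> u)"
      have xu: "x \<circ> u \<in> P" using x u P.comp_G by simp
      have hP: "?h \<in> P" using True xu P.comp_G P.inv_G by simp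
      have "inv (h \<circ> x) \<circ> z = u \<longleftrightarrow> h = ?h" if "h \<in> S" for h
      proof -
        have hx: "h \<circ> x \<in> P" using S_P[OF that] x P.comp_G by simp
        have "inv (h \<circ> x) \<circ> z = u \<longleftrightarrow> z = h \<circ> (x \<circ> u)"
          unfolding inv_comp_eq_iff[OF hx] comp_assoc ..
        also have "\<dots> \<longleftrightarrow> ?h = h" unfolding comp_inv_eq_iff[OF xu] ..
        also have "\<dots> \<longleftrightarrow> h = ?h" by (rule eq_commute)
        finally show ?thesis .
      qed
      then have "(\<Sum>h\<in>S. if inv (h \<circ> x) \<circ> z = u then 1 else 0) = (\<Sum>h\<in>S. if h = ?h then 1 else 0 :: complex)"
        by (intro sum.cong refl) (simp del: o_apply)
      also have "\<dots> = (if ?h \<in> S then 1 else 0)" using S.finite_G by simp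
      also have "?h \<in> S \<longleftrightarrow> w \<circ> x \<circ> u = w \<circ> z"
      proof -
        have "w \<circ> ?h = w \<longleftrightarrow> w \<circ> z = w \<circ> (x \<circ> u)"
          unfolding o_assoc[of w z] comp_inv_eq_iff[OF xu] ..
        then show ?thesis using hP unfolding S_iff comp_assoc by auto
      qed
      finally show ?thesis .
    qed
    have "(\<Sum>h\<in>S. c (inv (h \<circ> x) \<circ> z)) = (\<Sum>h\<in>S. \<Sum>u\<in>P. c u * (if inv (h \<circ> x) \<circ> z = u then 1 else 0))"
    proof (intro sum.cong refl)
      fix h assume "h \<in> S"
      then have "inv (h \<circ> x) \<circ> z \<in> P" using True x S_P P.comp_G P.inv_G by simp
      then have "(\<Sum>u\<in>P. if inv (h \<circ> x) \<circ> z = u then c u else 0) = c (inv (h \<circ> x) \<circ> z)"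
        using P.finite_G by (simp del: o_apply)
      moreover have "c u * (if b then 1 else 0) = (if b then c u else 0)" for u b by simp
      ultimately show "c (inv (h \<circ> x) \<circ> z) = (\<Sum>u\<in>P. c u * (if inv (h \<circ> x) \<circ> z = u then 1 else 0))"
        by (simp del: o_apply)
    qed
    also have "\<dots> = (\<Sum>u\<in>P. c u * (\<Sum>h\<in>S. if inv (h \<circ> x) \<circ> z = u then 1 else 0))"
      unfolding sum_distrib_left by (rule sum.swap)
    also have "\<dots> = D (w \<circ> x) (w \<circ> z)"
      unfolding D_def using 1 by (intro sum.cong refl) (simp del: o_apply)
    finally show ?thesis using True by (simp add: e_def)
  qed
qed

definition V :: "((nat \<Rightarrow> nat) \<Rightarrow> complex) set" where "V = cfun.span (e ` W)"

text \<open>On \<open>V\<close>, summing over \<open>S\<close> on the left multiplies by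
  \<open>card S\<close>, and \<open>c\<close> on the right multiplies by \<kappa>; the divisor
  undoes both.\<close>

lemma V_projection:
  assumes "v \<in> V"
  shows "v = (\<lambda>z. \<Sum>y\<in>P. v y * (e (w \<circ> y) z / (of_nat (card S) * \<kappa>)))"
  using assms unfolding V_def
proof (rule linear_on_span[rotated])
  fix v assume "v \<in> e ` W"
  then obtain x where x: "x \<in> P" and v: "v = e (w \<circ> x)" by (auto simp: W_def)
  show "v = (\<lambda>z. \<Sum>y\<in>P. v y * (e (w \<circ> y) z / (of_nat (card S) * \<kappa>)))"
  proof
    fix z
    have "(\<Sum>y\<in>P. v y * e (w \<circ> y) z) =
        (\<Sum>y\<in>P. \<Sum>h\<in>S. \<Sum>h'\<in>S. c (inv (h \<circ> x) \<circ> y) * c (inv (h' \<circ> y) \<circ> z))"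
      unfolding v by (intro sum.cong refl) (simp add: e_eq x sum_product)
    also have "\<dots> = (\<Sum>h\<in>S. \<Sum>y\<in>P. \<Sum>h'\<in>S. c (inv (h \<circ> x) \<circ> y) * c (inv (h' \<circ> y) \<circ> z))"
      by (rule sum.swap)
    also have "\<dots> = (\<Sum>h\<in>S. \<Sum>h'\<in>S. \<Sum>y\<in>P. c (inv (h \<circ> x) \<circ> y) * c (inv (h' \<circ> y) \<circ> z))"
      by (intro sum.cong refl sum.swap)
    also have "\<dots> = (\<Sum>h\<in>S. \<Sum>h'\<in>S. \<kappa> * c (inv (h' \<circ> h \<circ> x) \<circ> z))"
    proof (intro sum.cong refl)
      fix h h' assume h: "h \<in> S" "h' \<in> S"
      have hP: "h \<in> P" "h' \<in> P" using h S_P by auto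
      have "inv (h' \<circ> y) \<circ> z = inv y \<circ> (inv h' \<circ> z)" if "y \<in> P" for y
        using hP that by (simp add: inv_comp_P comp_assoc)
      then have "(\<Sum>y\<in>P. c (inv (h \<circ> x) \<circ> y) * c (inv (h' \<circ> y) \<circ> z)) =
          (\<Sum>y\<in>P. c (inv (h \<circ> x) \<circ> y) * c (inv y \<circ> (inv h' \<circ> z)))"
        by (intro sum.cong refl) (simp del: o_apply)
      also have "\<dots> = \<kappa> * c (inv (h \<circ> x) \<circ> (inv h' \<circ> z))"
        using hP x P.comp_G by (intro c_convolution) simp
      also have "inv (h \<circ> x) \<circ> (inv h' \<circ> z) = inv (h' \<circ> h \<circ> x) \<circ> z"
        using hP x P.comp_G by (simp add: inv_comp_P comp_assoc)
      finally show "(\<Sum>y\<in>P. c (inv (h \<circ> x) \<circ> y) * c (inv (h' \<circ> y) \<circ> z)) = \<kappa> * c (inv (h' \<circ> h \<circ> x) \<circ> z)" .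
    qed
    also have "\<dots> = (\<Sum>h\<in>S. \<Sum>h'\<in>S. \<kappa> * c (inv (h' \<circ> x) \<circ> z))"
      by (intro sum.cong refl S.sum_right)
    also have "\<dots> = of_nat (card S) * \<kappa> * v z"
      unfolding v e_eq[OF x] by (simp add: sum_distrib_left mult.assoc)
    finally have "(\<Sum>y\<in>P. v y * e (w \<circ> y) z) = of_nat (card S) * \<kappa> * v z" .
    moreover have "of_nat (card S) * \<kappa> \<noteq> 0"
      using \<kappa>_nonzero S.finite_G S.id_G by (auto simp: card_eq_0_iff)
    ultimately show "v z = (\<Sum>y\<in>P. v y * (e (w \<circ> y) z / (of_nat (card S) * \<kappa>)))"
      by (simp add: sum_divide_distrib[symmetric] del: o_apply)
  qed
qed

text \<open>The trace of the identity on \<open>V\<close> is its dimension; computed through the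
  projection, it is the mean of the character over \<open>S\<close>.\<close>

lemma omega_id_eq_card_basis:
  assumes B: "cfun.independent B" "cfun.span B = V" "finite B"
  shows "omega (replicate n k) \<mu> id = of_nat (card B)"
proof -
  let ?m = "of_nat (card S) * \<kappa>"
  have "of_nat (card B) = (\<Sum>b\<in>B. cfun.representation B b b)"
    using cfun.representation_basis[OF B(1)] by simp
  also have "\<dots> = (\<Sum>y\<in>P. e (w \<circ> y) y / ?m)"
  proof (rule trace_via_projection[where T = "\<lambda>v. v" and Q = "\<lambda>y z. e (w \<circ> y) z / ?m", OF B P.finite_G])
    show "(\<lambda>z. e (w \<circ> y) z / ?m) \<in> V" if "y \<in> P" for y
    proof -
      have "e (w \<circ> y) \<in> V" unfolding V_def using that by (intro cfun.span_base) (auto simp: W_def)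
      then have "(\<lambda>z. 1 / ?m * e (w \<circ> y) z) \<in> V" unfolding V_def by (rule cfun.span_scale)
      then show ?thesis by simp
    qed
    show "v = (\<lambda>z. \<Sum>y\<in>P. v y * (e (w \<circ> y) z / ?m))" if "v \<in> V" for v
      using that by (rule V_projection)
    show "v \<in> V" if "v \<in> V" for v using that .
    show "(\<lambda>z. \<Sum>b\<in>B. f b * b z) = (\<lambda>z. \<Sum>b\<in>B. f b * b z)" for f by (rule refl)
  qed
  also have "\<dots> = (\<Sum>y\<in>P. \<Sum>h\<in>S. c (inv y \<circ> inv h \<circ> y)) / ?m"
    unfolding sum_divide_distrib[symmetric]
    by (intro arg_cong2[where f = "(/)"] sum.cong refl) (simp add: e_eq inv_comp_P S_P)
  also have "(\<Sum>y\<in>P. \<Sum>h\<in>S. c (inv y \<circ> inv h \<circ> y)) = (\<Sum>h\<in>S. E (inv h))"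
    unfolding E_def by (rule sum.swap)
  also have "\<dots> / ?m = (\<Sum>h\<in>S. irr_char (replicate n k) h) / of_nat (card S)"
    by (simp add: irr_char_rect S_P sum_divide_distrib mult.commute)
  finally show ?thesis
    by (simp add: omega_def S_def card_young_subgroup)
qed

section \<open>Relations between the elements \<open>e T\<close>\<close>

lemma e_row:
  assumes p: "p \<in> Row"
  shows "e (T \<circ> p) = e T"
proof -
  have "D (T \<circ> p) U = D T U" for U
  proof -
    have "D T U = (\<Sum>x\<in>P. c (p \<circ> x) * (if T \<circ> (p \<circ> x) = U then 1 else 0))"
      unfolding D_def by (rule P.sum_left[OF Row_P[OF p], symmetric])
    then show ?thesis unfolding D_def using c_row[OF p] by (simp add: comp_assoc del: o_apply)
  qed
  then show ?thesis by (simp add: e_def fun_eq_iff del: o_apply)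
qed

text \<open>\<open>c_kill_row\<close> carried over to fillings: Garnir relations without signs,
  because \<open>c\<close> is symmetric under rows on the left.\<close>

lemma e_garnir:
  assumes X: "X \<subseteq> {0..<N}" "card X = Suc k"
  shows "(\<Sum>s | s permutes X. e (T \<circ> s) z) = 0"
proof -
  interpret X: perm_group "{s. s permutes X}"
    using X finite_subset by (intro perm_group_permutes) blast
  have "(\<Sum>s | s permutes X. D (T \<circ> s) U) = 0" for U
  proof -
    let ?g = "\<lambda>x. if T \<circ> x = U then 1 else 0 :: complex"
    have "(\<Sum>s | s permutes X. D (T \<circ> s) U) = (\<Sum>s | s permutes X. \<Sum>x\<in>P. c (inv s \<circ> x) * ?g x)"
    proof (intro sum.cong refl)
      fix s assume "s \<in> {s. s permutes X}"
      then have s: "s \<in> P" using permutes_P[OF X(1)] by simp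
      have "(\<Sum>x\<in>P. c (inv s \<circ> x) * ?g x) = (\<Sum>x\<in>P. c (inv s \<circ> (s \<circ> x)) * ?g (s \<circ> x))"
        by (rule P.sum_left[OF s, symmetric])
      then show "D (T \<circ> s) U = (\<Sum>x\<in>P. c (inv s \<circ> x) * ?g x)"
        unfolding D_def using s by (simp add: comp_assoc del: o_apply)
    qed
    also have "\<dots> = (\<Sum>x\<in>P. (\<Sum>s | s permutes X. c (inv s \<circ> x)) * ?g x)"
      unfolding sum_distrib_right by (rule sum.swap)
    also have "\<dots> = (\<Sum>x\<in>P. (\<Sum>s | s permutes X. c (id \<circ> s \<circ> x)) * ?g x)"
      using X.sum_inv[of "\<lambda>s. c (s \<circ> x)" for x] by (simp del: o_apply)
    also have "\<dots> = 0" using c_kill_row[OF X] by (simp del: o_apply id_comp)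
    finally show ?thesis .
  qed
  then show ?thesis by (cases "z \<in> P") (simp_all add: e_def del: o_apply)
qed

end

section \<open>Straightening of fillings\<close>

text \<open>A sorted list is determined by its multiset of entries. \<open>a\<close> enumerates the
  boxes of one row or one column, which \<open>p\<close> only permutes.\<close>

lemma sorted_rearrangement:
  fixes T :: "'a \<Rightarrow> nat" and a :: "nat \<Rightarrow> 'a"
  assumes inj_a: "inj_on a {..<m}" and inj_p: "inj p" and sub: "p ` a ` {..<m} \<subseteq> a ` {..<m}"
    and mono1: "\<And>j. Suc j < m \<Longrightarrow> T (a j) \<le> T (a (Suc j))"
    and mono2: "\<And>j. Suc j < m \<Longrightarrow> T (p (a j)) \<le> T (p (a (Suc j)))"
    and j: "j < m"
  shows "T (p (a j)) = T (a j)"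
proof -
  let ?A = "a ` {..<m}"
  let ?xs = "map (\<lambda>j. T (a j)) [0..<m]" and ?ys = "map (\<lambda>j. T (p (a j))) [0..<m]"
  have "p ` ?A = ?A" using sub inj_p by (intro endo_inj_surj) (auto intro: inj_on_subset)
  then have pA: "image_mset p (mset_set ?A) = mset_set ?A"
    using image_mset_mset_set[OF inj_on_subset[OF inj_p subset_UNIV], of ?A] by simp
  have aA: "image_mset a (mset_set {..<m}) = mset_set ?A" by (rule image_mset_mset_set[OF inj_a])
  have "mset ?ys = image_mset T (image_mset p (image_mset a (mset_set {..<m})))"
    by (simp add: mset_upt atLeast0LessThan multiset.map_comp comp_def)
  also have "\<dots> = image_mset T (image_mset a (mset_set {..<m}))" by (simp add: aA pA)
  also have "\<dots> = mset ?xs"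
    by (simp add: mset_upt atLeast0LessThan multiset.map_comp comp_def)
  finally have "mset ?xs = mset ?ys" ..
  moreover have "sorted ?xs" "sorted ?ys"
    using mono1 mono2 by (auto simp: sorted_iff_nth_Suc)
  ultimately have "?xs = ?ys" by (metis properties_for_sort)
  then have "?xs ! j = ?ys ! j" by (rule arg_cong)
  then show ?thesis using j by simp
qed

lemma concat_nth_rect:
  assumes "\<forall>r\<in>set T. length r = k" "i < length T" "j < k"
  shows "concat T ! (i * k + j) = T ! i ! j"
  using assms
proof (induction T arbitrary: i)
  case (Cons r T)
  show ?case
  proof (cases i)
    case (Suc i')
    then have "concat (r # T) ! (i * k + j) = concat T ! (i' * k + j)"
      using Cons.prems(1) by (simp add: nth_append add.assoc)
    then show ?thesis using Cons Suc by simp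
  qed (use Cons.prems in \<open>simp add: nth_append\<close>)
qed simp

context rectangle
begin

section \<open>Statistics and orderings on fillings of the rectangle\<close>

lemma box_cases:
  assumes "b < N"
  obtains i j where "i < n" "j < k" "b = i * k + j"
  using row_less[OF assms] k that[of "b div k" "b mod k"] by simp

lemma box_div_mod: "j < k \<Longrightarrow> (i * k + j) div k = i" "j < k \<Longrightarrow> (i * k + j) mod k = j"
  by simp_all

text \<open>Weighted by the column index \<open>g\<close>, it is largest for sorted rows and gives
  triangularity; weighted by the row index, it orders the terms of a Garnir relation and gives
  termination of straightening.\<close>

definition stat :: "(nat \<Rightarrow> nat) \<Rightarrow> (nat \<Rightarrow> nat) \<Rightarrow> int" where
  "stat g T = (\<Sum>b\<in>{0..<N}. int (g b) * int (T b))"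

lemma stat_swap:
  assumes ab: "a < N" "b < N" "a \<noteq> b"
  shows "stat g (T \<circ> transpose a b) = stat g T + (int (g b) - int (g a)) * (int (T a) - int (T b))"
proof -
  have eq: "{0..<N} = insert a (insert b ({0..<N} - {a, b}))" using ab by auto
  have "stat g U = int (g a) * int (U a) + int (g b) * int (U b) + (\<Sum>x\<in>{0..<N} - {a, b}. int (g x) * int (U x))"
    for U unfolding stat_def by (subst eq) (use ab(3) in simp)
  moreover have "(\<Sum>x\<in>{0..<N} - {a, b}. int (g x) * int ((T \<circ> transpose a b) x)) =
      (\<Sum>x\<in>{0..<N} - {a, b}. int (g x) * int (T x))"
    by (intro sum.cong refl) (auto simp: transpose_def)
  ultimately show ?thesis by (simp add: algebra_simps)
qed

lemma stat_stab:
  assumes p: "p \<in> stab {0..<N} g"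
  shows "stat g (T \<circ> p) = stat g T"
proof -
  have "stat g T = (\<Sum>b\<in>{0..<N}. int (g (p b)) * int (T (p b)))"
    unfolding stat_def using sum.permute[OF stabD(1)[OF p], of "\<lambda>b. int (g b) * int (T b)"]
    by (simp add: comp_def)
  then show ?thesis by (simp add: stat_def stabD(2)[OF p])
qed

definition row_sorted :: "(nat \<Rightarrow> nat) \<Rightarrow> bool" where
  "row_sorted T \<longleftrightarrow> (\<forall>i j. i < n \<longrightarrow> Suc j < k \<longrightarrow> T (i * k + j) \<le> T (i * k + Suc j))"

definition col_strict :: "(nat \<Rightarrow> nat) \<Rightarrow> bool" where
  "col_strict T \<longleftrightarrow> (\<forall>i j. Suc i < n \<longrightarrow> j < k \<longrightarrow> T (i * k + j) < T (Suc i * k + j))"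

lemma row_sorted_mono:
  assumes "row_sorted T" "i < n" "j \<le> j'" "j' < k"
  shows "T (i * k + j) \<le> T (i * k + j')"
  using assms(3,4)
proof (induction j' rule: dec_induct)
  case (step m)
  then have "T (i * k + m) \<le> T (i * k + Suc m)" using assms(1,2) unfolding row_sorted_def by blast
  then show ?case using step by simp
qed simp

lemma row_sorted_unique:
  assumes "row_sorted T" "row_sorted (T \<circ> p)" "p \<in> Row"
  shows "T \<circ> p = T"
proof
  fix b
  note p = stabD[OF assms(3)[unfolded Row_def]]
  show "(T \<circ> p) b = T b"
  proof (cases "b < N")
    case False
    then show ?thesis using p(1) by (simp add: permutes_not_in)
  next
    case True
    then obtain i j where ij: "i < n" "j < k" "b = i * k + j" by (rule box_cases)
    have "p (i * k + j) \<in> (\<lambda>j. i * k + j) ` {..<k}" if "j < k" for j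
    proof -
      have "p (i * k + j) div k = i" using p(2) that by simp
      then have "p (i * k + j) = i * k + p (i * k + j) mod k" by (metis div_mult_mod_eq)
      then show ?thesis using k by (metis imageI lessThan_iff mod_less_divisor)
    qed
    then have "T (p (i * k + j)) = T (i * k + j)"
      using assms(1,2) ij permutes_inj[OF p(1)]
      by (intro sorted_rearrangement[where a = "\<lambda>j. i * k + j" and m = k])
        (auto simp: row_sorted_def inj_on_def)
    then show ?thesis using ij by simp
  qed
qed

lemma col_strict_unique:
  assumes "col_strict T" "col_strict (T \<circ> q)" "q \<in> Col"
  shows "T \<circ> q = T"
proof
  fix b
  note q = stabD[OF assms(3)[unfolded Col_def]]
  show "(T \<circ> q) b = T b"
  proof (cases "b < N")
    case False
    then show ?thesis using q(1) by (simp add: permutes_not_in)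
  next
    case True
    then obtain i j where ij: "i < n" "j < k" "b = i * k + j" by (rule box_cases)
    have "q (i * k + j) \<in> (\<lambda>i. i * k + j) ` {..<n}" if "i < n" for i
    proof -
      have "q (i * k + j) mod k = j" using q(2) ij by simp
      then have "q (i * k + j) = q (i * k + j) div k * k + j" by (metis div_mult_mod_eq)
      moreover have "q (i * k + j) < N"
        using P_less[OF Col_P[OF assms(3)]] box_less[OF that ij(2)] by simp
      ultimately show ?thesis using row_less by blast
    qed
    then have "T (q (i * k + j)) = T (i * k + j)"
      using assms(1,2) ij permutes_inj[OF q(1)] k
      by (intro sorted_rearrangement[where a = "\<lambda>i. i * k + j" and m = n])
        (auto simp: col_strict_def inj_on_def less_imp_le)
    then show ?thesis using ij by simp
  qed
qed

text \<open>At a descent, swapping the two neighbouring boxes would increase the statistic.\<close>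

lemma row_sorted_of_max:
  assumes p: "p \<in> Row" and max: "\<And>p'. p' \<in> Row \<Longrightarrow> stat (\<lambda>b. b mod k) (T \<circ> p') \<le> stat (\<lambda>b. b mod k) (T \<circ> p)"
  shows "row_sorted (T \<circ> p)"
  unfolding row_sorted_def
proof (intro allI impI)
  fix i j assume ij: "i < n" "Suc j < k"
  let ?a = "i * k + j" and ?b = "i * k + Suc j"
  have ab: "?a < N" "?b < N" "?a \<noteq> ?b" using ij box_less[of i j] box_less[of i "Suc j"] by auto
  have dm: "?a div k = i" "?b div k = i" "?a mod k = j" "?b mod k = Suc j"
    using ij box_div_mod[of j i] box_div_mod[of "Suc j" i] by auto
  have "transpose ?a ?b \<in> Row" unfolding Row_def using ab dm by (intro transpose_stab) auto
  then have "stat (\<lambda>b. b mod k) (T \<circ> (p \<circ> transpose ?a ?b)) \<le> stat (\<lambda>b. b mod k) (T \<circ> p)"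
    using p Row.comp_G max by blast
  then have "stat (\<lambda>b. b mod k) (T \<circ> p \<circ> transpose ?a ?b) \<le> stat (\<lambda>b. b mod k) (T \<circ> p)"
    by (simp only: comp_assoc)
  then show "(T \<circ> p) ?a \<le> (T \<circ> p) ?b"
    unfolding stat_swap[OF ab] dm by simp
qed

lemma row_max_exists:
  obtains p where "p \<in> Row" "\<And>p'. p' \<in> Row \<Longrightarrow> stat g (T \<circ> p') \<le> stat g (T \<circ> p)"
proof -
  let ?I = "(\<lambda>p. stat g (T \<circ> p)) ` Row"
  have fin: "finite ?I" "?I \<noteq> {}" using Row.finite_G Row.id_G by auto
  then have "Max ?I \<in> ?I" by (rule Max_in)
  then obtain p where "p \<in> Row" "stat g (T \<circ> p) = Max ?I" by auto
  then show ?thesis using that fin(1) by (metis Max_ge imageI)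
qed

text \<open>Maximisers exist and are sorted, and rows have only one sorted rearrangement; so a
  sorted filling is itself the unique maximiser.\<close>

lemma row_sorted_stat:
  assumes T: "row_sorted T" and p: "p \<in> Row"
  shows "stat (\<lambda>b. b mod k) (T \<circ> p) \<le> stat (\<lambda>b. b mod k) T"
    "stat (\<lambda>b. b mod k) (T \<circ> p) = stat (\<lambda>b. b mod k) T \<Longrightarrow> T \<circ> p = T"
proof -
  obtain r where r: "r \<in> Row" "\<And>p'. p' \<in> Row \<Longrightarrow> stat (\<lambda>b. b mod k) (T \<circ> p') \<le> stat (\<lambda>b. b mod k) (T \<circ> r)"
    using row_max_exists[of "\<lambda>b. b mod k" T] by metis
  have Tr: "T \<circ> r = T" using row_sorted_unique[OF T row_sorted_of_max[OF r] r(1)] .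
  then show "stat (\<lambda>b. b mod k) (T \<circ> p) \<le> stat (\<lambda>b. b mod k) T" using r(2)[OF p] by simp
  assume eq: "stat (\<lambda>b. b mod k) (T \<circ> p) = stat (\<lambda>b. b mod k) T"
  then have "row_sorted (T \<circ> p)" using r(2) Tr by (intro row_sorted_of_max[OF p]) simp
  then show "T \<circ> p = T" by (rule row_sorted_unique[OF T _ p])
qed

text \<open>The set of boxes \<open>{i k + j..Suc i k + j}\<close> consists of the end of row \<open>i\<close> and the beginning of
  row \<open>Suc i\<close>. If its entries in row \<open>i\<close> are all at least as large as those in row \<open>Suc i\<close>,
  then permuting it can only move large entries down.\<close>

lemma garnir_stat:
  assumes T: "row_sorted T" and ij: "Suc i < n" "j < k" and viol: "T (Suc i * k + j) \<le> T (i * k + j)"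
    and s: "s permutes {i * k + j..Suc i * k + j}"
  shows "stat (\<lambda>b. b div k) T \<le> stat (\<lambda>b. b div k) (T \<circ> s) \<and>
    (stat (\<lambda>b. b div k) (T \<circ> s) = stat (\<lambda>b. b div k) T \<longrightarrow> (\<exists>p\<in>Row. T \<circ> s = T \<circ> p))"
proof -
  let ?g = "\<lambda>b. b div k"
  define X where "X = {i * k + j..Suc i * k + j}"
  define A where "A = {i * k + j..<Suc i * k}"
  define C where "C = {Suc i * k..Suc i * k + j}"
  have XAC: "X = A \<union> C" "A \<inter> C = {}" using ij by (auto simp: X_def A_def C_def)
  have XN: "x < N" if "x \<in> X" for x using that box_less[OF ij] by (simp add: X_def)
  have A: "x div k = i" "T (i * k + j) \<le> T x" if "x \<in> A" for x
  proof -
    have "\<exists>j'. x = i * k + j' \<and> j \<le> j' \<and> j' < k"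
      using that by (intro exI[of _ "x - i * k"]) (auto simp: A_def)
    then obtain j' where "x = i * k + j'" "j \<le> j'" "j' < k" by blast
    then show "x div k = i" "T (i * k + j) \<le> T x" using row_sorted_mono[OF T _ \<open>j \<le> j'\<close>] ij by auto
  qed
  have C: "x div k = Suc i" "T x \<le> T (Suc i * k + j)" if "x \<in> C" for x
  proof -
    have "\<exists>j'. x = Suc i * k + j' \<and> j' \<le> j"
      using that by (intro exI[of _ "x - Suc i * k"]) (auto simp: C_def)
    then obtain j' where j': "x = Suc i * k + j'" "j' \<le> j" by blast
    then show "x div k = Suc i" using ij box_div_mod(1)[of j' "Suc i"] by simp
    show "T x \<le> T (Suc i * k + j)" using row_sorted_mono[OF T ij(1) j'(2) ij(2)] j'(1) by simp
  qed
  have "s permutes X \<Longrightarrow> stat ?g T \<le> stat ?g (T \<circ> s) \<and>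
    (stat ?g (T \<circ> s) = stat ?g T \<longrightarrow> (\<exists>p\<in>Row. T \<circ> s = T \<circ> p))" for s
  proof (induction "card {x \<in> C. s x \<in> A}" arbitrary: s rule: less_induct)
    case less
    note s = less.prems
    have inj: "inj s" using s by (rule permutes_inj)
    have sX: "s x \<in> X \<longleftrightarrow> x \<in> X" for x using s by (rule permutes_in_image)
    have fin: "finite A" "finite C" by (auto simp: A_def C_def)
    show "stat ?g T \<le> stat ?g (T \<circ> s) \<and> (stat ?g (T \<circ> s) = stat ?g T \<longrightarrow> (\<exists>p\<in>Row. T \<circ> s = T \<circ> p))"
    proof (cases "{x \<in> C. s x \<in> A} = {}")
      case True
      then have sC: "s ` C \<subseteq> C" using sX XAC by blast
      then have "s ` C = C" using fin inj by (intro endo_inj_surj) (auto intro: inj_on_subset)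
      have sA: "s x \<in> A" if "x \<in> A" for x
      proof -
        have "s x \<notin> C"
        proof
          assume "s x \<in> C"
          then obtain y where "y \<in> C" "s x = s y" using \<open>s ` C = C\<close> by blast
          then show False using inj that XAC by (auto dest: injD)
        qed
        then show ?thesis using sX that XAC by blast
      qed
      have "s x div k = x div k" for x
      proof -
        consider "x \<in> A" | "x \<in> C" | "x \<notin> X" using XAC by blast
        then show ?thesis
        proof cases
          case 1 then show ?thesis using sA A(1) by simp
        next
          case 2
          then have "s x \<in> C" using sC by blast
          then show ?thesis using 2 C(1) by simp
        next
          case 3 then show ?thesis using s by (simp add: permutes_not_in)
        qed
      qed
      moreover have "s permutes {0..<N}" using s by (rule permutes_subset) (auto dest: XN)
      ultimately have sR: "s \<in> Row" by (simp add: Row_def stab_def)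
      then have "stat ?g (T \<circ> s) = stat ?g T" unfolding Row_def by (rule stat_stab)
      then show ?thesis using sR by auto
    next
      case False
      then obtain x where x: "x \<in> C" "s x \<in> A" by blast
      obtain y where y: "y \<in> A" "s y \<in> C"
      proof (rule ccontr)
        assume "\<not> thesis"
        then have "s y \<notin> C" if "y \<in> A" for y using that \<open>\<And>y. \<lbrakk>y \<in> A; s y \<in> C\<rbrakk> \<Longrightarrow> thesis\<close> by blast
        then have "s ` A \<subseteq> A" using sX XAC by blast
        then have "s ` A = A" using fin inj by (intro endo_inj_surj) (auto intro: inj_on_subset)
        then obtain z where "z \<in> A" "s x = s z" using x by blast
        then show False using inj x XAC by (auto dest: injD)
      qed
      have xy: "x < N" "y < N" "x \<noteq> y" using x y XAC XN by auto
      \<comment> \<open>\<open>s\<close> sends \<open>x\<close> and \<open>y\<close> into each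
        other's row. The transposition undoes this crossing and lowers the induction
        measure.\<close>
      define s' where "s' = s \<circ> transpose x y"
      have s': "s' permutes X"
        unfolding s'_def using x y XAC s by (intro permutes_compose permutes_swap_id) auto
      have "{z \<in> C. s' z \<in> A} = {z \<in> C. s z \<in> A} - {x}"
        using x y XAC by (auto simp: s'_def transpose_def)
      then have "card {z \<in> C. s' z \<in> A} < card {z \<in> C. s z \<in> A}"
        using x fin by (simp add: card_Diff1_less del: card_Diff_insert)
      from less.hyps[OF this s']
      have IH: "stat ?g T \<le> stat ?g (T \<circ> s')" "stat ?g (T \<circ> s') = stat ?g T \<Longrightarrow> \<exists>p\<in>Row. T \<circ> s' = T \<circ> p"
        by auto
      have le: "T (s y) \<le> T (s x)" using C(2)[OF y(2)] A(2)[OF x(2)] viol by simp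
      have "stat ?g (T \<circ> s \<circ> transpose x y) = stat ?g (T \<circ> s) +
          (int (y div k) - int (x div k)) * (int ((T \<circ> s) x) - int ((T \<circ> s) y))"
        by (rule stat_swap[OF xy])
      then have st: "stat ?g (T \<circ> s') = stat ?g (T \<circ> s) - (int (T (s x)) - int (T (s y)))"
        using A(1)[OF y(1)] C(1)[OF x(1)] by (simp add: s'_def comp_assoc[symmetric])
      show ?thesis
      proof (intro conjI impI)
        show "stat ?g T \<le> stat ?g (T \<circ> s)" using IH(1) st le by simp
        assume "stat ?g (T \<circ> s) = stat ?g T"
        then have "T (s x) = T (s y)" "stat ?g (T \<circ> s') = stat ?g T" using IH(1) st le by auto
        then have "T \<circ> s' = T \<circ> s" by (auto simp: s'_def fun_eq_iff transpose_def)
        then show "\<exists>p\<in>Row. T \<circ> s = T \<circ> p" using IH(2) \<open>stat ?g (T \<circ> s') = stat ?g T\<close> by simp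
      qed
    qed
  qed
  then show ?thesis using s by (simp add: X_def)
qed

end

context rectangle_weight
begin

section \<open>The semistandard fillings give a basis of the invariants\<close>

definition SST :: "(nat \<Rightarrow> nat) set" where
  "SST = {T \<in> W. row_sorted T \<and> col_strict T}"

lemma finite_SST: "finite SST"
  unfolding SST_def using finite_W by simp

text \<open>Take a counterexample with the largest row statistic and sort its rows, which changes
  neither \<open>e\<close> nor the statistic. At a column violation, every term of the Garnir
  relation either equals \<open>e U\<close> or has larger statistic and so lies in the span.\<close>

lemma e_in_span:
  assumes "T \<in> W"
  shows "e T \<in> cfun.span (e ` SST)"
proof (rule ccontr)
  let ?g = "\<lambda>b. b div k" and ?H = "cfun.span (e ` SST)"
  let ?bad = "{T \<in> W. e T \<notin> ?H}"
  assume "e T \<notin> ?H"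
  then have bad: "finite (stat ?g ` ?bad)" "stat ?g ` ?bad \<noteq> {}" using assms finite_W by auto
  then have "Max (stat ?g ` ?bad) \<in> stat ?g ` ?bad" by (rule Max_in)
  then obtain T0 where T0: "T0 \<in> ?bad" "stat ?g T0 = Max (stat ?g ` ?bad)" by auto
  have good: "e U \<in> ?H" if "U \<in> W" "stat ?g U > stat ?g T0" for U
  proof (rule ccontr)
    assume "e U \<notin> ?H"
    then have "stat ?g U \<le> stat ?g T0" unfolding T0(2) using that bad(1) by (intro Max_ge) auto
    then show False using that by simp
  qed
  obtain p where p: "p \<in> Row" "\<And>p'. p' \<in> Row \<Longrightarrow> stat (\<lambda>b. b mod k) (T0 \<circ> p') \<le> stat (\<lambda>b. b mod k) (T0 \<circ> p)"
    using row_max_exists[of "\<lambda>b. b mod k" T0] by metis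
  define U where "U = T0 \<circ> p"
  have sorted: "row_sorted U" unfolding U_def by (rule row_sorted_of_max[OF p])
  have UW: "U \<in> W" using T0(1) p(1) Row_P by (simp add: U_def W_comp)
  have eU: "e U = e T0" using e_row[OF p(1)] by (simp add: U_def)
  have statU: "stat ?g U = stat ?g T0" unfolding U_def using p(1) by (intro stat_stab) (simp add: Row_def)
  have "U \<notin> SST"
  proof
    assume "U \<in> SST"
    then have "e U \<in> ?H" by (intro cfun.span_base) blast
    then show False using eU T0(1) by simp
  qed
  then obtain i j where ij: "Suc i < n" "j < k" and viol: "U (Suc i * k + j) \<le> U (i * k + j)"
    using UW sorted by (auto simp: SST_def col_strict_def not_less)
  let ?X = "{i * k + j..Suc i * k + j}"
  let ?Eq = "{s. s permutes ?X \<and> stat ?g (U \<circ> s) = stat ?g U}"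
  let ?Gt = "{s. s permutes ?X \<and> stat ?g (U \<circ> s) \<noteq> stat ?g U}"
  have X: "?X \<subseteq> {0..<N}" "card ?X = Suc k" using box_less[OF ij] by auto
  have fin: "finite {s. s permutes ?X}" by (rule finite_permutations) simp
  have eq: "e (U \<circ> s) = e U" if "s \<in> ?Eq" for s
  proof -
    obtain p where "p \<in> Row" "U \<circ> s = U \<circ> p"
      using garnir_stat[OF sorted ij viol, of s] \<open>s \<in> ?Eq\<close> by auto
    then show ?thesis using e_row by simp
  qed
  have gt: "e (U \<circ> s) \<in> ?H" if s: "s \<in> ?Gt" for s
  proof (rule good)
    show "U \<circ> s \<in> W" using UW permutes_P[OF X(1)] s by (intro W_comp) auto
    show "stat ?g (U \<circ> s) > stat ?g T0"
      using garnir_stat[OF sorted ij viol, of s] s statU by auto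
  qed
  have "of_nat (card ?Eq) * e U z + (\<Sum>s\<in>?Gt. e (U \<circ> s) z) = 0" for z
  proof -
    have "(\<Sum>s | s permutes ?X. e (U \<circ> s) z) = (\<Sum>s\<in>?Eq. e (U \<circ> s) z) + (\<Sum>s\<in>?Gt. e (U \<circ> s) z)"
      using fin by (subst sum.union_disjoint[symmetric]) (auto intro!: sum.cong)
    moreover have "(\<Sum>s\<in>?Eq. e (U \<circ> s) z) = of_nat (card ?Eq) * e U z"
      using eq by (simp del: o_apply)
    ultimately show ?thesis using e_garnir[OF X, of U z] by simp
  qed
  \<comment> \<open>The relation has no signs, so the copies of \<open>e U\<close> cannot cancel;
    the identity supplies at least one.\<close>
  moreover have "card ?Eq \<noteq> 0"
  proof -
    have "id \<in> ?Eq" by (simp add: permutes_id)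
    moreover have "finite ?Eq" using fin by (rule rev_finite_subset) auto
    ultimately show ?thesis unfolding card_eq_0_iff by blast
  qed
  ultimately have "e U z = - 1 / of_nat (card ?Eq) * (\<Sum>s\<in>?Gt. e (U \<circ> s)) z" for z
    unfolding sum_apply by (simp add: field_simps eq_neg_iff_add_eq_0 del: o_apply)
  then have "e U = (\<lambda>z. - 1 / of_nat (card ?Eq) * (\<Sum>s\<in>?Gt. e (U \<circ> s)) z)" by blast
  moreover have "(\<lambda>z. - 1 / of_nat (card ?Eq) * (\<Sum>s\<in>?Gt. e (U \<circ> s)) z) \<in> ?H"
    using gt by (intro cfun.span_scale cfun.span_sum) blast
  ultimately have "e U \<in> ?H" by simp
  then show False using eU T0(1) by simp
qed

lemma span_SST: "cfun.span (e ` SST) = V"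
proof
  show "cfun.span (e ` SST) \<subseteq> V"
    unfolding V_def by (intro cfun.span_mono) (auto simp: SST_def)
  show "V \<subseteq> cfun.span (e ` SST)"
    unfolding V_def using e_in_span by (intro cfun.span_minimal cfun.subspace_span) auto
qed

text \<open>A column permutation preserves the column statistic, and a row permutation cannot raise
  it above that of the sorted \<open>T\<close>. In case of equality \<open>p\<close> fixes
  \<open>T\<close>, and strict columns admit only one rearrangement.\<close>

lemma SST_rearrangement:
  assumes "T \<in> SST" "U \<in> SST" "p \<in> Row" "q \<in> Col" "T \<circ> p \<circ> q = U"
  shows "stat (\<lambda>b. b mod k) U \<le> stat (\<lambda>b. b mod k) T"
    "stat (\<lambda>b. b mod k) U = stat (\<lambda>b. b mod k) T \<Longrightarrow> T \<circ> p = T \<and> U = T"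
proof -
  have "stat (\<lambda>b. b mod k) U = stat (\<lambda>b. b mod k) (T \<circ> p)"
    using assms(4,5) stat_stab[of q "\<lambda>b. b mod k" "T \<circ> p"] by (simp add: Col_def)
  moreover have T: "row_sorted T" "col_strict T" and U: "col_strict U" using assms by (auto simp: SST_def)
  ultimately show "stat (\<lambda>b. b mod k) U \<le> stat (\<lambda>b. b mod k) T"
    using row_sorted_stat(1)[OF T(1) assms(3)] by simp
  assume "stat (\<lambda>b. b mod k) U = stat (\<lambda>b. b mod k) T"
  then have "T \<circ> p = T"
    using row_sorted_stat(2)[OF T(1) assms(3)] \<open>stat _ U = stat _ (T \<circ> p)\<close> by simp
  then have "T \<circ> q = U" using assms(5) by simp
  then have "U = T" using col_strict_unique[OF T(2) _ assms(4)] U by simp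
  then show "T \<circ> p = T \<and> U = T" using \<open>T \<circ> p = T\<close> by simp
qed

lemma D_zero:
  assumes "T \<in> SST" "U \<in> SST" "T \<noteq> U" "stat (\<lambda>b. b mod k) T \<le> stat (\<lambda>b. b mod k) U"
  shows "D T U = 0"
proof -
  have "T \<circ> p \<circ> q \<noteq> U" if "p \<in> Row" "q \<in> Col" for p q
    using SST_rearrangement[OF assms(1,2) that] assms(3,4) by fastforce
  then show ?thesis unfolding D_eq by (simp add: sum.neutral del: o_apply)
qed

text \<open>Strict columns have distinct entries, which forces \<open>q = id\<close>. All surviving
  terms are then 1, one for each row permutation that fixes \<open>T\<close>.\<close>

lemma D_diag:
  assumes T: "T \<in> SST"
  shows "D T T \<noteq> 0"
proof -
  have strict: "col_strict T" using T by (simp add: SST_def)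
  have mono: "T (i * k + j) < T (i' * k + j)" if "i < i'" "i' < n" "j < k" for i i' j
    using that(1,2)
  proof (induction i' rule: less_induct)
    case (less i')
    then obtain m where m: "i' = Suc m" by (cases i') auto
    then have "T (m * k + j) < T (Suc m * k + j)" using strict less that unfolding col_strict_def by blast
    then show ?case using less.IH[of m] less.prems m by (cases "i = m") auto
  qed
  have fixq: "q = id" if q: "q \<in> Col" and Tq: "T \<circ> q = T" for q
  proof
    fix b
    note q' = stabD[OF q[unfolded Col_def]]
    show "q b = id b"
    proof (cases "b < N")
      case True
      then obtain i j where ij: "i < n" "j < k" "b = i * k + j" by (rule box_cases)
      have qb: "q b < N" using True P_less[OF Col_P[OF q]] by simp
      then obtain i' j' where ij': "i' < n" "j' < k" "q b = i' * k + j'" by (rule box_cases)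
      have "j' = j" using q'(2)[of b] ij ij' by simp
      moreover have "T (q b) = T b" using Tq by (metis o_apply)
      ultimately have "i' = i" using mono[of i i' j] mono[of i' i j] ij ij' by (cases i i' rule: linorder_cases) auto
      then show ?thesis using \<open>j' = j\<close> ij ij' by simp
    qed (use q'(1) in \<open>simp add: permutes_not_in\<close>)
  qed
  have "T \<circ> p \<circ> q = T \<longleftrightarrow> T \<circ> p = T \<and> q = id" if "p \<in> Row" "q \<in> Col" for p q
  proof
    assume *: "T \<circ> p \<circ> q = T"
    then have "T \<circ> p = T" using SST_rearrangement(2)[OF T T that *] by simp
    then show "T \<circ> p = T \<and> q = id" using * fixq that by simp
  qed simp
  then have "D T T = (\<Sum>p\<in>Row. \<Sum>q\<in>Col. if T \<circ> p = T \<and> q = id then sgn_c q else 0)"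
    unfolding D_eq by (intro sum.cong refl) (simp del: o_apply)
  also have "\<dots> = (\<Sum>p\<in>Row. if T \<circ> p = T then 1 else 0)"
  proof (rule sum.cong[OF refl])
    fix p
    show "(\<Sum>q\<in>Col. if T \<circ> p = T \<and> q = id then sgn_c q else 0) = (if T \<circ> p = T then 1 else 0)"
      using Col.finite_G Col.id_G by (cases "T \<circ> p = T") (simp_all del: o_apply)
  qed
  also have "\<dots> = of_nat (card {p \<in> Row. T \<circ> p = T})"
    using Row.finite_G by (simp add: sum.If_cases Int_def del: o_apply)
  finally show ?thesis
    using Row.finite_G Row.id_G by (auto simp: card_eq_0_iff)
qed

lemma e_value: "U \<in> W \<Longrightarrow> \<exists>y. \<forall>T. e T y = D T U"
  by (auto simp: W_def e_def)

text \<open>Needed to count the basis by fillings. For two different fillings, one of the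
  off-diagonal values vanishes by \<open>D_zero\<close>, whereas both diagonal values are
  nonzero.\<close>

lemma e_inj: "inj_on e SST"
proof (rule inj_onI, rule ccontr)
  fix T U assume TU: "T \<in> SST" "U \<in> SST" "e T = e U" "T \<noteq> U"
  obtain y where "\<forall>R. e R y = D R U" using e_value[of U] TU by (auto simp: SST_def)
  then have "D T U = D U U" using TU(3) by metis
  moreover obtain y where "\<forall>R. e R y = D R T" using e_value[of T] TU by (auto simp: SST_def)
  then have "D U T = D T T" using TU(3) by metis
  ultimately show False
    using D_zero[OF TU(1,2,4)] D_zero[OF TU(2,1)] TU(4) D_diag[OF TU(1)] D_diag[OF TU(2)]
    by (metis linorder_linear)
qed

text \<open>Evaluate a relation at a \<open>y\<close> whose filling has the largest column statistic
  among those with nonzero coefficient: by \<open>D_zero\<close> only the diagonal term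
  remains.\<close>

lemma e_independent: "cfun.independent (e ` SST)"
proof
  let ?st = "stat (\<lambda>b. b mod k)"
  assume "cfun.dependent (e ` SST)"
  then obtain u where u: "\<exists>v\<in>e ` SST. u v \<noteq> 0" "(\<Sum>v\<in>e ` SST. (\<lambda>y. u v * v y)) = 0"
    using cfun.dependent_finite[of "e ` SST"] finite_SST by auto
  let ?N = "{T \<in> SST. u (e T) \<noteq> 0}"
  have fin: "finite (?st ` ?N)" "?st ` ?N \<noteq> {}" using finite_SST u(1) by auto
  then have "Max (?st ` ?N) \<in> ?st ` ?N" by (rule Max_in)
  then obtain U where U: "U \<in> ?N" "?st U = Max (?st ` ?N)" by auto
  have max: "?st T \<le> ?st U" if "T \<in> ?N" for T unfolding U(2) using that fin by (intro Max_ge) auto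
  obtain y where y: "\<forall>R. e R y = D R U" using e_value[of U] U by (auto simp: SST_def)
  have "(\<Sum>T\<in>SST. u (e T) * D T U) = (\<Sum>v\<in>e ` SST. (\<lambda>y. u v * v y)) y"
    unfolding sum_apply using y by (simp add: sum.reindex[OF e_inj])
  also have "\<dots> = 0" using u(2) by simp
  finally have "0 = (\<Sum>T\<in>SST. u (e T) * D T U)" by simp
  also have "\<dots> = (\<Sum>T\<in>SST. if T = U then u (e U) * D U U else 0)"
  proof (intro sum.cong refl)
    fix T assume T: "T \<in> SST"
    show "u (e T) * D T U = (if T = U then u (e U) * D U U else 0)"
    proof (cases "T = U \<or> u (e T) = 0")
      case False
      then have "D T U = 0" using T U max by (intro D_zero) auto
      then show ?thesis using False by simp
    qed auto
  qed
  also have "\<dots> = u (e U) * D U U" using U finite_SST by simp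
  finally show False using U D_diag by auto
qed

lemma omega_id_eq_card_SST: "omega (replicate n k) \<mu> id = of_nat (card SST)"
  using omega_id_eq_card_basis[OF e_independent span_SST] finite_SST card_image[OF e_inj] by simp

section \<open>Fillings as lists of rows, and the Kostka number\<close>

lemma W_iff:
  "T \<in> W \<longleftrightarrow> (\<forall>b\<ge>N. T b = 0) \<and> (\<forall>b<N. T b \<in> {1..length \<mu>}) \<and>
    (\<forall>i<length \<mu>. card {b \<in> {0..<N}. T b = Suc i} = \<mu> ! i)"
proof -
  have w_card: "card {b \<in> {0..<N}. w b = Suc i} = \<mu> ! i" if "i < length \<mu>" for i
  proof -
    have "{b \<in> {0..<N}. w b = Suc i} = row_set \<mu> i"
      unfolding row_set_block[OF that] mu by (auto simp: w_def)
    then show ?thesis by (simp add: row_set_def Let_def)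
  qed
  have w_range: "w b \<in> {1..length \<mu>}" if "b < N" for b
    using block_less[of b \<mu>] that mu by (simp add: w_def Suc_le_eq)
  show ?thesis
  proof
    assume "T \<in> W"
    then obtain x where x: "x \<in> P" and T: "T = w \<circ> x" by (auto simp: W_def)
    have "card {b \<in> {0..<N}. T b = Suc i} = \<mu> ! i" if "i < length \<mu>" for i
    proof -
      have "x ` {b \<in> {0..<N}. T b = Suc i} = {b \<in> {0..<N}. w b = Suc i}"
      proof (intro equalityI subsetI)
        fix b assume "b \<in> {b \<in> {0..<N}. w b = Suc i}"
        then have "inv x b \<in> {b \<in> {0..<N}. T b = Suc i}" "b = x (inv x b)"
          using x P_less[OF P.inv_G[OF x]] by (auto simp: T)
        then show "b \<in> x ` {b \<in> {0..<N}. T b = Suc i}" by blast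
      qed (use P_less[OF x] in \<open>auto simp: T\<close>)
      moreover have "inj_on x {b \<in> {0..<N}. T b = Suc i}"
        by (rule inj_on_subset[OF bij_is_inj[OF P.bij_G[OF x]] subset_UNIV])
      ultimately show ?thesis using w_card[OF that] card_image[of x "{b \<in> {0..<N}. T b = Suc i}"] by simp
    qed
    moreover have "T b = 0" if "b \<ge> N" for b
      using P_less[OF x, of b] that by (simp add: T w_def)
    moreover have "T b \<in> {1..length \<mu>}" if "b < N" for b
      using w_range P_less[OF x, of b] that by (simp add: T)
    ultimately show "(\<forall>b\<ge>N. T b = 0) \<and> (\<forall>b<N. T b \<in> {1..length \<mu>}) \<and>
      (\<forall>i<length \<mu>. card {b \<in> {0..<N}. T b = Suc i} = \<mu> ! i)" by blast
  next
    assume R: "(\<forall>b\<ge>N. T b = 0) \<and> (\<forall>b<N. T b \<in> {1..length \<mu>}) \<and>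
      (\<forall>i<length \<mu>. card {b \<in> {0..<N}. T b = Suc i} = \<mu> ! i)"
    \<comment> \<open>The colour 0 lies in the range that \<open>colouring_permutes\<close>
      inspects; inside the rectangle neither filling uses it.\<close>
    have cards: "card {b \<in> {0..<N}. w b = i} = card {b \<in> {0..<N}. T b = i}" if i: "i < Suc (length \<mu>)" for i
    proof (cases i)
      case 0
      have "{b \<in> {0..<N}. w b = 0} = {}" "{b \<in> {0..<N}. T b = 0} = {}"
        using w_range R by fastforce+
      then show ?thesis using 0 by (simp only:)
    next
      case (Suc i')
      then show ?thesis using R w_card[of i'] i by simp
    qed
    have colours: "w b < Suc (length \<mu>)" "T b < Suc (length \<mu>)" if "b \<in> {0..<N}" for b
      using w_range[of b] R that by auto
    obtain x where x: "x permutes {0..<N}" "\<And>b. b \<in> {0..<N} \<Longrightarrow> T b = w (x b)"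
      by (rule colouring_permutes[OF finite_atLeastLessThan colours cards]) (assumption | rule that)+
    have "T b = w (x b)" for b
      using x R by (cases "b < N") (auto simp: w_def permutes_not_in)
    then have "T = w \<circ> x" by auto
    then show "T \<in> W" using x by (auto simp: W_def P_def)
  qed
qed

text \<open>Concatenating the rows lists the boxes in the order of the letters
  \<open>i * k + j\<close>; the value 0 outside agrees with the convention of
  \<open>w\<close>.\<close>

definition fill :: "nat list list \<Rightarrow> nat \<Rightarrow> nat" where
  "fill R b = (if b < N then concat R ! b else 0)"

definition unfill :: "(nat \<Rightarrow> nat) \<Rightarrow> nat list list" where
  "unfill T = map (\<lambda>i. map (\<lambda>j. T (i * k + j)) [0..<k]) [0..<n]"

lemma fill_nth:
  assumes "map length R = replicate n k" "i < n" "j < k"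
  shows "fill R (i * k + j) = R ! i ! j"
proof -
  have len: "length R = n" using assms(1) by (metis length_map length_replicate)
  have "length r = k" if "r \<in> set R" for r
    using arg_cong[OF assms(1), of set] that n by auto
  then show ?thesis using concat_nth_rect[of R k i j] len assms box_less[of i j] by (simp add: fill_def)
qed

lemma fill_tableau:
  assumes R: "map length R = replicate n k"
  shows "R \<in> semistandard_tableaux (replicate n k) \<mu> \<longleftrightarrow> fill R \<in> SST"
proof -
  have len: "length R = n" using R by (metis length_map length_replicate)
  have rlen: "length (R ! i) = k" if "i < n" for i
    using arg_cong[OF R, of "\<lambda>xs. xs ! i"] that len by simp
  have clen: "length (concat R) = N" by (simp add: length_concat R N_eq)
  have cf: "concat R ! b = fill R b" if "b < N" for b using that by (simp add: fill_def)
  have rows: "(\<forall>row\<in>set R. sorted row) \<longleftrightarrow> row_sorted (fill R)"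
  proof -
    have "(\<forall>row\<in>set R. sorted row) \<longleftrightarrow> (\<forall>i<n. \<forall>j. Suc j < k \<longrightarrow> R ! i ! j \<le> R ! i ! Suc j)"
      by (auto simp: all_set_conv_all_nth len sorted_iff_nth_Suc rlen)
    also have "\<dots> \<longleftrightarrow> row_sorted (fill R)"
      unfolding row_sorted_def using fill_nth[OF R] by (metis Suc_lessD)
    finally show ?thesis .
  qed
  have cols: "(\<forall>i j. Suc i < length R \<and> j < length (R ! i) \<and> j < length (R ! Suc i) \<longrightarrow> R ! i ! j < R ! Suc i ! j)
      \<longleftrightarrow> col_strict (fill R)"
  proof -
    have "(\<forall>i j. Suc i < length R \<and> j < length (R ! i) \<and> j < length (R ! Suc i) \<longrightarrow> R ! i ! j < R ! Suc i ! j) \<longleftrightarrow>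
        (\<forall>i j. Suc i < n \<longrightarrow> j < k \<longrightarrow> R ! i ! j < R ! Suc i ! j)"
      using rlen len by auto
    also have "\<dots> \<longleftrightarrow> col_strict (fill R)"
      unfolding col_strict_def using fill_nth[OF R] by (metis Suc_lessD)
    finally show ?thesis .
  qed
  have range: "set (concat R) \<subseteq> {1..length \<mu>} \<longleftrightarrow> (\<forall>b<N. fill R b \<in> {1..length \<mu>})"
    unfolding subset_iff in_set_conv_nth clen using cf by metis
  have count: "count_list (concat R) m = card {b \<in> {0..<N}. fill R b = m}" for m
  proof -
    have "count_list (concat R) m = card {b. b < length (concat R) \<and> m = concat R ! b}"
      by (simp only: count_list_eq_length_filter length_filter_conv_card)
    also have "{b. b < length (concat R) \<and> m = concat R ! b} = {b \<in> {0..<N}. fill R b = m}"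
      unfolding clen using cf by auto
    finally show ?thesis .
  qed
  have "\<forall>b\<ge>N. fill R b = 0" by (simp add: fill_def)
  then show ?thesis
    unfolding semistandard_tableaux_def SST_def mem_Collect_eq W_iff
    using R rows cols range count by auto
qed

lemma kostka_eq_card_SST: "kostka (replicate n k) \<mu> = card SST"
proof -
  have shape: "map length (unfill T) = replicate n k" for T
    by (simp add: unfill_def map_replicate_const comp_def)
  have fu: "fill (unfill T) = T" if "T \<in> SST" for T
  proof
    fix b
    show "fill (unfill T) b = T b"
    proof (cases "b < N")
      case True
      then obtain i j where "i < n" "j < k" "b = i * k + j" by (rule box_cases)
      then show ?thesis using fill_nth[OF shape, of i j T] by (simp add: unfill_def)
    next
      case False
      then show ?thesis using that by (simp add: fill_def SST_def W_iff)
    qed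
  qed
  have uf: "unfill (fill R) = R" if R: "map length R = replicate n k" for R
  proof -
    have len: "length R = n" using R by (metis length_map length_replicate)
    have rlen: "length (R ! i) = k" if "i < n" for i
      using arg_cong[OF R, of "\<lambda>xs. xs ! i"] that len by simp
    show ?thesis
      by (rule nth_equalityI) (auto simp: unfill_def len rlen fill_nth[OF R] intro!: nth_equalityI)
  qed
  have sh: "map length R = replicate n k" if "R \<in> semistandard_tableaux (replicate n k) \<mu>" for R
    using that by (simp add: semistandard_tableaux_def)
  have "bij_betw fill (semistandard_tableaux (replicate n k) \<mu>) SST"
  proof (rule bij_betw_byWitness[where f' = unfill])
    show "\<forall>R\<in>semistandard_tableaux (replicate n k) \<mu>. unfill (fill R) = R" using uf sh by blast
    show "\<forall>T\<in>SST. fill (unfill T) = T" using fu by blast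
    show "fill ` semistandard_tableaux (replicate n k) \<mu> \<subseteq> SST" using fill_tableau sh by blast
    show "unfill ` SST \<subseteq> semistandard_tableaux (replicate n k) \<mu>"
      using fill_tableau[OF shape] fu by auto
  qed
  then show ?thesis unfolding kostka_def by (rule bij_betw_same_card)
qed

end

theorem corollary5p1:
  fixes k n :: nat and \<mu> :: "nat list"
  assumes "0 < k" and "0 < n" and "is_partition (k * n) \<mu>"
  shows "(\<forall>g. g permutes {0..<k * n} \<longrightarrow>
            omega (replicate n k) \<mu> g =
              char_degree (replicate n k) / of_nat (part_fact \<mu>) *
              (alpha_beta_det (- 1 / of_nat k) (1 / of_nat n) (perm_matrix (k * n) g * ones_part \<mu>) /
               alpha_det (- 1 / of_nat (k * n)) (ones (k * n)))) \<and>
         of_nat (kostka (replicate n k) \<mu>) =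
           char_degree (replicate n k) / of_nat (part_fact \<mu>) *
           (alpha_beta_det (- 1 / of_nat k) (1 / of_nat n) (ones_part \<mu>) /
            alpha_det (- 1 / of_nat (k * n)) (ones (k * n)))"
proof -
  have mu: "sum_list \<mu> = k * n" using assms(3) by (simp add: is_partition_def)
  interpret R: rectangle k n using assms(1,2) by unfold_locales
  have N: "R.N = k * n" by (rule R.N_def)
  interpret W: rectangle_weight k n \<mu> using mu N by unfold_locales simp
  have omega: "omega (replicate n k) \<mu> g =
      char_degree (replicate n k) / of_nat (part_fact \<mu>) *
      (alpha_beta_det (- 1 / of_nat k) (1 / of_nat n) (perm_matrix (k * n) g * ones_part \<mu>) /
       alpha_det (- 1 / of_nat (k * n)) (ones (k * n)))" if "g permutes {0..<k * n}" for g
    using R.omega_rect[of g \<mu>] that mu by (simp add: R.P_def N)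
  \<comment> \<open>The Kostka formula is the case \<open>g = id\<close>, where the permutation
    matrix drops out.\<close>
  have "perm_matrix (k * n) id * ones_part \<mu> = ones_part \<mu>"
  proof -
    have "perm_matrix (k * n) id = 1\<^sub>m (k * n)" by (auto simp: perm_matrix_def)
    moreover have "ones_part \<mu> \<in> carrier_mat (k * n) (k * n)" using ones_part_index[of \<mu>] mu by auto
    ultimately show ?thesis by simp
  qed
  moreover have "of_nat (kostka (replicate n k) \<mu>) = omega (replicate n k) \<mu> id"
    using W.omega_id_eq_card_SST W.kostka_eq_card_SST by simp
  ultimately show ?thesis using omega omega[OF permutes_id] by simp
qed

end
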